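(* Let $V$ be a non-trivial holomorphic vertex operator algebra of CFT type. Then $V$ is not classically free.
   Context: Everything is over $\mathbb{C}$ and $\mathbb{N}=\{0,1,2,\dots\}$. A vertex algebra is a (purely even) vector space $V$ with $\mathbf 1\in V$ and a linear map $a\mapsto Y(a,z)=\sum_{n\in\mathbb{Z}}a_{(n)}z^{-n-1}$, $a_{(n)}\in\operatorname{End}V$, such that for all $a,b,c\in V$: $a_{(n)}b=0$ for $n\gg0$; $Y(\mathbf 1,z)=\mathrm{id}$, $a_{(n)}\mathbf 1=0$ for $n\ge0$, $a_{(-1)}\mathbf 1=a$; and the Borcherds identity holds: for all $m,n,k\in\mathbb{Z}$, $\sum_{j\ge0}\binom mj(a_{(n+j)}b)_{(m+k-j)}c=\sum_{j\ge0}(-1)^j\binom nj\big(a_{(m+n-j)}b_{(k+j)}c-(-1)^n b_{(n+k-j)}a_{(m+j)}c\big)$. Put $Ta=a_{(-2)}\mathbf 1$. It is graded if equipped with a diagonalizable operator $H$ such that $[H,Y(a,z)]=z\partial_zY(a,z)+Y(Ha,z)$, and $\mathbb{N}$-graded if moreover the eigenvalues of $H$ lie in $\mathbb{N}$; write $V_n=\ker(H-n)$ and $\deg a=n$ for (homogeneous) $a\in V_n$. A vertex operator algebra (VOA) is a graded vertex algebra $V$ with a distinguished $\omega\in V_2$, $Y(\omega,z)=\sum_nL_nz^{-n-2}$, such that $L_{-1}=T$, $L_0=H$ and $[L_m,L_n]=(m-n)L_{m+n}+\delta_{m+n,0}\frac{m^3-m}{12}c\,\mathrm{id}$ for a constant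 $c$. A VOA is of CFT type if it is $\mathbb{N}$-graded and $V_0=\mathbb{C}\mathbf 1$. Non-trivial means $V\ne\mathbb{C}\mathbf 1$. An admissible $V$-module is a (weak) $V$-module $M=\bigoplus_{n\in\mathbb{N}}M_n$ with $a_{(k)}M_n\subseteq M_{n+\deg a-k-1}$ for $a$ homogeneous. $V$ is rational if every admissible $V$-module is a direct sum of simple admissible $V$-modules. $V$ is holomorphic if it is rational and $V$ itself is the unique simple admissible $V$-module up to isomorphism. Li filtration: $F^pV=\operatorname{span}\{a^1_{(-n_1-1)}\cdots a^r_{(-n_r-1)}\mathbf 1\mid a^i\in V,\ n_i\ge0,\ n_1+\cdots+n_r\ge p\}$. Set $R_V=V/F^1V$ and $\operatorname{gr}V=\bigoplus_{p\ge0}F^pV/F^{p+1}V$. The operation $(a,b)\mapsto a_{(-1)}b$ induces a commutative associative multiplication on $\operatorname{gr}V$, and $\partial(a+F^{p+1}V)=Ta+F^{p+2}V$ for $a\in F^pV$ makes it a differential algebra (unital commutative algebra with a derivation), generated as a differential algebra by its degree-zero part $R_V$. For a unital commutative $\mathbb{C}$-algebra $R$, the jet algebra $\mathcal{J}_\infty R$ is the differential algebra with an algebra map $j:R\to\mathcal{J}_\infty R$ such that every algebra homomorphism from $R$ to a differential algebra $A$ factors uniquely through $j$ by a differential algebra homomorphism $\mathcal{J}_\infty R\to A$. $V$ is classically free if the canonical surjection $\mathcal{J}_\infty R_V\to\operatorname{gr}V$ induced by $R_V\subseteq\operatorname{gr}V$ is an isomorphism. *)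

theory Defs
  imports
    "HOL-Library.Groups_Big_Fun"
    "HOL-Library.Function_Algebras"
    "HOL-Algebra.Module"
    "HOL-Algebra.Algebraic_Closure_Type"
begin

section \<open>Differential algebras and jet algebras\<close>

abbreviation complex_ring :: "complex ring"
  where "complex_ring \<equiv> ring_of_type_algebra"

record ('a, 'b) diff_algebra = "('a, 'b) module" +
  deriv :: "'b \<Rightarrow> 'b"

locale diff_algebra = algebra complex_ring A
  for A :: "(complex, 'a, 'm) diff_algebra_scheme" (structure) +
  assumes deriv_closed: "x \<in> carrier A \<Longrightarrow> deriv A x \<in> carrier A"
    and deriv_add: "\<lbrakk>x \<in> carrier A; y \<in> carrier A\<rbrakk>
      \<Longrightarrow> deriv A (x \<oplus> y) = deriv A x \<oplus> deriv A y"
    and deriv_smult: "x \<in> carrier A \<Longrightarrow> deriv A (c \<odot> x) = c \<odot> deriv A x"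
    and deriv_mult: "\<lbrakk>x \<in> carrier A; y \<in> carrier A\<rbrakk>
      \<Longrightarrow> deriv A (x \<otimes> y) = (deriv A x \<otimes> y) \<oplus> (x \<otimes> deriv A y)"

definition algebra_hom ::
    "(complex, 'a, 'm) module_scheme \<Rightarrow> (complex, 'b, 'n) module_scheme \<Rightarrow> ('a \<Rightarrow> 'b) set"
  where "algebra_hom A B = {h \<in> ring_hom A B.
     \<forall>c. \<forall>x\<in>carrier A. h (c \<odot>\<^bsub>A\<^esub> x) = c \<odot>\<^bsub>B\<^esub> h x}"

definition diff_algebra_hom ::
    "(complex, 'a, 'm) diff_algebra_scheme \<Rightarrow> (complex, 'b, 'n) diff_algebra_scheme \<Rightarrow> ('a \<Rightarrow> 'b) set"
  where "diff_algebra_hom A B = {h \<in> algebra_hom A B.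
     \<forall>x\<in>carrier A. h (deriv A x) = deriv B (h x)}"

text \<open>
  The jet algebra of \<open>R\<close> is presented by generators and relations: terms built from the elements
  of \<open>R\<close> by the differential algebra operations, modulo the congruence generated by the axioms of
  unital commutative differential algebras and by the relations saying that \<open>JGen\<close> is a
  homomorphism of algebras. (\<open>JGen\<close> of the zero and the one of \<open>R\<close> serve as zero and one.)
  Theorems \<open>jet_algebra_diff_algebra\<close>, \<open>jet_incl_hom\<close> and \<open>jet_algebra_universal\<close> below
  show that it has the defining universal property.
\<close>

datatype (jgens: 'r) jet_term =
    JGen 'r
  | JScale complex "'r jet_term"
  | JAdd "'r jet_term" "'r jet_term"
  | JMult "'r jet_term" "'r jet_term"
  | JDeriv "'r jet_term"

definition jet_terms :: "(complex, 'r, 'm) module_scheme \<Rightarrow> 'r jet_term set"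
  where "jet_terms R = {t. jgens t \<subseteq> carrier R}"

inductive_set jet_rel ::
    "(complex, 'r, 'm) module_scheme \<Rightarrow> ('r jet_term \<times> 'r jet_term) set"
  for R :: "(complex, 'r, 'm) module_scheme"
where
  refl: "t \<in> jet_terms R \<Longrightarrow> (t, t) \<in> jet_rel R"
| sym: "(s, t) \<in> jet_rel R \<Longrightarrow> (t, s) \<in> jet_rel R"
| trans: "\<lbrakk>(s, t) \<in> jet_rel R; (t, u) \<in> jet_rel R\<rbrakk> \<Longrightarrow> (s, u) \<in> jet_rel R"
| cong_scale: "(s, t) \<in> jet_rel R \<Longrightarrow> (JScale c s, JScale c t) \<in> jet_rel R"
| cong_add: "\<lbrakk>(s, t) \<in> jet_rel R; (s', t') \<in> jet_rel R\<rbrakk>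
    \<Longrightarrow> (JAdd s s', JAdd t t') \<in> jet_rel R"
| cong_mult: "\<lbrakk>(s, t) \<in> jet_rel R; (s', t') \<in> jet_rel R\<rbrakk>
    \<Longrightarrow> (JMult s s', JMult t t') \<in> jet_rel R"
| cong_deriv: "(s, t) \<in> jet_rel R \<Longrightarrow> (JDeriv s, JDeriv t) \<in> jet_rel R"
| add_assoc: "\<lbrakk>s \<in> jet_terms R; t \<in> jet_terms R; u \<in> jet_terms R\<rbrakk>
    \<Longrightarrow> (JAdd (JAdd s t) u, JAdd s (JAdd t u)) \<in> jet_rel R"
| add_comm: "\<lbrakk>s \<in> jet_terms R; t \<in> jet_terms R\<rbrakk>
    \<Longrightarrow> (JAdd s t, JAdd t s) \<in> jet_rel R"
| add_zero: "t \<in> jet_terms R \<Longrightarrow> (JAdd (JGen \<zero>\<^bsub>R\<^esub>) t, t) \<in> jet_rel R"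
| add_inverse: "t \<in> jet_terms R
    \<Longrightarrow> (JAdd (JScale (-1) t) t, JGen \<zero>\<^bsub>R\<^esub>) \<in> jet_rel R"
| scale_add_left: "t \<in> jet_terms R
    \<Longrightarrow> (JScale (c + d) t, JAdd (JScale c t) (JScale d t)) \<in> jet_rel R"
| scale_add_right: "\<lbrakk>s \<in> jet_terms R; t \<in> jet_terms R\<rbrakk>
    \<Longrightarrow> (JScale c (JAdd s t), JAdd (JScale c s) (JScale c t)) \<in> jet_rel R"
| scale_scale: "t \<in> jet_terms R
    \<Longrightarrow> (JScale (c * d) t, JScale c (JScale d t)) \<in> jet_rel R"
| scale_one: "t \<in> jet_terms R \<Longrightarrow> (JScale 1 t, t) \<in> jet_rel R"
| mult_assoc: "\<lbrakk>s \<in> jet_terms R; t \<in> jet_terms R; u \<in> jet_terms R\<rbrakk>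
    \<Longrightarrow> (JMult (JMult s t) u, JMult s (JMult t u)) \<in> jet_rel R"
| mult_comm: "\<lbrakk>s \<in> jet_terms R; t \<in> jet_terms R\<rbrakk>
    \<Longrightarrow> (JMult s t, JMult t s) \<in> jet_rel R"
| mult_one: "t \<in> jet_terms R \<Longrightarrow> (JMult (JGen \<one>\<^bsub>R\<^esub>) t, t) \<in> jet_rel R"
| mult_add: "\<lbrakk>s \<in> jet_terms R; t \<in> jet_terms R; u \<in> jet_terms R\<rbrakk>
    \<Longrightarrow> (JMult (JAdd s t) u, JAdd (JMult s u) (JMult t u)) \<in> jet_rel R"
| mult_scale: "\<lbrakk>s \<in> jet_terms R; t \<in> jet_terms R\<rbrakk>
    \<Longrightarrow> (JMult (JScale c s) t, JScale c (JMult s t)) \<in> jet_rel R"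
| deriv_add: "\<lbrakk>s \<in> jet_terms R; t \<in> jet_terms R\<rbrakk>
    \<Longrightarrow> (JDeriv (JAdd s t), JAdd (JDeriv s) (JDeriv t)) \<in> jet_rel R"
| deriv_scale: "t \<in> jet_terms R
    \<Longrightarrow> (JDeriv (JScale c t), JScale c (JDeriv t)) \<in> jet_rel R"
| deriv_mult: "\<lbrakk>s \<in> jet_terms R; t \<in> jet_terms R\<rbrakk>
    \<Longrightarrow> (JDeriv (JMult s t), JAdd (JMult (JDeriv s) t) (JMult s (JDeriv t))) \<in> jet_rel R"
| gen_add: "\<lbrakk>r \<in> carrier R; r' \<in> carrier R\<rbrakk>
    \<Longrightarrow> (JGen (r \<oplus>\<^bsub>R\<^esub> r'), JAdd (JGen r) (JGen r')) \<in> jet_rel R"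
| gen_scale: "r \<in> carrier R \<Longrightarrow> (JGen (c \<odot>\<^bsub>R\<^esub> r), JScale c (JGen r)) \<in> jet_rel R"
| gen_mult: "\<lbrakk>r \<in> carrier R; r' \<in> carrier R\<rbrakk>
    \<Longrightarrow> (JGen (r \<otimes>\<^bsub>R\<^esub> r'), JMult (JGen r) (JGen r')) \<in> jet_rel R"

definition jet_class :: "(complex, 'r, 'm) module_scheme \<Rightarrow> 'r jet_term \<Rightarrow> 'r jet_term set"
  where "jet_class R t = jet_rel R `` {t}"

definition jet_algebra ::
    "(complex, 'r, 'm) module_scheme \<Rightarrow> (complex, 'r jet_term set) diff_algebra"
  where "jet_algebra R = \<lparr>
     carrier = jet_terms R // jet_rel R,
     monoid.mult = (\<lambda>A B. \<Union>s\<in>A. \<Union>t\<in>B. jet_class R (JMult s t)),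
     one = jet_class R (JGen \<one>\<^bsub>R\<^esub>),
     ring.zero = jet_class R (JGen \<zero>\<^bsub>R\<^esub>),
     add = (\<lambda>A B. \<Union>s\<in>A. \<Union>t\<in>B. jet_class R (JAdd s t)),
     module.smult = (\<lambda>c A. \<Union>t\<in>A. jet_class R (JScale c t)),
     deriv = (\<lambda>A. \<Union>t\<in>A. jet_class R (JDeriv t)) \<rparr>"

definition jet_incl :: "(complex, 'r, 'm) module_scheme \<Rightarrow> 'r \<Rightarrow> 'r jet_term set"
  where "jet_incl R r = jet_class R (JGen r)"

lemma jet_terms_simps [simp]:
  "JGen r \<in> jet_terms R \<longleftrightarrow> r \<in> carrier R"
  "JScale c t \<in> jet_terms R \<longleftrightarrow> t \<in> jet_terms R"
  "JAdd s t \<in> jet_terms R \<longleftrightarrow> s \<in> jet_terms R \<and> t \<in> jet_terms R"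
  "JMult s t \<in> jet_terms R \<longleftrightarrow> s \<in> jet_terms R \<and> t \<in> jet_terms R"
  "JDeriv t \<in> jet_terms R \<longleftrightarrow> t \<in> jet_terms R"
  by (auto simp: jet_terms_def)

context
  fixes R :: "(complex, 'r, 'm) module_scheme"
  assumes R: "algebra complex_ring R"
begin

interpretation R: algebra complex_ring R by (rule R)

lemma scalar_carrier: "c \<in> carrier complex_ring"
  by (simp add: ring_of_type_algebra_def)

lemma jet_rel_terms: "(s, t) \<in> jet_rel R \<Longrightarrow> s \<in> jet_terms R \<and> t \<in> jet_terms R"
  by (induction rule: jet_rel.induct) (auto intro: R.smult_closed scalar_carrier)

lemma jet_rel_equiv: "equiv (jet_terms R) (jet_rel R)"
  by (rule equivI) (auto intro!: refl_onI symI transI intro: jet_rel.intros dest: jet_rel_terms)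

lemma jet_class_eq_iff:
  assumes "s \<in> jet_terms R" "t \<in> jet_terms R"
  shows "jet_class R s = jet_class R t \<longleftrightarrow> (s, t) \<in> jet_rel R"
  unfolding jet_class_def using eq_equiv_class_iff[OF jet_rel_equiv] assms by blast

lemma jet_class_carrier: "t \<in> jet_terms R \<Longrightarrow> jet_class R t \<in> carrier (jet_algebra R)"
  by (simp add: jet_algebra_def jet_class_def quotientI)

lemma jet_carrierE:
  assumes "x \<in> carrier (jet_algebra R)"
  obtains t where "t \<in> jet_terms R" "x = jet_class R t"
  using assms by (auto simp: jet_algebra_def jet_class_def elim: quotientE)

lemma jet_one: "\<one>\<^bsub>jet_algebra R\<^esub> = jet_class R (JGen \<one>\<^bsub>R\<^esub>)"
  and jet_zero: "\<zero>\<^bsub>jet_algebra R\<^esub> = jet_class R (JGen \<zero>\<^bsub>R\<^esub>)"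
  by (simp_all add: jet_algebra_def)

lemma jet_class_binop:
  assumes c: "\<And>s t s' t'. \<lbrakk>(s, t) \<in> jet_rel R; (s', t') \<in> jet_rel R\<rbrakk> \<Longrightarrow> (f s s', f t t') \<in> jet_rel R"
    and s: "s \<in> jet_terms R" and t: "t \<in> jet_terms R"
  shows "(\<Union>a\<in>jet_class R s. \<Union>b\<in>jet_class R t. jet_class R (f a b)) = jet_class R (f s t)"
proof -
  have "jet_class R (f a b) = jet_class R (f s t)"
    if "a \<in> jet_class R s" "b \<in> jet_class R t" for a b
    using that c[of s a t b] equiv_class_eq[OF jet_rel_equiv]
    by (metis Image_singleton_iff jet_class_def)
  moreover have "s \<in> jet_class R s" "t \<in> jet_class R t"
    using s t by (auto simp: jet_class_def intro: jet_rel.refl)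
  ultimately show ?thesis by blast
qed

lemma jet_class_unop:
  assumes c: "\<And>s t. (s, t) \<in> jet_rel R \<Longrightarrow> (f s, f t) \<in> jet_rel R"
    and s: "s \<in> jet_terms R"
  shows "(\<Union>a\<in>jet_class R s. jet_class R (f a)) = jet_class R (f s)"
proof -
  have "jet_class R (f a) = jet_class R (f s)" if "a \<in> jet_class R s" for a
    using that c[of s a] equiv_class_eq[OF jet_rel_equiv]
    by (metis Image_singleton_iff jet_class_def)
  moreover have "s \<in> jet_class R s"
    using s by (auto simp: jet_class_def intro: jet_rel.refl)
  ultimately show ?thesis by blast
qed

lemma jet_mult: "\<lbrakk>s \<in> jet_terms R; t \<in> jet_terms R\<rbrakk>
    \<Longrightarrow> jet_class R s \<otimes>\<^bsub>jet_algebra R\<^esub> jet_class R t = jet_class R (JMult s t)"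
  and jet_add: "\<lbrakk>s \<in> jet_terms R; t \<in> jet_terms R\<rbrakk>
    \<Longrightarrow> jet_class R s \<oplus>\<^bsub>jet_algebra R\<^esub> jet_class R t = jet_class R (JAdd s t)"
  and jet_smult: "t \<in> jet_terms R
    \<Longrightarrow> c \<odot>\<^bsub>jet_algebra R\<^esub> jet_class R t = jet_class R (JScale c t)"
  and jet_deriv: "t \<in> jet_terms R
    \<Longrightarrow> deriv (jet_algebra R) (jet_class R t) = jet_class R (JDeriv t)"
  unfolding jet_algebra_def
  by (simp_all add: jet_class_binop[of JMult] jet_class_binop[of JAdd] jet_class_unop[of "JScale c"]
      jet_class_unop[of JDeriv] jet_rel.cong_mult jet_rel.cong_add jet_rel.cong_scale
      jet_rel.cong_deriv)

lemmas jet_ops = jet_one jet_zero jet_mult jet_add jet_smult jet_deriv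

lemma jet_cring: "cring (jet_algebra R)"
proof (rule cringI)
  show "abelian_group (jet_algebra R)"
  proof (rule abelian_groupI; (elim jet_carrierE)?)
    fix x t assume t: "t \<in> jet_terms R" "x = jet_class R t"
    have "jet_class R (JScale (-1) t) \<oplus>\<^bsub>jet_algebra R\<^esub> x = \<zero>\<^bsub>jet_algebra R\<^esub>"
      using t by (simp add: jet_ops jet_class_eq_iff jet_rel.add_inverse)
    then show "\<exists>y\<in>carrier (jet_algebra R). y \<oplus>\<^bsub>jet_algebra R\<^esub> x = \<zero>\<^bsub>jet_algebra R\<^esub>"
      using t by (intro bexI[of _ "jet_class R (JScale (-1) t)"]) (simp_all add: jet_class_carrier)
  qed (simp_all add: jet_ops jet_class_eq_iff jet_class_carrier
      jet_rel.add_assoc jet_rel.add_comm jet_rel.add_zero)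
  show "Group.comm_monoid (jet_algebra R)"
    by (rule comm_monoidI; (elim jet_carrierE)?)
      (simp_all add: jet_ops jet_class_eq_iff jet_class_carrier
        jet_rel.mult_assoc jet_rel.mult_comm jet_rel.mult_one)
qed (elim jet_carrierE, simp add: jet_ops jet_class_eq_iff jet_rel.mult_add)

theorem jet_algebra_diff_algebra: "diff_algebra (jet_algebra R)"
proof -
  have alg: "algebra complex_ring (jet_algebra R)"
    by (rule algebraI[OF R.R_cring jet_cring]; (elim jet_carrierE)?)
      (simp_all add: jet_ops jet_class_eq_iff jet_class_carrier ring_of_type_algebra_def
        jet_rel.scale_add_left jet_rel.scale_add_right jet_rel.scale_scale jet_rel.scale_one
        jet_rel.mult_scale)
  show ?thesis
    by (intro diff_algebra.intro alg diff_algebra_axioms.intro; elim jet_carrierE)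
      (simp_all add: jet_ops jet_class_eq_iff jet_class_carrier
        jet_rel.deriv_add jet_rel.deriv_scale jet_rel.deriv_mult)
qed

theorem jet_incl_hom: "jet_incl R \<in> algebra_hom R (jet_algebra R)"
  unfolding algebra_hom_def ring_hom_def jet_incl_def
  by (auto simp: jet_ops jet_class_eq_iff R.smult_closed[OF scalar_carrier]
      intro: jet_class_carrier jet_rel.gen_add jet_rel.gen_scale jet_rel.gen_mult)

primrec jet_eval :: "(complex, 'b, 'n) diff_algebra_scheme \<Rightarrow> ('r \<Rightarrow> 'b) \<Rightarrow> 'r jet_term \<Rightarrow> 'b" where
  "jet_eval A f (JGen r) = f r"
| "jet_eval A f (JScale c t) = c \<odot>\<^bsub>A\<^esub> jet_eval A f t"
| "jet_eval A f (JAdd s t) = jet_eval A f s \<oplus>\<^bsub>A\<^esub> jet_eval A f t"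
| "jet_eval A f (JMult s t) = jet_eval A f s \<otimes>\<^bsub>A\<^esub> jet_eval A f t"
| "jet_eval A f (JDeriv t) = deriv A (jet_eval A f t)"

theorem jet_algebra_universal:
  fixes A :: "(complex, 'b, 'n) diff_algebra_scheme"
  assumes A: "diff_algebra A" and f: "f \<in> algebra_hom R A"
  shows "\<exists>h \<in> diff_algebra_hom (jet_algebra R) A. \<forall>r\<in>carrier R. h (jet_incl R r) = f r"
    and "\<lbrakk>h \<in> diff_algebra_hom (jet_algebra R) A; \<forall>r\<in>carrier R. h (jet_incl R r) = f r;
          h' \<in> diff_algebra_hom (jet_algebra R) A; \<forall>r\<in>carrier R. h' (jet_incl R r) = f r;
          x \<in> carrier (jet_algebra R)\<rbrakk> \<Longrightarrow> h x = h' x"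
proof -
  interpret A: diff_algebra A by (rule A)
  have f_simps: "\<And>r. r \<in> carrier R \<Longrightarrow> f r \<in> carrier A"
    "\<And>r s. \<lbrakk>r \<in> carrier R; s \<in> carrier R\<rbrakk> \<Longrightarrow> f (r \<oplus>\<^bsub>R\<^esub> s) = f r \<oplus>\<^bsub>A\<^esub> f s"
    "\<And>r s. \<lbrakk>r \<in> carrier R; s \<in> carrier R\<rbrakk> \<Longrightarrow> f (r \<otimes>\<^bsub>R\<^esub> s) = f r \<otimes>\<^bsub>A\<^esub> f s"
    "\<And>c r. r \<in> carrier R \<Longrightarrow> f (c \<odot>\<^bsub>R\<^esub> r) = c \<odot>\<^bsub>A\<^esub> f r"
    "f \<one>\<^bsub>R\<^esub> = \<one>\<^bsub>A\<^esub>"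
    using f by (auto simp: algebra_hom_def ring_hom_def)
  have f_zero: "f \<zero>\<^bsub>R\<^esub> = \<zero>\<^bsub>A\<^esub>"
    using f_simps(2)[of "\<zero>\<^bsub>R\<^esub>" "\<zero>\<^bsub>R\<^esub>"] f_simps(1)[of "\<zero>\<^bsub>R\<^esub>"]
    by (metis A.add.r_cancel_one' R.l_zero R.zero_closed)
  have ev: "jet_eval A f t \<in> carrier A" if "t \<in> jet_terms R" for t
    using that
    by (induction t) (auto simp: f_simps A.deriv_closed A.smult_closed[OF scalar_carrier])
  have neg: "((-1) \<odot>\<^bsub>A\<^esub> x) \<oplus>\<^bsub>A\<^esub> x = \<zero>\<^bsub>A\<^esub>" if "x \<in> carrier A" for x
    using A.smult_l_distr[of "-1" 1 x] A.smult_one[of x] A.smult_l_null[of x] that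
    by (simp add: ring_of_type_algebra_def)
  have sc: "(c + d) \<odot>\<^bsub>A\<^esub> x = (c \<odot>\<^bsub>A\<^esub> x) \<oplus>\<^bsub>A\<^esub> (d \<odot>\<^bsub>A\<^esub> x)"
    "(c * d) \<odot>\<^bsub>A\<^esub> x = c \<odot>\<^bsub>A\<^esub> (d \<odot>\<^bsub>A\<^esub> x)"
    "1 \<odot>\<^bsub>A\<^esub> x = x" if "x \<in> carrier A" for c d x
    using A.smult_l_distr[of c d x] A.smult_assoc1[of c d x] A.smult_one[of x] that
    by (simp_all add: ring_of_type_algebra_def)
  have resp: "jet_eval A f s = jet_eval A f t" if "(s, t) \<in> jet_rel R" for s t
    using that
  proof (induction rule: jet_rel.induct)
    case (add_comm s t) then show ?case by (simp add: ev A.a_comm)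
  next
    case (mult_comm s t) then show ?case by (simp add: ev A.m_comm)
  next
    case (mult_add s t u) then show ?case by (simp add: ev A.l_distr)
  qed (simp_all add: ev f_simps f_zero neg sc A.a_assoc A.m_assoc A.smult_r_distr[OF scalar_carrier]
      A.smult_assoc2[OF scalar_carrier] A.deriv_add A.deriv_smult A.deriv_mult)
  define h where "h C = jet_eval A f (SOME t. t \<in> C)" for C
  have h_class: "h (jet_class R t) = jet_eval A f t" if "t \<in> jet_terms R" for t
  proof -
    have "t \<in> jet_class R t" using that by (auto simp: jet_class_def intro: jet_rel.refl)
    then have "(SOME s. s \<in> jet_class R t) \<in> jet_class R t" by (rule someI)
    then have "(t, SOME s. s \<in> jet_class R t) \<in> jet_rel R" by (simp add: jet_class_def)
    from resp[OF this] show ?thesis by (simp add: h_def)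
  qed
  have "h \<in> diff_algebra_hom (jet_algebra R) A"
    unfolding diff_algebra_hom_def algebra_hom_def ring_hom_def
    by (auto elim!: jet_carrierE simp: jet_ops h_class ev f_simps)
  moreover have "\<forall>r\<in>carrier R. h (jet_incl R r) = f r"
    by (simp add: jet_incl_def h_class)
  ultimately show "\<exists>h \<in> diff_algebra_hom (jet_algebra R) A. \<forall>r\<in>carrier R. h (jet_incl R r) = f r"
    by blast
  have uniq: "g (jet_class R t) = jet_eval A f t"
    if g: "g \<in> diff_algebra_hom (jet_algebra R) A" "\<forall>r\<in>carrier R. g (jet_incl R r) = f r"
      and t: "t \<in> jet_terms R" for g t
  proof -
    have g_ops: "g (c \<odot>\<^bsub>jet_algebra R\<^esub> x) = c \<odot>\<^bsub>A\<^esub> g x"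
      "g (x \<oplus>\<^bsub>jet_algebra R\<^esub> y) = g x \<oplus>\<^bsub>A\<^esub> g y"
      "g (x \<otimes>\<^bsub>jet_algebra R\<^esub> y) = g x \<otimes>\<^bsub>A\<^esub> g y"
      "g (deriv (jet_algebra R) x) = deriv A (g x)"
      if "x \<in> carrier (jet_algebra R)" "y \<in> carrier (jet_algebra R)" for c x y
      using g(1) that by (auto simp: diff_algebra_hom_def algebra_hom_def ring_hom_def)
    show ?thesis using t
    proof (induction t)
      case (JGen r) then show ?case using g(2) by (simp add: jet_incl_def)
    next
      case (JScale c t) then show ?case
        using g_ops(1)[of "jet_class R t" "jet_class R t" c] by (simp add: jet_ops jet_class_carrier)
    next
      case (JAdd s t) then show ?case
        using g_ops(2)[of "jet_class R s" "jet_class R t"] by (simp add: jet_ops jet_class_carrier)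
    next
      case (JMult s t) then show ?case
        using g_ops(3)[of "jet_class R s" "jet_class R t"] by (simp add: jet_ops jet_class_carrier)
    next
      case (JDeriv t) then show ?case
        using g_ops(4)[of "jet_class R t" "jet_class R t"] by (simp add: jet_ops jet_class_carrier)
    qed
  qed
  show "h x = h' x"
    if "h \<in> diff_algebra_hom (jet_algebra R) A" "\<forall>r\<in>carrier R. h (jet_incl R r) = f r"
       "h' \<in> diff_algebra_hom (jet_algebra R) A" "\<forall>r\<in>carrier R. h' (jet_incl R r) = f r"
       "x \<in> carrier (jet_algebra R)" for h h' x
    using that(5) uniq[OF that(1,2)] uniq[OF that(3,4)] by (auto elim!: jet_carrierE)
qed

end

section \<open>Vertex algebras\<close>

text \<open>
  Modes are written \<open>Y a n b\<close> for $a_{(n)}b$. All the sums over \<open>j\<close> have finite support by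
  the truncation condition, so that \<open>Sum_any\<close> is the intended sum.
\<close>

definition borcherds_identity ::
    "('v \<Rightarrow> int \<Rightarrow> 'v \<Rightarrow> 'v) \<Rightarrow> (complex \<Rightarrow> 'm \<Rightarrow> 'm::ab_group_add) \<Rightarrow> 'm set
      \<Rightarrow> ('v \<Rightarrow> int \<Rightarrow> 'm \<Rightarrow> 'm) \<Rightarrow> bool"
  where "borcherds_identity Y s M act \<longleftrightarrow> (\<forall>a b m n k. \<forall>x\<in>M.
    Sum_any (\<lambda>j::nat. s (of_int m gchoose j) (act (Y a (n + int j) b) (m + k - int j) x)) =
    Sum_any (\<lambda>j::nat. s ((-1) ^ j * (of_int n gchoose j))
      (act a (m + n - int j) (act b (k + int j) x)
       - s ((-1) powi n) (act b (n + k - int j) (act a (m + int j) x)))))"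

locale vertex_algebra = vector_space scale
  for scale :: "complex \<Rightarrow> 'v::ab_group_add \<Rightarrow> 'v" (infixr \<open>*s\<close> 75) +
  fixes vac :: 'v
    and Y :: "'v \<Rightarrow> int \<Rightarrow> 'v \<Rightarrow> 'v"
  assumes Y_linear_left: "Vector_Spaces.linear scale scale (\<lambda>a. Y a n b)"
    and Y_linear_right: "Vector_Spaces.linear scale scale (Y a n)"
    and Y_truncation: "\<exists>N. \<forall>n\<ge>N. Y a n b = 0"
    and Y_vac_left: "Y vac n a = (if n = -1 then a else 0)"
    and Y_vac_right: "n \<ge> 0 \<Longrightarrow> Y a n vac = 0"
    and Y_creation: "Y a (-1) vac = a"
    and Y_borcherds: "borcherds_identity Y scale UNIV Y"
begin

definition T :: "'v \<Rightarrow> 'v"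
  where "T a = Y a (-2) vac"

definition nontrivial :: bool
  where "nontrivial \<longleftrightarrow> UNIV \<noteq> span {vac}"

subsection \<open>Li filtration, associated graded algebra, classical freeness\<close>

text \<open>The list $[(a^1,n_1),\ldots,(a^r,n_r)]$ encodes $a^1_{(-n_1-1)}\cdots a^r_{(-n_r-1)}\mathbf 1$.\<close>

definition li_monomial :: "('v \<times> nat) list \<Rightarrow> 'v"
  where "li_monomial xs = foldr (\<lambda>(a, n) v. Y a (- int n - 1) v) xs vac"

definition li_filtration :: "nat \<Rightarrow> 'v set"
  where "li_filtration p = span {li_monomial xs | xs. sum_list (map snd xs) \<ge> p}"

text \<open>\<open>li_symbol p a\<close> is the class of \<open>a\<close> in $F^pV/F^{p+1}V$.\<close>

definition li_symbol :: "nat \<Rightarrow> 'v \<Rightarrow> 'v set"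
  where "li_symbol p a = {a + x | x. x \<in> li_filtration (Suc p)}"

definition R_V :: "(complex, 'v set) module"
  where "R_V = \<lparr>
     carrier = range (li_symbol 0),
     monoid.mult = (\<lambda>A B. \<Union>a\<in>A. \<Union>b\<in>B. li_symbol 0 (Y a (-1) b)),
     one = li_symbol 0 vac,
     ring.zero = li_symbol 0 0,
     add = (\<lambda>A B. \<Union>a\<in>A. \<Union>b\<in>B. li_symbol 0 (a + b)),
     module.smult = (\<lambda>c A. \<Union>a\<in>A. li_symbol 0 (c *s a)) \<rparr>"

text \<open>An element \<open>f\<close> of $\operatorname{gr}V$ is the family of its homogeneous components
  \<open>f p\<close>, each of which is a coset of $F^{p+1}V$ in $F^pV$.\<close>

definition gr :: "(complex, nat \<Rightarrow> 'v set) diff_algebra"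
  where "gr = \<lparr>
     carrier = {f. (\<forall>p. f p \<in> li_symbol p ` li_filtration p) \<and> finite {p. f p \<noteq> li_symbol p 0}},
     monoid.mult = (\<lambda>f g n. \<Union>{li_symbol n (\<Sum>p\<le>n. Y (a p) (-1) (b (n - p))) | a b.
                                 \<forall>p\<le>n. a p \<in> f p \<and> b p \<in> g p}),
     one = (\<lambda>p. li_symbol p (if p = 0 then vac else 0)),
     ring.zero = (\<lambda>p. li_symbol p 0),
     add = (\<lambda>f g p. \<Union>a\<in>f p. \<Union>b\<in>g p. li_symbol p (a + b)),
     module.smult = (\<lambda>c f p. \<Union>a\<in>f p. li_symbol p (c *s a)),
     deriv = (\<lambda>f p. case p of 0 \<Rightarrow> li_symbol 0 0
                             | Suc q \<Rightarrow> (\<Union>a\<in>f q. li_symbol (Suc q) (T a))) \<rparr>"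

definition R_V_incl :: "'v set \<Rightarrow> nat \<Rightarrow> 'v set"
  where "R_V_incl A = (\<lambda>p. if p = 0 then A else li_symbol p 0)"

text \<open>By \<open>jet_algebra_universal\<close> the homomorphism \<open>h\<close> is unique on the carrier, hence it is the
  canonical one.\<close>

definition classically_free :: bool
  where "classically_free \<longleftrightarrow> (\<exists>h \<in> diff_algebra_hom (jet_algebra R_V) gr.
     (\<forall>A\<in>carrier R_V. h (jet_incl R_V A) = R_V_incl A) \<and>
     bij_betw h (carrier (jet_algebra R_V)) (carrier gr))"

end

locale graded_vertex_algebra = vertex_algebra scale vac Y
  for scale :: "complex \<Rightarrow> 'v::ab_group_add \<Rightarrow> 'v" (infixr \<open>*s\<close> 75) and vac Y +
  fixes H :: "'v \<Rightarrow> 'v"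
  assumes H_linear: "Vector_Spaces.linear scale scale H"
    and H_diagonalizable: "\<exists>B. independent B \<and> span B = UNIV \<and> (\<forall>b\<in>B. \<exists>d. H b = d *s b)"
    \<comment> \<open>coefficient of $z^{-n-1}$ in $[H,Y(a,z)]=z\partial_zY(a,z)+Y(Ha,z)$\<close>
    and H_commutator: "H (Y a n b) - Y a n (H b) = of_int (- n - 1) *s Y a n b + Y (H a) n b"
begin

definition weight_space :: "complex \<Rightarrow> 'v set"
  where "weight_space d = {v. H v = d *s v}"

definition N_graded :: bool
  where "N_graded \<longleftrightarrow> (\<forall>d v. v \<noteq> 0 \<and> H v = d *s v \<longrightarrow> d \<in> \<nat>)"

definition cft_type :: bool
  where "cft_type \<longleftrightarrow> N_graded \<and> weight_space 0 = span {vac}"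

end

locale vertex_operator_algebra = graded_vertex_algebra scale vac Y H
  for scale :: "complex \<Rightarrow> 'v::ab_group_add \<Rightarrow> 'v" (infixr \<open>*s\<close> 75) and vac Y H +
  fixes \<omega> :: 'v
  assumes omega_weight: "\<omega> \<in> weight_space 2"
    \<comment> \<open>$L_n=\omega_{(n+1)}$\<close>
    and L_minus_1: "Y \<omega> 0 a = T a"
    and L_0: "Y \<omega> 1 a = H a"
    and virasoro: "\<exists>c::complex. \<forall>m n a.
      Y \<omega> (m + 1) (Y \<omega> (n + 1) a) - Y \<omega> (n + 1) (Y \<omega> (m + 1) a)
      = of_int (m - n) *s Y \<omega> (m + n + 1) a
        + (if m + n = 0 then ((of_int m ^ 3 - of_int m) / 12 * c) *s a else 0)"

section \<open>Modules\<close>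

text \<open>
  A module is carried by a subspace \<open>M\<close> of an ambient complex vector space with scalar
  multiplication \<open>s\<close>; the values of the action \<open>act\<close> outside \<open>M\<close> are irrelevant.
\<close>

definition internal_direct_sum :: "'m::ab_group_add set \<Rightarrow> ('i \<Rightarrow> 'm set) \<Rightarrow> 'i set \<Rightarrow> bool"
  where "internal_direct_sum M N I \<longleftrightarrow> (\<forall>i\<in>I. N i \<subseteq> M) \<and>
    (\<forall>x\<in>M. \<exists>!f. (\<forall>i\<in>I. f i \<in> N i) \<and> (\<forall>i. i \<notin> I \<longrightarrow> f i = 0) \<and> finite {i. f i \<noteq> 0} \<and>
       x = (\<Sum>i | f i \<noteq> 0. f i))"

context vertex_algebra
begin

definition weak_module ::
    "(complex \<Rightarrow> 'm::ab_group_add \<Rightarrow> 'm) \<Rightarrow> 'm set \<Rightarrow> ('v \<Rightarrow> int \<Rightarrow> 'm \<Rightarrow> 'm) \<Rightarrow> bool"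
  where "weak_module s M act \<longleftrightarrow>
    vector_space s \<and> module.subspace s M \<and>
    (\<forall>a n. \<forall>x\<in>M. act a n x \<in> M) \<and>
    (\<forall>a b n. \<forall>x\<in>M. act (a + b) n x = act a n x + act b n x) \<and>
    (\<forall>c a n. \<forall>x\<in>M. act (c *s a) n x = s c (act a n x)) \<and>
    (\<forall>a n. \<forall>x\<in>M. \<forall>y\<in>M. act a n (x + y) = act a n x + act a n y) \<and>
    (\<forall>c a n. \<forall>x\<in>M. act a n (s c x) = s c (act a n x)) \<and>
    (\<forall>a. \<forall>x\<in>M. \<exists>N. \<forall>n\<ge>N. act a n x = 0) \<and>
    (\<forall>n. \<forall>x\<in>M. act vac n x = (if n = -1 then x else 0)) \<and>
    borcherds_identity Y s M act"

definition module_iso ::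
    "(complex \<Rightarrow> 'm::ab_group_add \<Rightarrow> 'm) \<Rightarrow> 'm set \<Rightarrow> ('v \<Rightarrow> int \<Rightarrow> 'm \<Rightarrow> 'm)
     \<Rightarrow> (complex \<Rightarrow> 'n::ab_group_add \<Rightarrow> 'n) \<Rightarrow> 'n set \<Rightarrow> ('v \<Rightarrow> int \<Rightarrow> 'n \<Rightarrow> 'n)
     \<Rightarrow> ('m \<Rightarrow> 'n) \<Rightarrow> bool"
  where "module_iso s M act s' M' act' h \<longleftrightarrow> bij_betw h M M' \<and>
    (\<forall>x\<in>M. \<forall>y\<in>M. h (x + y) = h x + h y) \<and>
    (\<forall>c. \<forall>x\<in>M. h (s c x) = s' c (h x)) \<and>
    (\<forall>a n. \<forall>x\<in>M. h (act a n x) = act' a n (h x))"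

end

context graded_vertex_algebra
begin

text \<open>The union in the last clause has at most one member: it is the component of degree
  \<open>n + d - k - 1\<close>, if this number lies in \<open>\<nat>\<close>, and the other components are zero.\<close>

definition admissible_module ::
    "(complex \<Rightarrow> 'm::ab_group_add \<Rightarrow> 'm) \<Rightarrow> 'm set \<Rightarrow> ('v \<Rightarrow> int \<Rightarrow> 'm \<Rightarrow> 'm) \<Rightarrow> (nat \<Rightarrow> 'm set) \<Rightarrow> bool"
  where "admissible_module s M act G \<longleftrightarrow>
    weak_module s M act \<and>
    (\<forall>n. module.subspace s (G n)) \<and> internal_direct_sum M G UNIV \<and>
    (\<forall>d k n. \<forall>a\<in>weight_space d. \<forall>x\<in>G n.
       act a k x \<in> {0} \<union> (\<Union>m\<in>{m. of_nat m = of_nat n + d - of_int k - 1}. G m))"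

definition admissible_submodule ::
    "(complex \<Rightarrow> 'm::ab_group_add \<Rightarrow> 'm) \<Rightarrow> 'm set \<Rightarrow> ('v \<Rightarrow> int \<Rightarrow> 'm \<Rightarrow> 'm) \<Rightarrow> (nat \<Rightarrow> 'm set)
     \<Rightarrow> 'm set \<Rightarrow> bool"
  where "admissible_submodule s M act G N \<longleftrightarrow>
    N \<subseteq> M \<and> admissible_module s N act (\<lambda>n. N \<inter> G n)"

definition simple_admissible_module ::
    "(complex \<Rightarrow> 'm::ab_group_add \<Rightarrow> 'm) \<Rightarrow> 'm set \<Rightarrow> ('v \<Rightarrow> int \<Rightarrow> 'm \<Rightarrow> 'm) \<Rightarrow> (nat \<Rightarrow> 'm set) \<Rightarrow> bool"
  where "simple_admissible_module s M act G \<longleftrightarrow>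
    admissible_module s M act G \<and> M \<noteq> {0} \<and>
    (\<forall>N. admissible_submodule s M act G N \<longrightarrow> N = {0} \<or> N = M)"

definition completely_reducible ::
    "(complex \<Rightarrow> 'm::ab_group_add \<Rightarrow> 'm) \<Rightarrow> 'm set \<Rightarrow> ('v \<Rightarrow> int \<Rightarrow> 'm \<Rightarrow> 'm) \<Rightarrow> (nat \<Rightarrow> 'm set) \<Rightarrow> bool"
  where "completely_reducible s M act G \<longleftrightarrow>
    (\<exists>\<S>. (\<forall>S\<in>\<S>. admissible_submodule s M act G S \<and>
               simple_admissible_module s S act (\<lambda>n. S \<inter> G n)) \<and>
         internal_direct_sum M (\<lambda>S. S) \<S>)"

text \<open>
  HOL cannot quantify over the carrier types of modules inside a formula, so modules range over
  the subspaces of the vector space of all functions on words $(a^1,n_1)\ldots(a^r,n_r)$ with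
  \<open>a\<^sup>i \<in> V\<close>. This is no restriction. A module generated by a vector \<open>w\<close> is spanned by the elements
  $a^1_{(n_1)}\cdots a^r_{(n_r)}w$, so it is a quotient of the space of finitely supported functions
  on words, hence isomorphic to a module carried by a complement of the kernel. This covers
  all simple modules. An arbitrary admissible module is the sum of the submodules generated by its
  homogeneous vectors; if each of these is a sum of simple submodules, then so is the whole
  module, and a sum of simple submodules is the direct sum of some of them.
\<close>

definition word_scale ::
    "complex \<Rightarrow> (('v \<times> int) list \<Rightarrow> complex) \<Rightarrow> (('v \<times> int) list \<Rightarrow> complex)"
  where "word_scale c f = (\<lambda>w. c * f w)"

definition rational :: bool
  where "rational \<longleftrightarrow>
    (\<forall>M act G. admissible_module word_scale M act G \<longrightarrow> completely_reducible word_scale M act G)"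

text \<open>Isomorphisms need not respect the gradings: shifting the grading of an admissible module
  gives an admissible module again, which is the same \<open>V\<close>-module.\<close>

definition holomorphic :: bool
  where "holomorphic \<longleftrightarrow> rational \<and>
    simple_admissible_module scale UNIV Y (\<lambda>n. weight_space (of_nat n)) \<and>
    (\<forall>M act G. simple_admissible_module word_scale M act G \<longrightarrow>
       (\<exists>h. module_iso scale UNIV Y word_scale M act h))"

end

end

theory Submission
  imports Defs
begin

text \<open>
  Suppose that \<open>V\<close> is holomorphic of CFT type, with a vector \<open>a\<close> of the lowest positive weight \<open>d\<close>.
  A functional on \<open>V\<close> that kills Zhu's elements
  \<open>u \<circ> v = (\<Sum>j. (deg u gchoose j) u\<^bsub>(j-2)\<^esub>v)\<close> is a vector of degree \<open>0\<close> in an admissible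
  module made of functionals, a part of the regular representation of \<open>V\<close>. But every
  admissible module is a sum of copies of \<open>V\<close>, whose lowest weight vectors are multiples of
  the vacuum, so the functional would be annihilated by the mode \<open>a\<^bsub>(d-1)\<^esub>\<close>. That is impossible
  if it does not vanish at \<open>a\<close>. So it suffices to show that in a classically free \<open>V\<close> there
  is a functional \<open>\<psi>\<close> with \<open>\<psi>(u \<circ> v) = 0\<close> for all \<open>u, v\<close> and \<open>\<psi>(a) \<noteq> 0\<close>.

  The component of highest weight of \<open>u \<circ> v\<close> is \<open>u\<^bsub>(-2)\<^esub>v\<close>, and the symbol of \<open>u\<^bsub>(-2)\<^esub>v\<close> in
  \<open>gr V\<close> is the product \<open>\<partial>u \<cdot> v\<close>. A functional
  on \<open>V\<^sub>d\<close> is extended to all of \<open>V\<close> weight by weight, and within one weight by descending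
  induction on the Li degree (\<open>zhu_improve\<close>). At each stage the values at the leading terms
  \<open>\<partial>u \<cdot> v\<close> are prescribed, and the question is whether the prescription respects all linear
  relations between these products. The obvious relations are the Leibniz rule
  \<open>\<partial>(uv)w = \<partial>u \<cdot> vw + \<partial>v \<cdot> uw\<close> and the symmetry of \<open>\<partial>u \<cdot> \<partial>v \<cdot> w\<close>. They lift to Zhu's
  elements by the Borcherds identity (\<open>pairing_leibniz\<close>, \<open>pairing_contraction\<close>). In a jet
  algebra there are no other relations: this is the exactness of the Koszul complex
  \<open>\<Omega>\<^sup>2 \<rightarrow> \<Omega>\<^sup>1 \<rightarrow> J\<close> given by contraction with the derivation (\<open>jet_koszul_exact\<close>). Classical
  freeness says that \<open>gr V\<close> is a jet algebra.

  For the module, put \<open>V\<close> at the point \<open>x = 1\<close> and let \<open>z = x - 1\<close>. If \<open>\<psi>\<close> kills Zhu's elements,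
  then \<open>\<psi>(Y(u,z)v)\<close> is the expansion at \<open>x = 1\<close> of a rational function of \<open>x\<close> with poles only
  at \<open>0\<close> and \<open>1\<close>. It has a pole of order at most \<open>deg u\<close> at \<open>x = 0\<close> and is of order
  \<open>x\<^bsup>-deg u\<^esup>\<close> at infinity. The modes of the module are its Laurent coefficients at \<open>x = 0\<close>. Functionals with
  poles of order at most \<open>deg u + n\<close> form the component of degree \<open>n\<close> (\<open>level\<close>), and the
  Borcherds identity for the modes at \<open>x = 0\<close> (\<open>dual_mode_borcherds\<close>) follows from the one at
  \<open>x = 1\<close> by the residue theorem on the projective line. Only residues against the functions
  \<open>x\<^sup>k z\<^sup>p\<close> are used below. As \<open>x = 1 + z\<close>, any family of such residues satisfies Pascal's
  recurrence in \<open>(k, p)\<close>, and the uniqueness of solutions of this recurrence replaces the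
  theory of rational functions.
\<close>

section \<open>Exactness of the Koszul complex of a jet algebra\<close>

text \<open>The jet algebra retracts onto \<open>R\<close> by killing all derivatives.\<close>
primrec jet_aug :: "(complex, 'r, 'm) module_scheme \<Rightarrow> 'r jet_term \<Rightarrow> 'r" where
  "jet_aug R (JGen r) = r"
| "jet_aug R (JScale c t) = c \<odot>\<^bsub>R\<^esub> jet_aug R t"
| "jet_aug R (JAdd s t) = jet_aug R s \<oplus>\<^bsub>R\<^esub> jet_aug R t"
| "jet_aug R (JMult s t) = jet_aug R s \<otimes>\<^bsub>R\<^esub> jet_aug R t"
| "jet_aug R (JDeriv t) = \<zero>\<^bsub>R\<^esub>"

text \<open>
  The differential ideal generated by \<open>\<partial>J\<close> is the kernel of the augmentation \<open>\<epsilon>\<close>. A functional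
  \<open>L\<close> with \<open>L(\<partial>x \<cdot> y) = \<phi>(x, y)\<close> is therefore determined by \<open>\<phi>\<close> on all elements
  \<open>(t - \<epsilon>(t)) x\<close>, and \<open>koszul_primitive R \<phi> t x\<close> is the value it must have there. The clause
  for products expands
  \<open>st - \<epsilon>(s)\<epsilon>(t) = \<epsilon>(s)(t - \<epsilon>(t)) + (s - \<epsilon>(s))t\<close>.
\<close>
primrec koszul_primitive ::
    "(complex, 'r, 'm) module_scheme \<Rightarrow> ('r jet_term set \<Rightarrow> 'r jet_term set \<Rightarrow> complex)
      \<Rightarrow> 'r jet_term \<Rightarrow> 'r jet_term set \<Rightarrow> complex" where
  "koszul_primitive R \<phi> (JGen r) x = 0"
| "koszul_primitive R \<phi> (JScale c t) x = c * koszul_primitive R \<phi> t x"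
| "koszul_primitive R \<phi> (JAdd s t) x = koszul_primitive R \<phi> s x + koszul_primitive R \<phi> t x"
| "koszul_primitive R \<phi> (JMult s t) x =
     koszul_primitive R \<phi> t (jet_incl R (jet_aug R s) \<otimes>\<^bsub>jet_algebra R\<^esub> x)
     + koszul_primitive R \<phi> s (jet_class R t \<otimes>\<^bsub>jet_algebra R\<^esub> x)"
| "koszul_primitive R \<phi> (JDeriv t) x = \<phi> (jet_class R t) x"

text \<open>
  The values of \<open>L\<close> on the retract \<open>R\<close> are free; they are taken to be \<open>0\<close>.
\<close>
definition koszul_lift ::
    "(complex, 'r, 'm) module_scheme \<Rightarrow> ('r jet_term set \<Rightarrow> 'r jet_term set \<Rightarrow> complex)
      \<Rightarrow> 'r jet_term set \<Rightarrow> complex" where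
  "koszul_lift R \<phi> x = koszul_primitive R \<phi> (SOME t. t \<in> x) \<one>\<^bsub>jet_algebra R\<^esub>"

lemma diff_telescope:
  fixes a :: "'a::ab_group_add"
  assumes "a - b = c - d" "b - e = f - g"
  shows "a - e = (f + c) - (g + d)"
proof -
  have "a - e = (a - b) + (b - e)" by simp
  with assms show ?thesis by (simp add: add_diff_add add.commute)
qed

text \<open>
  By the Leibniz rule, \<open>\<phi>\<close> is a functional on the Kaehler differentials
  \<open>\<Omega>\<^sup>1\<close>, with \<open>\<phi>(x, z)\<close> the value at \<open>z dx\<close>. The last assumption says that it vanishes on the image
  of the contraction \<open>\<Omega>\<^sup>2 \<rightarrow> \<Omega>\<^sup>1\<close>, \<open>z dx dy \<mapsto> z(\<partial>x dy - \<partial>y dx)\<close>.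
\<close>
locale jet_koszul =
  fixes R :: "(complex, 'r, 'm) module_scheme"
    and \<phi> :: "'r jet_term set \<Rightarrow> 'r jet_term set \<Rightarrow> complex"
  assumes R: "algebra complex_ring R"
    and \<phi>_add_left: "\<lbrakk>x \<in> carrier (jet_algebra R); y \<in> carrier (jet_algebra R); z \<in> carrier (jet_algebra R)\<rbrakk>
       \<Longrightarrow> \<phi> (x \<oplus>\<^bsub>jet_algebra R\<^esub> y) z = \<phi> x z + \<phi> y z"
    and \<phi>_add_right: "\<lbrakk>x \<in> carrier (jet_algebra R); y \<in> carrier (jet_algebra R); z \<in> carrier (jet_algebra R)\<rbrakk>
       \<Longrightarrow> \<phi> x (y \<oplus>\<^bsub>jet_algebra R\<^esub> z) = \<phi> x y + \<phi> x z"
    and \<phi>_smult_left: "\<lbrakk>x \<in> carrier (jet_algebra R); y \<in> carrier (jet_algebra R)\<rbrakk>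
       \<Longrightarrow> \<phi> (c \<odot>\<^bsub>jet_algebra R\<^esub> x) y = c * \<phi> x y"
    and \<phi>_smult_right: "\<lbrakk>x \<in> carrier (jet_algebra R); y \<in> carrier (jet_algebra R)\<rbrakk>
       \<Longrightarrow> \<phi> x (c \<odot>\<^bsub>jet_algebra R\<^esub> y) = c * \<phi> x y"
    and \<phi>_leibniz: "\<lbrakk>x \<in> carrier (jet_algebra R); y \<in> carrier (jet_algebra R); z \<in> carrier (jet_algebra R)\<rbrakk>
       \<Longrightarrow> \<phi> (x \<otimes>\<^bsub>jet_algebra R\<^esub> y) z = \<phi> x (y \<otimes>\<^bsub>jet_algebra R\<^esub> z) + \<phi> y (x \<otimes>\<^bsub>jet_algebra R\<^esub> z)"
    and \<phi>_contraction: "\<lbrakk>x \<in> carrier (jet_algebra R); y \<in> carrier (jet_algebra R); z \<in> carrier (jet_algebra R)\<rbrakk>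
       \<Longrightarrow> \<phi> x (deriv (jet_algebra R) y \<otimes>\<^bsub>jet_algebra R\<^esub> z) = \<phi> y (deriv (jet_algebra R) x \<otimes>\<^bsub>jet_algebra R\<^esub> z)"
begin

abbreviation J where "J \<equiv> jet_algebra R"
abbreviation cl where "cl \<equiv> jet_class R"
abbreviation aug where "aug t \<equiv> jet_incl R (jet_aug R t)"
abbreviation prim where "prim \<equiv> koszul_primitive R \<phi>"

sublocale R: algebra complex_ring R by (rule R)
sublocale J: diff_algebra J by (rule jet_algebra_diff_algebra[OF R])

lemmas ops = jet_ops[OF R]
lemmas cl_carrier = jet_class_carrier[OF R]
lemma R_smult_closed: "x \<in> carrier R \<Longrightarrow> c \<odot>\<^bsub>R\<^esub> x \<in> carrier R"
  by (simp add: R.smult_closed scalar_carrier[OF R])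

lemma J_smult_closed: "x \<in> carrier J \<Longrightarrow> c \<odot>\<^bsub>J\<^esub> x \<in> carrier J"
  by (simp add: J.smult_closed scalar_carrier[OF R])

lemma jet_aug_carrier: "t \<in> jet_terms R \<Longrightarrow> jet_aug R t \<in> carrier R"
  by (induction t) (auto simp: R_smult_closed)

lemma incl:
  "r \<in> carrier R \<Longrightarrow> jet_incl R r \<in> carrier J"
  "\<lbrakk>r \<in> carrier R; s \<in> carrier R\<rbrakk> \<Longrightarrow> jet_incl R (r \<oplus>\<^bsub>R\<^esub> s) = jet_incl R r \<oplus>\<^bsub>J\<^esub> jet_incl R s"
  "\<lbrakk>r \<in> carrier R; s \<in> carrier R\<rbrakk> \<Longrightarrow> jet_incl R (r \<otimes>\<^bsub>R\<^esub> s) = jet_incl R r \<otimes>\<^bsub>J\<^esub> jet_incl R s"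
  "r \<in> carrier R \<Longrightarrow> jet_incl R (c \<odot>\<^bsub>R\<^esub> r) = c \<odot>\<^bsub>J\<^esub> jet_incl R r"
  "jet_incl R \<one>\<^bsub>R\<^esub> = \<one>\<^bsub>J\<^esub>"
  using jet_incl_hom[OF R] by (auto simp: algebra_hom_def ring_hom_def)

lemma incl_zero: "jet_incl R \<zero>\<^bsub>R\<^esub> = \<zero>\<^bsub>J\<^esub>"
  by (simp add: jet_incl_def ops)

lemma cl_gen: "cl (JGen r) = jet_incl R r"
  by (simp add: jet_incl_def)

lemma aug_carrier: "t \<in> jet_terms R \<Longrightarrow> aug t \<in> carrier J"
  by (simp add: incl jet_aug_carrier)

lemma smult_mult_right: "\<lbrakk>x \<in> carrier J; y \<in> carrier J\<rbrakk> \<Longrightarrow> x \<otimes>\<^bsub>J\<^esub> (c \<odot>\<^bsub>J\<^esub> y) = c \<odot>\<^bsub>J\<^esub> (x \<otimes>\<^bsub>J\<^esub> y)"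
  by (metis J.m_comm J.smult_assoc2 scalar_carrier[OF R] J_smult_closed)

lemma smult_mult_left: "\<lbrakk>x \<in> carrier J; y \<in> carrier J\<rbrakk> \<Longrightarrow> (c \<odot>\<^bsub>J\<^esub> x) \<otimes>\<^bsub>J\<^esub> y = c \<odot>\<^bsub>J\<^esub> (x \<otimes>\<^bsub>J\<^esub> y)"
  by (metis J.smult_assoc2 scalar_carrier[OF R])

lemma \<phi>_zero_right: "x \<in> carrier J \<Longrightarrow> \<phi> x \<zero>\<^bsub>J\<^esub> = 0"
  using \<phi>_add_right[of x "\<zero>\<^bsub>J\<^esub>" "\<zero>\<^bsub>J\<^esub>"] by simp

lemma prim_add:
  "\<lbrakk>t \<in> jet_terms R; x \<in> carrier J; y \<in> carrier J\<rbrakk> \<Longrightarrow> prim t (x \<oplus>\<^bsub>J\<^esub> y) = prim t x + prim t y"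
  by (induction t arbitrary: x y)
     (auto simp: algebra_simps J.r_distr aug_carrier cl_carrier \<phi>_add_right)

lemma prim_smult:
  "\<lbrakk>t \<in> jet_terms R; x \<in> carrier J\<rbrakk> \<Longrightarrow> prim t (c \<odot>\<^bsub>J\<^esub> x) = c * prim t x"
  by (induction t arbitrary: x)
     (auto simp: algebra_simps smult_mult_right aug_carrier cl_carrier \<phi>_smult_right)

lemma prim_zero: "t \<in> jet_terms R \<Longrightarrow> prim t \<zero>\<^bsub>J\<^esub> = 0"
  using prim_add[of t "\<zero>\<^bsub>J\<^esub>" "\<zero>\<^bsub>J\<^esub>"] by simp

lemmas carr = aug_carrier cl_carrier J.deriv_closed J_smult_closed

text \<open>
  This is the required identity \<open>L(\<partial>a \<cdot> (t - \<epsilon>(t)) x) = \<phi>(a, (t - \<epsilon>(t)) x)\<close>. For a derivative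
  \<open>t = \<partial>s\<close> it is exactly the contraction assumption.
\<close>
lemma prim_deriv_mult:
  "\<lbrakk>t \<in> jet_terms R; a \<in> carrier J; x \<in> carrier J\<rbrakk>
    \<Longrightarrow> prim t (deriv J a \<otimes>\<^bsub>J\<^esub> x) = \<phi> a (cl t \<otimes>\<^bsub>J\<^esub> x) - \<phi> a (aug t \<otimes>\<^bsub>J\<^esub> x)"
proof (induction t arbitrary: x)
  case (JGen r)
  then show ?case by (simp add: cl_gen)
next
  case (JScale c t)
  then show ?case
    by (simp add: ops(5)[symmetric] incl jet_aug_carrier smult_mult_left carr \<phi>_smult_right
        flip: right_diff_distrib)
next
  case (JAdd s t)
  then show ?case
    by (simp add: ops(4)[symmetric] incl jet_aug_carrier J.l_distr carr \<phi>_add_right)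
next
  case (JMult s t)
  then have c: "cl s \<in> carrier J" "cl t \<in> carrier J" "aug s \<in> carrier J" "aug t \<in> carrier J"
    "jet_aug R s \<in> carrier R" "jet_aug R t \<in> carrier R" "deriv J a \<in> carrier J"
    by (simp_all add: carr jet_aug_carrier)
  have 1: "aug s \<otimes>\<^bsub>J\<^esub> (deriv J a \<otimes>\<^bsub>J\<^esub> x) = deriv J a \<otimes>\<^bsub>J\<^esub> (aug s \<otimes>\<^bsub>J\<^esub> x)"
    "cl t \<otimes>\<^bsub>J\<^esub> (deriv J a \<otimes>\<^bsub>J\<^esub> x) = deriv J a \<otimes>\<^bsub>J\<^esub> (cl t \<otimes>\<^bsub>J\<^esub> x)"
    using c JMult by (simp_all add: J.m_lcomm)
  have 3: "cl t \<otimes>\<^bsub>J\<^esub> (aug s \<otimes>\<^bsub>J\<^esub> x) = aug s \<otimes>\<^bsub>J\<^esub> (cl t \<otimes>\<^bsub>J\<^esub> x)"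
    "aug t \<otimes>\<^bsub>J\<^esub> (aug s \<otimes>\<^bsub>J\<^esub> x) = aug s \<otimes>\<^bsub>J\<^esub> (aug t \<otimes>\<^bsub>J\<^esub> x)"
    using c JMult.prems by (simp_all add: J.m_lcomm)
  have 2: "prim s (deriv J a \<otimes>\<^bsub>J\<^esub> (cl t \<otimes>\<^bsub>J\<^esub> x)) =
      \<phi> a (cl s \<otimes>\<^bsub>J\<^esub> (cl t \<otimes>\<^bsub>J\<^esub> x)) - \<phi> a (aug s \<otimes>\<^bsub>J\<^esub> (cl t \<otimes>\<^bsub>J\<^esub> x))"
    "prim t (deriv J a \<otimes>\<^bsub>J\<^esub> (aug s \<otimes>\<^bsub>J\<^esub> x)) =
      \<phi> a (cl t \<otimes>\<^bsub>J\<^esub> (aug s \<otimes>\<^bsub>J\<^esub> x)) - \<phi> a (aug t \<otimes>\<^bsub>J\<^esub> (aug s \<otimes>\<^bsub>J\<^esub> x))"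
    using c JMult by simp_all
  show ?case
    using c JMult.prems by (simp add: 1 2 3 ops(3)[symmetric] incl J.m_assoc)
next
  case (JDeriv t)
  then show ?case
    by (simp add: ops(6)[symmetric] incl_zero \<phi>_zero_right carr \<phi>_contraction)
qed

text \<open>
  Both sides are the value of \<open>L\<close> at \<open>(t - \<epsilon>(t))(u - \<epsilon>(u))x\<close>, once read with \<open>u\<close> and once with
  \<open>t\<close> as the factor that is decomposed. So \<open>koszul_primitive\<close> respects
  commutativity, although its clause for products is not symmetric.
\<close>
lemma prim_commute:
  "\<lbrakk>t \<in> jet_terms R; u \<in> jet_terms R; x \<in> carrier J\<rbrakk>
    \<Longrightarrow> prim u (cl t \<otimes>\<^bsub>J\<^esub> x) - prim u (aug t \<otimes>\<^bsub>J\<^esub> x) = prim t (cl u \<otimes>\<^bsub>J\<^esub> x) - prim t (aug u \<otimes>\<^bsub>J\<^esub> x)"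
proof (induction t arbitrary: x)
  case (JGen r)
  then show ?case by (simp add: cl_gen)
next
  case (JScale c t)
  from JScale.IH[of x] JScale.prems show ?case
    by (simp add: ops(5)[symmetric] incl jet_aug_carrier smult_mult_left carr prim_smult
        flip: right_diff_distrib)
next
  case (JAdd s t)
  from JAdd.IH(1)[of x] JAdd.IH(2)[of x] JAdd.prems show ?case
    by (simp add: ops(4)[symmetric] incl jet_aug_carrier J.l_distr carr prim_add add_diff_add)
next
  case (JMult s t)
  then have c: "cl s \<in> carrier J" "cl t \<in> carrier J" "aug s \<in> carrier J" "aug t \<in> carrier J"
    "jet_aug R s \<in> carrier R" "jet_aug R t \<in> carrier R" "cl u \<in> carrier J" "aug u \<in> carrier J"
    by (simp_all add: carr jet_aug_carrier)
  have "prim u (cl s \<otimes>\<^bsub>J\<^esub> (cl t \<otimes>\<^bsub>J\<^esub> x)) - prim u (aug s \<otimes>\<^bsub>J\<^esub> (cl t \<otimes>\<^bsub>J\<^esub> x)) =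
      prim s (cl u \<otimes>\<^bsub>J\<^esub> (cl t \<otimes>\<^bsub>J\<^esub> x)) - prim s (aug u \<otimes>\<^bsub>J\<^esub> (cl t \<otimes>\<^bsub>J\<^esub> x))"
    "prim u (aug s \<otimes>\<^bsub>J\<^esub> (cl t \<otimes>\<^bsub>J\<^esub> x)) - prim u (aug s \<otimes>\<^bsub>J\<^esub> (aug t \<otimes>\<^bsub>J\<^esub> x)) =
      prim t (cl u \<otimes>\<^bsub>J\<^esub> (aug s \<otimes>\<^bsub>J\<^esub> x)) - prim t (aug u \<otimes>\<^bsub>J\<^esub> (aug s \<otimes>\<^bsub>J\<^esub> x))"
    using c JMult.prems JMult.IH(1)[of "cl t \<otimes>\<^bsub>J\<^esub> x"] JMult.IH(2)[of "aug s \<otimes>\<^bsub>J\<^esub> x"]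
    by (simp_all add: J.m_lcomm)
  from diff_telescope[OF this] show ?case
    using c JMult.prems by (simp add: ops(3)[symmetric] incl J.m_assoc J.m_lcomm)
next
  case (JDeriv t)
  then show ?case
    by (simp add: ops(6)[symmetric] incl_zero prim_zero carr prim_deriv_mult)
qed

lemma rel_terms: "(s, t) \<in> jet_rel R \<Longrightarrow> s \<in> jet_terms R \<and> t \<in> jet_terms R"
  by (rule jet_rel_terms[OF R])

lemma rel_cl: "(s, t) \<in> jet_rel R \<Longrightarrow> cl s = cl t"
  using jet_class_eq_iff[OF R] rel_terms by blast

lemma R_sc:
  assumes "x \<in> carrier R"
  shows "(c + d) \<odot>\<^bsub>R\<^esub> x = (c \<odot>\<^bsub>R\<^esub> x) \<oplus>\<^bsub>R\<^esub> (d \<odot>\<^bsub>R\<^esub> x)"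
    "(c * d) \<odot>\<^bsub>R\<^esub> x = c \<odot>\<^bsub>R\<^esub> (d \<odot>\<^bsub>R\<^esub> x)"
    "1 \<odot>\<^bsub>R\<^esub> x = x" "((-1) \<odot>\<^bsub>R\<^esub> x) \<oplus>\<^bsub>R\<^esub> x = \<zero>\<^bsub>R\<^esub>" 
  using R.smult_l_distr[of c d x] R.smult_assoc1[of c d x] R.smult_one[of x]
    R.smult_l_distr[of "-1" 1 x] R.smult_l_null[of x] assms
  by (simp_all add: ring_of_type_algebra_def)

lemma jet_aug_rel: "(s, t) \<in> jet_rel R \<Longrightarrow> jet_aug R s = jet_aug R t"
proof (induction rule: jet_rel.induct)
  case (add_comm s t) then show ?case by (simp add: jet_aug_carrier R.a_comm)
next
  case (mult_comm s t) then show ?case by (simp add: jet_aug_carrier R.m_comm)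
next
  case (mult_add s t u) then show ?case by (simp add: jet_aug_carrier R.l_distr)
qed (simp_all add: jet_aug_carrier R_sc R.smult_r_null[OF scalar_carrier[OF R]] R.a_assoc R.m_assoc R.smult_r_distr[OF scalar_carrier[OF R]]
      R.smult_assoc2[OF scalar_carrier[OF R]])

lemma prim_rel: "(s, t) \<in> jet_rel R \<Longrightarrow> x \<in> carrier J \<Longrightarrow> prim s x = prim t x"
proof (induction arbitrary: x rule: jet_rel.induct)
  case (cong_mult s t s' t')
  then have *: "cl s = cl t" "cl s' = cl t'" "aug s = aug t" "aug s' = aug t'"
     "s \<in> jet_terms R" "t \<in> jet_terms R" "s' \<in> jet_terms R" "t' \<in> jet_terms R"
    using rel_cl rel_terms jet_aug_rel by auto
  have "prim s' (aug t \<otimes>\<^bsub>J\<^esub> x) = prim t' (aug t \<otimes>\<^bsub>J\<^esub> x)"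
    using cong_mult.IH * cong_mult.prems by (simp add: aug_carrier)
  moreover have "prim s (cl t' \<otimes>\<^bsub>J\<^esub> x) = prim t (cl t' \<otimes>\<^bsub>J\<^esub> x)"
    using cong_mult.IH * cong_mult.prems by (simp add: cl_carrier)
  ultimately show ?case using * by simp
next
  case (cong_deriv s t)
  then show ?case using rel_cl by simp
next
  case (add_zero t) then show ?case by simp
next
  case (mult_assoc s t u)
  then show ?case
    by (simp add: ops(3)[symmetric] incl J.m_ac carr jet_aug_carrier)
next
  case (mult_comm s t)
  then show ?case using prim_commute[of s t x] by (simp add: algebra_simps)
next
  case (mult_one t)
  then show ?case by (simp add: incl)
next
  case (mult_add s t u)
  then show ?case by (simp add: ops(4)[symmetric] incl carr jet_aug_carrier J.l_distr prim_add)
next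
  case (mult_scale s t c)
  then show ?case
    by (simp add: ops(5)[symmetric] incl carr jet_aug_carrier smult_mult_left prim_smult algebra_simps)
next
  case (deriv_add s t)
  then show ?case by (simp add: ops(4)[symmetric] carr \<phi>_add_left)
next
  case (deriv_scale t c)
  then show ?case by (simp add: ops(5)[symmetric] carr \<phi>_smult_left)
next
  case (deriv_mult s t)
  then have c: "cl s \<in> carrier J" "cl t \<in> carrier J" "aug s \<in> carrier J" "aug t \<in> carrier J"
    by (simp_all add: carr)
  with deriv_mult show ?case
    by (simp add: ops(3)[symmetric] ops(6)[symmetric] incl_zero prim_zero carr \<phi>_leibniz prim_deriv_mult)
qed (simp_all add: algebra_simps)

abbreviation lift where "lift \<equiv> koszul_lift R \<phi>"

lemma lift_cl: "t \<in> jet_terms R \<Longrightarrow> lift (cl t) = prim t \<one>\<^bsub>J\<^esub>"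
proof -
  assume t: "t \<in> jet_terms R"
  then have "t \<in> cl t" by (auto simp: jet_class_def intro: jet_rel.refl)
  then have "(SOME s. s \<in> cl t) \<in> cl t" by (rule someI)
  then have "(t, SOME s. s \<in> cl t) \<in> jet_rel R" by (simp add: jet_class_def)
  from prim_rel[OF this] show ?thesis by (simp add: koszul_lift_def)
qed

text \<open>
  A functional on \<open>\<Omega>\<^sup>1\<close> that kills the image of \<open>\<Omega>\<^sup>2\<close> factors through the contraction
  \<open>\<Omega>\<^sup>1 \<rightarrow> J\<close>, \<open>y dx \<mapsto> y \<partial>x\<close>: the Koszul complex is exact at \<open>\<Omega>\<^sup>1\<close>.
\<close>
theorem jet_koszul_exact:
  shows "\<lbrakk>x \<in> carrier J; y \<in> carrier J\<rbrakk> \<Longrightarrow> lift (x \<oplus>\<^bsub>J\<^esub> y) = lift x + lift y"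
    and "x \<in> carrier J \<Longrightarrow> lift (c \<odot>\<^bsub>J\<^esub> x) = c * lift x"
    and "\<lbrakk>x \<in> carrier J; y \<in> carrier J\<rbrakk> \<Longrightarrow> lift (deriv J x \<otimes>\<^bsub>J\<^esub> y) = \<phi> x y"
proof -
  show "\<lbrakk>x \<in> carrier J; y \<in> carrier J\<rbrakk> \<Longrightarrow> lift (x \<oplus>\<^bsub>J\<^esub> y) = lift x + lift y"
    by (elim jet_carrierE[OF R]) (simp add: ops lift_cl)
  show "x \<in> carrier J \<Longrightarrow> lift (c \<odot>\<^bsub>J\<^esub> x) = c * lift x"
    by (elim jet_carrierE[OF R]) (simp add: ops lift_cl)
  show "lift (deriv J x \<otimes>\<^bsub>J\<^esub> y) = \<phi> x y" if xy: "x \<in> carrier J" "y \<in> carrier J"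
  proof -
    from xy obtain t u where *: "t \<in> jet_terms R" "x = cl t" "u \<in> jet_terms R" "y = cl u"
      by (elim jet_carrierE[OF R])
    then have "lift (deriv J x \<otimes>\<^bsub>J\<^esub> y) = prim u \<zero>\<^bsub>J\<^esub> + \<phi> x y"
      by (simp add: ops(3,6) lift_cl incl_zero carr)
    with * show ?thesis by (simp add: prim_zero)
  qed
qed

end

section \<open>Pascal arrays and binomial sums\<close>

text \<open>
  The recurrence satisfied by any linear functional of \<open>x\<^sup>k z\<^sup>p\<close> when \<open>x = 1 + z\<close>, because then
  \<open>x\<^bsup>k+1\<^esup> z\<^sup>p = x\<^sup>k z\<^sup>p + x\<^sup>k z\<^bsup>p+1\<^esup>\<close>.
\<close>
definition pascal :: "(int \<Rightarrow> int \<Rightarrow> 'a::ab_group_add) \<Rightarrow> bool" where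
  "pascal A \<longleftrightarrow> (\<forall>k p. A (k + 1) p = A k p + A k (p + 1))"

lemma pascalD: "pascal A \<Longrightarrow> A (k + 1) p = A k p + A k (p + 1)"
  by (simp add: pascal_def)

lemma pascal_diff: "pascal A \<Longrightarrow> pascal B \<Longrightarrow> pascal (\<lambda>k p. A k p - B k p)"
  by (simp add: pascal_def)

lemma pascal_shift: "pascal A \<Longrightarrow> pascal (\<lambda>k p. A (k + a) (p + b))"
  using pascalD[of A "_ + a" "_ + b"] by (simp add: pascal_def algebra_simps)

lemma pascal_shift':
  "pascal A \<Longrightarrow> pascal (\<lambda>k p. A (k - a) (p - b))"
  "pascal A \<Longrightarrow> pascal (\<lambda>k p. A (k - a) (p + b))"
  "pascal A \<Longrightarrow> pascal (\<lambda>k p. A (k + a) (p - b))"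
  "pascal A \<Longrightarrow> pascal (\<lambda>k p. A k (p + b))"
  "pascal A \<Longrightarrow> pascal (\<lambda>k p. A k (p - b))"
  "pascal A \<Longrightarrow> pascal (\<lambda>k p. A (k + a) p)"
  using pascal_shift[of A "-a" "-b"] pascal_shift[of A "-a" "b"] pascal_shift[of A "a" "-b"]
   pascal_shift[of A 0 b] pascal_shift[of A 0 "-b"] pascal_shift[of A a 0] by simp_all

text \<open>
  To the right of column \<open>0\<close> the recurrence determines everything. To the left it determines
  \<open>A (k - 1) p\<close> from the column \<open>k\<close> and \<open>A (k - 1) (p + 1)\<close>, so one descends from large \<open>p\<close>.
  The bound is what makes the expansion of \<open>x\<^bsup>-1\<^esup>\<close> in powers of \<open>z\<close> the right one.
\<close>
lemma pascal_zero_from_column: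
  assumes A: "pascal A" and col: "\<And>p. A 0 p = 0" and L: "\<And>k p. p \<ge> L \<Longrightarrow> A k p = 0"
  shows "A k p = (0::'a::ab_group_add)"
proof -
  have up: "A (int n) p = 0" for n p
  proof (induction n arbitrary: p)
    case 0 then show ?case by (simp add: col)
  next
    case (Suc n)
    then show ?case using pascalD[OF A, of "int n" p] by (simp add: add.commute)
  qed
  have dn: "A (- int n) p = 0" for n p
  proof (induction n arbitrary: p)
    case 0 then show ?case by (simp add: col)
  next
    case (Suc n)
    have step: "A (- int (Suc n)) (L - int d) = 0" for d
    proof (induction d)
      case 0 then show ?case by (simp add: L)
    next
      case (Suc d)
      then show ?case
        using pascalD[OF A, of "- int (Suc n)" "L - int (Suc d)"] \<open>\<And>p. A (- int n) p = 0\<close>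
        by (simp add: algebra_simps)
    qed
    show ?case
    proof (cases "p \<ge> L")
      case True then show ?thesis by (rule L)
    next
      case False
      then show ?thesis using step[of "nat (L - p)"] by simp
    qed
  qed
  show ?thesis using up[of "nat k" p] dn[of "nat (- k)" p] by (cases "k \<ge> 0") auto
qed

text \<open>
  If one antidiagonal \<open>k + p = c\<close> vanishes, the recurrence says that the next one is constant,
  and the vanishing for large \<open>k\<close> makes this constant zero.
\<close>
lemma pascal_zero_from_diagonal:
  assumes A: "pascal A" and C: "\<And>k p. k \<ge> m \<Longrightarrow> k + p \<le> C \<Longrightarrow> A k p = 0"
    and L: "\<And>k p. k \<ge> L \<Longrightarrow> A k p = 0" and k: "k \<ge> m"
  shows "A k p = (0::'a::ab_group_add)"
proof -
  have "A k p = 0" if "k \<ge> m" "k + p \<le> C + int n" for n k p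
    using that
  proof (induction n arbitrary: k p)
    case 0 then show ?case using C by simp
  next
    case outer: (Suc n)
    note kp = outer.prems
    have *: "A (k + int d) (p - int d) = A k p" for d
    proof (induction d)
      case 0 then show ?case by simp
    next
      case (Suc d)
      have "A (k + int d + 1) (p - int d - 1) = A (k + int d) (p - int d - 1) + A (k + int d) (p - int d)"
        using pascalD[OF A, of "k + int d" "p - int d - 1"] by simp
      moreover have "A (k + int d) (p - int d - 1) = 0"
        using kp by (intro outer.IH) auto
      ultimately show ?case using Suc by (simp add: algebra_simps)
    qed
    show ?case using *[of "nat (L - k)"] L[of "k + int (nat (L - k))" "p - int (nat (L - k))"] by simp
  qed
  from this[of k p "nat (k + p - C)"] k show ?thesis by simp
qed

text \<open>
  An antidiagonal determines all lower ones, since each entry is a difference of two entries on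
  the next antidiagonal.
\<close>
lemma pascal_eq_below:
  assumes A: "pascal A" and B: "pascal B"
    and eq: "\<And>k p. k + p = C \<Longrightarrow> A k p = (B k p :: 'a::ab_group_add)" and "k + p \<le> C"
  shows "A k p = B k p"
proof -
  have "A k p = B k p" if "k + p = C - int n" for n
    using that
  proof (induction n arbitrary: k p)
    case 0 then show ?case using eq by simp
  next
    case (Suc n)
    have "A (k + 1) p = B (k + 1) p" "A k (p + 1) = B k (p + 1)"
      using Suc.prems by (intro Suc.IH; simp)+
    then show ?case using pascalD[OF A, of k p] pascalD[OF B, of k p] by simp
  qed
  from this[of "nat (C - k - p)"] assms(4) show ?thesis by simp
qed

lemma gbinomial_int_Suc:
  "(1 + of_int n gchoose Suc i :: complex) = (of_int n gchoose i) + (of_int n gchoose Suc i)"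
  "(of_int n + 1 gchoose Suc i :: complex) = (of_int n gchoose i) + (of_int n gchoose Suc i)"
  using gbinomial_Suc_Suc[of "of_int n :: complex" i] by (simp_all add: add.commute)

lemma gbinomial_zero_pos: "i \<noteq> 0 \<Longrightarrow> (0 gchoose i :: complex) = 0"
  by (cases i) auto

abbreviation vanishes :: "(nat \<Rightarrow> 'a::zero) \<Rightarrow> bool" where
  "vanishes G \<equiv> eventually (\<lambda>j. G j = 0) sequentially"

lemma vanishes_Suc: "vanishes G \<Longrightarrow> vanishes (\<lambda>j. G (Suc j))"
  using eventually_sequentially_Suc[of "\<lambda>j. G j = 0"] by simp

locale complex_vector_space = vector_space scale
  for scale :: "complex \<Rightarrow> 'b::ab_group_add \<Rightarrow> 'b"
begin

definition binsum :: "int \<Rightarrow> (nat \<Rightarrow> 'b) \<Rightarrow> 'b" where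
  "binsum n G = Sum_any (\<lambda>j. scale (of_int n gchoose j) (G j))"

lemma binsum_eq:
  assumes "\<And>j. j \<ge> N \<Longrightarrow> G j = 0"
  shows "binsum n G = (\<Sum>j<N. scale (of_int n gchoose j) (G j))"
  unfolding binsum_def
proof (rule Sum_any.expand_superset)
  show "{j. scale (of_int n gchoose j) (G j) \<noteq> 0} \<subseteq> {..<N}"
  proof (rule subsetI)
    fix j assume "j \<in> {j. scale (of_int n gchoose j) (G j) \<noteq> 0}"
    then have "G j \<noteq> 0" by auto
    then show "j \<in> {..<N}" using assms[of j] by (cases "N \<le> j") auto
  qed
qed simp

lemma binsum_add:
  assumes "vanishes G" "vanishes G'"
  shows "binsum n (\<lambda>j. G j + G' j) = binsum n G + binsum n G'"
proof -
  from eventually_conj[OF assms] obtain N where N: "\<And>j. j \<ge> N \<Longrightarrow> G j = 0 \<and> G' j = 0"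
    by (auto simp: eventually_sequentially)
  then show ?thesis
    using binsum_eq[of N G n] binsum_eq[of N G' n] binsum_eq[of N "\<lambda>j. G j + G' j" n]
    by (simp add: scale_right_distrib sum.distrib)
qed

lemma binsum_scale:
  assumes "vanishes G"
  shows "binsum n (\<lambda>j. scale c (G j)) = scale c (binsum n G)"
proof -
  from assms obtain N where N: "\<And>j. j \<ge> N \<Longrightarrow> G j = 0"
    by (auto simp: eventually_sequentially)
  have "binsum n (\<lambda>j. scale c (G j)) = (\<Sum>j<N. scale (of_int n gchoose j) (scale c (G j)))"
    using N by (intro binsum_eq) simp
  also have "\<dots> = scale c (\<Sum>j<N. scale (of_int n gchoose j) (G j))"
    unfolding scale_sum_right by (rule sum.cong[OF HOL.refl]) (rule scale_left_commute)
  also have "(\<Sum>j<N. scale (of_int n gchoose j) (G j)) = binsum n G"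
    using N by (intro binsum_eq[symmetric]) simp
  finally show ?thesis .
qed

lemma binsum_minus: "vanishes G \<Longrightarrow> binsum n (\<lambda>j. - G j) = - binsum n G"
  using binsum_scale[of G n "-1"] by simp

lemma binsum_diff:
  assumes "vanishes G" "vanishes G'"
  shows "binsum n (\<lambda>j. G j - G' j) = binsum n G - binsum n G'"
  using binsum_add[of G "\<lambda>j. - G' j" n] assms by (simp add: binsum_minus)

lemma binsum_zero [simp]: "binsum n (\<lambda>j. 0) = 0"
  by (simp add: binsum_def)

lemma binsum_0_left [simp]: "binsum 0 G = G 0"
proof -
  have "binsum 0 G = (\<Sum>j<1::nat. scale (of_int 0 gchoose j) (G j))"
    unfolding binsum_def
    by (rule Sum_any.expand_superset) (auto simp: gr0_conv_Suc not_less, metis gbinomial_0(2) not0_implies_Suc)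
  then show ?thesis by simp
qed

lemma binsum_pascal:
  assumes "vanishes G"
  shows "binsum (n + 1) G = binsum n G + binsum n (\<lambda>j. G (Suc j))"
proof -
  from assms obtain N where N: "\<And>j. j \<ge> N \<Longrightarrow> G j = 0"
    by (auto simp: eventually_sequentially)
  have "binsum (n + 1) G = (\<Sum>j<Suc N. scale (of_int (n + 1) gchoose j) (G j))"
    using N by (intro binsum_eq) simp
  also have "\<dots> = G 0 + (\<Sum>j<N. scale (of_int n gchoose Suc j) (G (Suc j)) + scale (of_int n gchoose j) (G (Suc j)))"
    unfolding sum.lessThan_Suc_shift
    by (simp add: gbinomial_int_Suc scale_left_distrib add.commute)
  also have "\<dots> = (\<Sum>j<Suc N. scale (of_int n gchoose j) (G j)) + (\<Sum>j<N. scale (of_int n gchoose j) (G (Suc j)))"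
    unfolding sum.lessThan_Suc_shift by (simp add: sum.distrib add.assoc)
  finally show ?thesis
    using binsum_eq[of "Suc N" G n] binsum_eq[of N "\<lambda>j. G (Suc j)" n] N by simp
qed

definition altsum :: "int \<Rightarrow> (nat \<Rightarrow> 'b) \<Rightarrow> 'b" where
  "altsum n G = binsum n (\<lambda>j. scale ((-1) ^ j) (G j))"

lemma vanishes_sign: "vanishes G \<Longrightarrow> vanishes (\<lambda>j. scale (c j) (G j))"
  by (erule eventually_mono) simp

lemma altsum_eq:
  assumes "\<And>j. j \<ge> N \<Longrightarrow> G j = 0"
  shows "altsum n G = (\<Sum>j<N. scale ((-1) ^ j * (of_int n gchoose j)) (G j))"
  unfolding altsum_def using assms by (subst binsum_eq[of N]) (auto simp: mult.commute)

lemma altsum_add: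
  "vanishes G \<Longrightarrow> vanishes G' \<Longrightarrow> altsum n (\<lambda>j. G j + G' j) = altsum n G + altsum n G'"
  by (simp add: altsum_def scale_right_distrib binsum_add vanishes_sign)

lemma altsum_diff:
  "vanishes G \<Longrightarrow> vanishes G' \<Longrightarrow> altsum n (\<lambda>j. G j - G' j) = altsum n G - altsum n G'"
  by (simp add: altsum_def scale_right_diff_distrib binsum_diff vanishes_sign)

lemma altsum_scale:
  assumes "vanishes G"
  shows "altsum n (\<lambda>j. scale c (G j)) = scale c (altsum n G)"
proof -
  have "(\<lambda>j. scale ((-1) ^ j) (scale c (G j))) = (\<lambda>j. scale c (scale ((-1) ^ j) (G j)))"
    by (simp add: mult.commute)
  then show ?thesis
    using binsum_scale[OF vanishes_sign[OF assms]] by (simp only: altsum_def)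
qed

lemma altsum_minus: "vanishes G \<Longrightarrow> altsum n (\<lambda>j. - G j) = - altsum n G"
  using altsum_scale[of G n "-1"] by simp

lemma altsum_zero [simp]: "altsum n (\<lambda>j. 0) = 0"
  by (simp add: altsum_def)

lemma altsum_0_left [simp]: "altsum 0 G = G 0"
  by (simp add: altsum_def)

lemma altsum_pascal:
  assumes "vanishes G"
  shows "altsum (n + 1) G = altsum n G - altsum n (\<lambda>j. G (Suc j))"
proof -
  have "vanishes (\<lambda>j. scale ((-1) ^ Suc j) (G (Suc j)))"
    by (rule vanishes_sign) (rule vanishes_Suc[OF assms])
  then have "altsum n (\<lambda>j. G (Suc j)) = - binsum n (\<lambda>j. scale ((-1) ^ Suc j) (G (Suc j)))"
    unfolding altsum_def by (subst binsum_minus[symmetric]) simp_all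
  then show ?thesis
    unfolding altsum_def using binsum_pascal[OF vanishes_sign[OF assms], of n] by simp
qed

text \<open>
  If \<open>A k p\<close> is a functional evaluated at \<open>x\<^sup>k z\<^sup>p\<close>, then \<open>taylor j A k p\<close> is the same functional
  evaluated at the \<open>j\<close>-th divided derivative of \<open>x\<^sup>k z\<^sup>p\<close>, written out by the Leibniz rule.
\<close>
definition taylor :: "nat \<Rightarrow> (int \<Rightarrow> int \<Rightarrow> 'b) \<Rightarrow> int \<Rightarrow> int \<Rightarrow> 'b" where
  "taylor j A k p = (\<Sum>i\<le>j. scale ((of_int k gchoose i) * (of_int p gchoose (j - i)))
      (A (k - int i) (p - int (j - i))))"

lemma pascal_taylor:
  assumes A: "pascal A"
  shows "pascal (taylor j A)"
  unfolding pascal_def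
proof (intro allI)
  fix k p :: int
  let ?g = "\<lambda>(x::int) i. of_int x gchoose i ::complex"
  have E: "A (k + 1 - int i) q = A (k - int i) q + A (k - int i) (q + 1)" for i q
    using pascalD[OF A, of "k - int i" q] by (simp add: algebra_simps)
  show "taylor j A (k + 1) p = taylor j A k p + taylor j A k (p + 1)"
  proof (cases j)
    case 0
    then show ?thesis using E[of 0 p] by (simp add: taylor_def)
  next
    case (Suc m)
    define S1 where "S1 = (\<Sum>i\<le>Suc m. scale (?g k i * ?g p (Suc m - i)) (A (k + 1 - int i) (p - int (Suc m - i))))"
    define S2 where "S2 = (\<Sum>i\<le>m. scale (?g k i * ?g p (m - i)) (A (k - int i) (p - int (m - i))))"
    define S3 where "S3 = (\<Sum>i\<le>Suc m. scale (?g k i * ?g p (Suc m - i)) (A (k - int i) (p + 1 - int (Suc m - i))))"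
    have "taylor j A (k + 1) p = S1 + S2"
    proof -
      have "taylor j A (k + 1) p = scale (?g p (Suc m)) (A (k + 1) (p - int (Suc m)))
         + (\<Sum>i\<le>m. scale (?g (k + 1) (Suc i) * ?g p (m - i)) (A (k - int i) (p - int (m - i))))"
        unfolding taylor_def Suc sum.atMost_Suc_shift by simp
      also have "(\<Sum>i\<le>m. scale (?g (k + 1) (Suc i) * ?g p (m - i)) (A (k - int i) (p - int (m - i))))
        = (\<Sum>i\<le>m. scale (?g k (Suc i) * ?g p (m - i)) (A (k - int i) (p - int (m - i)))) + S2"
        by (simp add: S2_def gbinomial_int_Suc scale_left_distrib distrib_right sum.distrib add.commute)
      also have "scale (?g p (Suc m)) (A (k + 1) (p - int (Suc m))) + \<dots> = S1 + S2"
        unfolding S1_def sum.atMost_Suc_shift by (simp add: algebra_simps)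
      finally show ?thesis .
    qed
    moreover have "S1 = taylor j A k p + S3"
      unfolding S1_def S3_def taylor_def Suc E scale_right_distrib sum.distrib
      by (simp add: algebra_simps)
    moreover have "taylor j A k (p + 1) = S3 + S2"
    proof -
      have 1: "?g (p + 1) (Suc m - i) = ?g p (Suc m - i) + ?g p (m - i)" if "i \<le> m" for i
        using that by (simp add: Suc_diff_le gbinomial_int_Suc)
      have 2: "p + 1 - int (Suc m - i) = p - int (m - i)" if "i \<le> m" for i
        using that by (simp add: of_nat_diff)
      have "(\<Sum>i\<le>m. scale (?g k i * ?g (p + 1) (Suc m - i)) (A (k - int i) (p + 1 - int (Suc m - i))))
         = (\<Sum>i\<le>m. scale (?g k i * ?g p (Suc m - i)) (A (k - int i) (p + 1 - int (Suc m - i)))) + S2"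
        unfolding S2_def sum.distrib[symmetric]
        by (rule sum.cong[OF HOL.refl]) (simp add: 1[simplified] 2 distrib_left scale_left_distrib del: of_nat_Suc of_nat_diff)
      then show ?thesis
        unfolding taylor_def Suc S3_def sum.atMost_Suc by simp
    qed
    ultimately show ?thesis by simp
  qed
qed

lemma taylor_column [simp]: "taylor j A 0 p = scale (of_int p gchoose j) (A 0 (p - int j))"
proof -
  have "taylor j A 0 p = (\<Sum>i\<in>{0}. scale ((of_int 0 gchoose i) * (of_int p gchoose (j - i)))
      (A (0 - int i) (p - int (j - i))))"
    unfolding taylor_def
    by (rule sum.mono_neutral_right) (auto simp: gbinomial_zero_pos)
  then show ?thesis by simp
qed

lemma taylor_row [simp]: "taylor j A k 0 = scale (of_int k gchoose j) (A (k - int j) 0)"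
proof -
  have "taylor j A k 0 = (\<Sum>i\<in>{j}. scale ((of_int k gchoose i) * (of_int 0 gchoose (j - i)))
      (A (k - int i) (0 - int (j - i))))"
    unfolding taylor_def
    by (rule sum.mono_neutral_right) (auto simp: gbinomial_zero_pos)
  then show ?thesis by simp
qed

end

section \<open>Residues of vertex operators against rational functions\<close>

interpretation cmul: complex_vector_space "(*) :: complex \<Rightarrow> complex \<Rightarrow> complex"
  by unfold_locales (auto simp: algebra_simps)

context complex_vector_space begin

lemma pascal_altsum:
  assumes "\<And>j. pascal (\<lambda>k p. G k p j)" "\<And>k p. vanishes (G k p)"
  shows "pascal (\<lambda>k p. altsum n (G k p))"
  unfolding pascal_def
proof (intro allI)
  fix k p
  have "G (k + 1) p = (\<lambda>j. G k p j + G k (p + 1) j)"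
    using pascalD[OF assms(1)] by auto
  then show "altsum n (G (k + 1) p) = altsum n (G k p) + altsum n (G k (p + 1))"
    by (simp add: altsum_add assms(2))
qed

lemma pascal_sum: "(\<And>j. pascal (\<lambda>k p. G k p j)) \<Longrightarrow> pascal (\<lambda>k p. \<Sum>j\<in>S. G k p j)"
  by (simp add: pascal_def sum.distrib)

lemma pascal_scale: "pascal A \<Longrightarrow> pascal (\<lambda>k p. scale c (A k p))"
  by (simp add: pascal_def scale_right_distrib)

lemma binsum_cong: "(\<And>j. G j = G' j) \<Longrightarrow> binsum n G = binsum n G'"
  by presburger

lemma altsum_cong: "(\<And>j. G j = G' j) \<Longrightarrow> altsum n G = altsum n G'"
  by presburger

lemma altsum_all_zero: "(\<And>j. G j = 0) \<Longrightarrow> altsum n G = 0"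
  using altsum_cong[of G "\<lambda>j. 0"] by simp

lemma binsum_all_zero: "(\<And>j. G j = 0) \<Longrightarrow> binsum n G = 0"
  using binsum_cong[of G "\<lambda>j. 0"] by simp

lemma binsum_weight:
  assumes "vanishes G"
  shows "binsum n (\<lambda>j. scale (of_nat j) (G j)) = scale (of_int n) (binsum (n - 1) (\<lambda>j. G (Suc j)))"
proof -
  from assms obtain N where N: "\<And>j. j \<ge> N \<Longrightarrow> G j = 0"
    by (auto simp: eventually_sequentially)
  have "binsum n (\<lambda>j. scale (of_nat j) (G j)) = (\<Sum>j<Suc N. scale (of_int n gchoose j) (scale (of_nat j) (G j)))"
    using N by (intro binsum_eq) simp
  also have "\<dots> = (\<Sum>j<N. scale (of_nat (Suc j) * (of_int n gchoose Suc j)) (G (Suc j)))"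
    unfolding sum.lessThan_Suc_shift by (simp add: mult.commute)
  also have "\<dots> = (\<Sum>j<N. scale (of_int n) (scale (of_int (n - 1) gchoose j) (G (Suc j))))"
    using gbinomial_absorption[of _ "of_int n :: complex"] by simp
  finally show ?thesis
    using N binsum_eq[of N "\<lambda>j. G (Suc j)" "n - 1"] by (simp add: scale_sum_right)
qed

end

sublocale vertex_algebra \<subseteq> complex_vector_space scale
  by unfold_locales

context vertex_algebra begin

lemma Y_left [simp]:
  "Y (a + a') n b = Y a n b + Y a' n b" "Y (c *s a) n b = c *s Y a n b"
  "Y 0 n b = 0" "Y (- a) n b = - Y a n b" "Y (a - a') n b = Y a n b - Y a' n b"
  "Y (sum f S) n b = (\<Sum>i\<in>S. Y (f i) n b)"
proof -
  interpret l: Vector_Spaces.linear scale scale "\<lambda>a. Y a n b" by (rule Y_linear_left)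
  show "Y (a + a') n b = Y a n b + Y a' n b" "Y (c *s a) n b = c *s Y a n b"
    "Y 0 n b = 0" "Y (- a) n b = - Y a n b" "Y (a - a') n b = Y a n b - Y a' n b"
    "Y (sum f S) n b = (\<Sum>i\<in>S. Y (f i) n b)"
    by (rule l.add l.scale l.zero l.neg l.diff l.sum)+
qed

lemma Y_right [simp]:
  "Y a n (b + b') = Y a n b + Y a n b'" "Y a n (c *s b) = c *s Y a n b"
  "Y a n 0 = 0" "Y a n (- b) = - Y a n b" "Y a n (b - b') = Y a n b - Y a n b'"
  "Y a n (sum f S) = (\<Sum>i\<in>S. Y a n (f i))"
proof -
  interpret l: Vector_Spaces.linear scale scale "Y a n" by (rule Y_linear_right)
  show "Y a n (b + b') = Y a n b + Y a n b'" "Y a n (c *s b) = c *s Y a n b"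
    "Y a n 0 = 0" "Y a n (- b) = - Y a n b" "Y a n (b - b') = Y a n b - Y a n b'"
    "Y a n (sum f S) = (\<Sum>i\<in>S. Y a n (f i))"
    by (rule l.add l.scale l.zero l.neg l.diff l.sum)+
qed

lemma Y_vanishes: "vanishes (\<lambda>j. Y a (n + int j) b)"
proof -
  obtain N where N: "\<forall>n\<ge>N. Y a n b = 0" using Y_truncation by blast
  show ?thesis unfolding eventually_sequentially
    by (rule exI[of _ "nat (N - n)"]) (use N in auto)
qed

lemma vanishes_compose: "vanishes G \<Longrightarrow> (\<And>j. G j = 0 \<Longrightarrow> G' j = 0) \<Longrightarrow> vanishes G'"
  by (erule eventually_mono) simp

lemma borcherds:
  "binsum m (\<lambda>j. Y (Y a (n + int j) b) (m + k - int j) c) =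
   altsum n (\<lambda>j. Y a (m + n - int j) (Y b (k + int j) c)
                - (-1) powi n *s Y b (n + k - int j) (Y a (m + int j) c))"
  using Y_borcherds unfolding borcherds_identity_def binsum_def altsum_def
  by (simp add: mult.commute)

lemma commutator:
  "Y a m (Y b k c) = Y b k (Y a m c) + binsum m (\<lambda>j. Y (Y a (int j) b) (m + k - int j) c)"
  using borcherds[of m a 0 b k c] by simp

lemma iterate:
  "Y (Y a n b) k c = altsum n (\<lambda>j. Y a (n - int j) (Y b (k + int j) c)
                - (-1) powi n *s Y b (n + k - int j) (Y a (int j) c))"
  using borcherds[of 0 a n b k c] by simp

lemma Y_T: "Y (T a) n b = - (of_int n *s Y a (n - 1) b)"
proof -
  have "binsum n (\<lambda>j. Y (Y a (-2 + int j) vac) (n + 0 - int j) b) = 0"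
    unfolding borcherds by (rule altsum_all_zero) (simp add: Y_vac_left)
  moreover have "binsum n (\<lambda>j. Y (Y a (-2 + int j) vac) (n + 0 - int j) b)
     = (\<Sum>j<Suc (Suc 0). (of_int n gchoose j) *s Y (Y a (-2 + int j) vac) (n + 0 - int j) b)"
    by (rule binsum_eq) (simp add: Y_vac_right)
  ultimately show ?thesis
    by (simp add: T_def Y_creation eq_neg_iff_add_eq_0)
qed

lemma T_linear [simp]: "T (a + b) = T a + T b" "T (c *s a) = c *s T a" "T 0 = 0"
  by (simp_all add: T_def)

text \<open>
  This is the residue at \<open>z = 0\<close> of \<open>x\<^sup>k z\<^sup>p Y(a,z)v\<close> with \<open>x = 1 + z\<close>; the power \<open>x\<^sup>k\<close> is expanded
  in powers of \<open>z\<close>. Zhu's product is \<open>a \<circ> b = emode a (deg a) (-2) b\<close>.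
\<close>
definition emode :: "'v \<Rightarrow> int \<Rightarrow> int \<Rightarrow> 'v \<Rightarrow> 'v" where
  "emode a k p v = binsum k (\<lambda>j. Y a (p + int j) v)"

lemma emode_0 [simp]: "emode a 0 p v = Y a p v"
  by (simp add: emode_def)

lemma pascal_emode: "pascal (\<lambda>k p. emode a k p v)"
  unfolding pascal_def emode_def
proof (intro allI)
  fix k p :: int
  show "binsum (k + 1) (\<lambda>j. Y a (p + int j) v) =
     binsum k (\<lambda>j. Y a (p + int j) v) + binsum k (\<lambda>j. Y a (p + 1 + int j) v)"
    using binsum_pascal[OF Y_vanishes[of a p v], of k] by (simp add: algebra_simps)
qed

lemma emode_left [simp]:
  "emode (a + b) k p v = emode a k p v + emode b k p v"
  "emode (c *s a) k p v = c *s emode a k p v"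
  "emode 0 k p v = 0"
  by (simp_all add: emode_def binsum_add binsum_scale Y_vanishes)

lemma emode_right [simp]:
  "emode a k p (v + w) = emode a k p v + emode a k p w"
  "emode a k p (c *s v) = c *s emode a k p v"
  "emode a k p 0 = 0"
  by (simp_all add: emode_def binsum_add binsum_scale Y_vanishes)

lemma emode_bound_finite:
  assumes "finite S"
  shows "\<exists>L. \<forall>(a, v)\<in>S. \<forall>k p. p \<ge> L \<longrightarrow> emode a k p v = 0"
  using assms
proof (induction S)
  case (insert x S)
  obtain a v where x: "x = (a, v)" by fastforce
  obtain N where N: "\<forall>n\<ge>N. Y a n v = 0" using Y_truncation by blast
  have "emode a k p v = 0" if "p \<ge> N" for k p
    unfolding emode_def using N that by (intro binsum_all_zero) auto
  moreover from insert obtain L where "\<forall>(a, v)\<in>S. \<forall>k p. p \<ge> L \<longrightarrow> emode a k p v = 0"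
    by blast
  ultimately show ?case unfolding x
    by (intro exI[of _ "max N L"]) auto
qed simp

lemma emode_bound: "\<exists>L. \<forall>k p. p \<ge> L \<longrightarrow> emode a k p v = 0"
  using emode_bound_finite[of "{(a, v)}"] by simp

lemma emode_vanishes: "vanishes (\<lambda>j. emode a k (p + int j) v)"
proof -
  obtain L where L: "\<forall>k p. p \<ge> L \<longrightarrow> emode a k p v = 0" using emode_bound by blast
  show ?thesis unfolding eventually_sequentially
    by (rule exI[of _ "nat (L - p)"]) (use L in auto)
qed

text \<open>The residue of the derivative of \<open>x\<^sup>k z\<^sup>p Y(a,z)v\<close> is zero.\<close>
lemma emode_T:
  "emode (T a) k p v = - (of_int k *s emode a (k - 1) p v) - of_int p *s emode a k (p - 1) v"
proof -
  have "emode (T a) k p v = binsum k (\<lambda>j. - (of_nat j *s Y a (p - 1 + int j) v) - of_int p *s Y a (p - 1 + int j) v)"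
    unfolding emode_def by (rule binsum_cong) (simp add: Y_T algebra_simps)
  also have "\<dots> = - binsum k (\<lambda>j. of_nat j *s Y a (p - 1 + int j) v) - of_int p *s binsum k (\<lambda>j. Y a (p - 1 + int j) v)"
  proof -
    have 1: "vanishes (\<lambda>j. of_nat j *s Y a (p - 1 + int j) v)"
      "vanishes (\<lambda>j. - (of_nat j *s Y a (p - 1 + int j) v))"
      "vanishes (\<lambda>j. of_int p *s Y a (p - 1 + int j) v)"
      by (rule vanishes_compose[OF Y_vanishes[of a "p - 1" v]]; simp)+
    show ?thesis
      unfolding binsum_diff[OF 1(2,3)] binsum_minus[OF 1(1)] binsum_scale[OF Y_vanishes] ..
  qed
  also have "binsum k (\<lambda>j. of_nat j *s Y a (p - 1 + int j) v) = of_int k *s emode a (k - 1) p v"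
    unfolding emode_def binsum_weight[OF Y_vanishes[of a "p - 1" v]] by simp
  finally show ?thesis by (simp add: emode_def)
qed

text \<open>
  The Borcherds identity with the test function
  \<open>x\<^sub>1\<^bsup>k1\<^esup> z\<^sub>1\<^bsup>p1\<^esup> x\<^sub>2\<^bsup>k2\<^esup> z\<^sub>2\<^bsup>p2\<^esup> (z\<^sub>1 - z\<^sub>2)\<^sup>n\<close> in place of a Laurent monomial. For \<open>k1 = k2 = 0\<close> it is the identity of
  the vertex algebra. Both sides satisfy Pascal's recurrence in \<open>(k1, p1)\<close> and in \<open>(k2, p2)\<close> and
  vanish for large exponents of \<open>z\<close>, so they agree everywhere.
\<close>
proposition emode_borcherds:
  assumes J: "\<And>j. j \<ge> J \<Longrightarrow> Y a (n + int j) b = 0"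
  shows "altsum n (\<lambda>j. emode a k1 (p1 + n - int j) (emode b k2 (p2 + int j) c)
                - (-1) powi n *s emode b k2 (p2 + n - int j) (emode a k1 (p1 + int j) c))
     = (\<Sum>j<J. taylor j (\<lambda>k p. emode (Y a (n + int j) b) (k + k2) (p + p2) c) k1 p1)"
proof -
  define G where "G k1 p1 k2 p2 j = emode a k1 (p1 + n - int j) (emode b k2 (p2 + int j) c)
                - (-1) powi n *s emode b k2 (p2 + n - int j) (emode a k1 (p1 + int j) c)" for k1 p1 k2 p2 j
  define B where "B k1 p1 k2 p2 j = taylor j (\<lambda>k p. emode (Y a (n + int j) b) (k + k2) (p + p2) c) k1 p1" for k1 p1 k2 p2 j
  define D where "D k1 p1 k2 p2 = altsum n (G k1 p1 k2 p2) - (\<Sum>j<J. B k1 p1 k2 p2 j)" for k1 p1 k2 p2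
  have G_vanishes: "vanishes (G k1 p1 k2 p2)" for k1 p1 k2 p2
    using eventually_conj[OF emode_vanishes[of b k2 p2 c] emode_vanishes[of a k1 p1 c]]
    unfolding G_def by (rule eventually_mono) simp
  have lin_left: "pascal (\<lambda>k p. emode d k (p + s) v)" for d s v
    by (rule pascal_shift'(4)[OF pascal_emode])
  have lin_left': "pascal (\<lambda>k p. emode d (l + k) (s + p) v)" for d l s v
    using pascal_shift[OF pascal_emode[of d v], of l s] by (simp add: add.commute)
  have comp: "pascal (\<lambda>k p. emode d l q (A k p))" if "pascal A" for d l q A
    using that by (simp add: pascal_def)
  have G_pascal1: "pascal (\<lambda>k1 p1. G k1 p1 k2 p2 j)" for k2 p2 j
    unfolding G_def
    by (intro pascal_diff pascal_scale comp lin_left)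
       (use lin_left[of a "n - int j"] in \<open>simp add: algebra_simps\<close>)
  have G_pascal2: "pascal (\<lambda>k2 p2. G k1 p1 k2 p2 j)" for k1 p1 j
    unfolding G_def
    by (intro pascal_diff pascal_scale comp lin_left)
       (use lin_left[of b "n - int j"] in \<open>simp add: algebra_simps\<close>)
  have B_pascal1: "pascal (\<lambda>k1 p1. B k1 p1 k2 p2 j)" for k2 p2 j
    unfolding B_def by (intro pascal_taylor pascal_shift pascal_emode)
  have B_pascal2: "pascal (\<lambda>k2 p2. B k1 p1 k2 p2 j)" for k1 p1 j
    unfolding B_def taylor_def
    by (intro pascal_sum pascal_scale lin_left')
  have D_pascal1: "pascal (\<lambda>k1 p1. D k1 p1 k2 p2)" for k2 p2
    unfolding D_def by (intro pascal_diff pascal_altsum pascal_sum G_pascal1 G_vanishes B_pascal1)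
  have D_pascal2: "pascal (\<lambda>k2 p2. D k1 p1 k2 p2)" for k1 p1
    unfolding D_def by (intro pascal_diff pascal_altsum pascal_sum G_pascal2 G_vanishes B_pascal2)
  \<comment> \<open>the case of Laurent monomials\<close>
  have D00: "D 0 p1 0 p2 = 0" for p1 p2
  proof -
    have "altsum n (G 0 p1 0 p2) = binsum p1 (\<lambda>j. Y (Y a (n + int j) b) (p1 + p2 - int j) c)"
      unfolding borcherds G_def by (simp add: add.commute)
    also have "\<dots> = (\<Sum>j<J. B 0 p1 0 p2 j)"
      using J by (subst binsum_eq[of J]) (simp_all add: B_def algebra_simps)
    finally show ?thesis by (simp add: D_def)
  qed
  have D0: "D 0 p1 k2 p2 = 0" for p1 k2 p2
  proof -
    obtain N where N: "\<forall>n\<ge>N. Y a n c = 0" using Y_truncation by blast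
    \<comment> \<open>the finitely many pairs whose modes occur for large \<open>p2\<close>; they have a common truncation bound \<open>L\<close>\<close>
    define S where "S = {(b, c)} \<union> (\<lambda>j. (b, Y a (p1 + int j) c)) ` {..nat (N - p1)}
        \<union> (\<lambda>j. (Y a (n + int j) b, c)) ` {..<J}"
    have "finite S" by (simp add: S_def)
    then obtain L where L: "\<And>d v k p. (d, v) \<in> S \<Longrightarrow> p \<ge> L \<Longrightarrow> emode d k p v = 0"
      using emode_bound_finite[of S] by blast
    define L' where "L' = \<bar>L\<bar> + \<bar>n\<bar> + \<bar>N - p1\<bar> + int J + \<bar>p1\<bar>"
    have "D 0 p1 k p = 0" if p: "p \<ge> L'" for k p
    proof -
      have "G 0 p1 k p j = 0" for j
      proof -
        have "emode b k (p + int j) c = 0"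
          using p by (intro L) (auto simp: S_def L'_def)
        moreover have "emode b k (p + n - int j) (Y a (p1 + int j) c) = 0"
        proof (cases "j \<le> nat (N - p1)")
          case True
          then show ?thesis using p by (intro L) (auto simp: S_def L'_def)
        next
          case False
          then have "Y a (p1 + int j) c = 0" using N by simp
          then show ?thesis by simp
        qed
        ultimately show ?thesis by (simp add: G_def)
      qed
      moreover have "B 0 p1 k p j = 0" if "j < J" for j
      proof -
        have "emode (Y a (n + int j) b) k (p1 - int j + p) c = 0"
          using p that by (intro L) (auto simp: S_def L'_def)
        then show ?thesis by (simp add: B_def)
      qed
      ultimately show ?thesis by (simp add: D_def altsum_all_zero)
    qed
    from pascal_zero_from_column[OF D_pascal2 D00 this] show ?thesis by blast
  qed
  have "D k1 p1 k2 p2 = 0"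
  proof -
    obtain N where N: "\<forall>k n. n\<ge>N \<longrightarrow> emode b k n c = 0" using emode_bound by blast
    define S where "S = {(a, c)} \<union> (\<lambda>j. (a, emode b k2 (p2 + int j) c)) ` {..nat (N - p2)}
        \<union> (\<lambda>j. (Y a (n + int j) b, c)) ` {..<J}"
    have "finite S" by (simp add: S_def)
    then obtain L where L: "\<And>d v k p. (d, v) \<in> S \<Longrightarrow> p \<ge> L \<Longrightarrow> emode d k p v = 0"
      using emode_bound_finite[of S] by blast
    define L' where "L' = \<bar>L\<bar> + \<bar>n\<bar> + \<bar>N - p2\<bar> + int J + \<bar>p2\<bar>"
    have "D k p k2 p2 = 0" if p: "p \<ge> L'" for k p
    proof -
      have "G k p k2 p2 j = 0" for j
      proof -
        have "emode a k (p + int j) c = 0"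
          using p by (intro L) (auto simp: S_def L'_def)
        moreover have "emode a k (p + n - int j) (emode b k2 (p2 + int j) c) = 0"
        proof (cases "j \<le> nat (N - p2)")
          case True
          then show ?thesis using p by (intro L) (auto simp: S_def L'_def)
        next
          case False
          then have "emode b k2 (p2 + int j) c = 0" using N by simp
          then show ?thesis by simp
        qed
        ultimately show ?thesis by (simp add: G_def)
      qed
      moreover have "B k p k2 p2 j = 0" if "j < J" for j
        unfolding B_def taylor_def
      proof (intro sum.neutral ballI)
        fix i assume "i \<in> {..j}"
        have "emode (Y a (n + int j) b) (k - int i + k2) (p - int (j - i) + p2) c = 0"
          using p that by (intro L) (auto simp: S_def L'_def)
        then show "((of_int k gchoose i) * (of_int p gchoose (j - i))) *s
            emode (Y a (n + int j) b) (k - int i + k2) (p - int (j - i) + p2) c = 0" by simp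
      qed
      ultimately show ?thesis by (simp add: D_def altsum_all_zero)
    qed
    from pascal_zero_from_column[OF D_pascal1 D0 this] show ?thesis by blast
  qed
  then show ?thesis by (simp add: D_def G_def[abs_def] B_def)
qed

end

section \<open>The Li filtration and the algebra of leading terms\<close>

context complex_vector_space begin

lemma binsum_subspace:
  assumes S: "subspace S" and G: "\<And>j. G j \<in> S" and v: "vanishes G"
  shows "binsum n G \<in> S"
proof -
  from v obtain N where N: "\<And>j. j \<ge> N \<Longrightarrow> G j = 0"
    by (auto simp: eventually_sequentially)
  have "binsum n G = (\<Sum>j<N. scale (of_int n gchoose j) (G j))"
    using N by (rule binsum_eq)
  also have "\<dots> \<in> S"
    by (intro subspace_sum[OF S] subspace_scale[OF S] G)
  finally show ?thesis .
qed

lemma altsum_subspace: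
  assumes S: "subspace S" and G: "\<And>j. G j \<in> S" and v: "vanishes G"
  shows "altsum n G \<in> S"
  unfolding altsum_def
  by (intro binsum_subspace S subspace_scale[OF S] G vanishes_sign v)

lemma altsum_head:
  assumes v: "vanishes G"
  obtains N where "altsum n G = G 0 + (\<Sum>j<N. scale ((-1) ^ Suc j * (of_int n gchoose Suc j)) (G (Suc j)))"
proof -
  from v obtain N where N: "\<And>j. j \<ge> N \<Longrightarrow> G j = 0"
    by (auto simp: eventually_sequentially)
  have "altsum n G = (\<Sum>j<Suc N. scale ((-1) ^ j * (of_int n gchoose j)) (G j))"
    using N by (intro altsum_eq) simp
  then show ?thesis
    by (intro that[of N]) (simp only: sum.lessThan_Suc_shift, simp)
qed

lemma altsum_subspace_head:
  assumes S: "subspace S" and G: "\<And>j. G (Suc j) \<in> S" and v: "vanishes G"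
  shows "altsum n G - G 0 \<in> S"
proof -
  obtain N where "altsum n G = G 0 + (\<Sum>j<N. scale ((-1) ^ Suc j * (of_int n gchoose Suc j)) (G (Suc j)))"
    using altsum_head[OF v] by blast
  then have "altsum n G - G 0 = (\<Sum>j<N. scale ((-1) ^ Suc j * (of_int n gchoose Suc j)) (G (Suc j)))"
    by simp
  also have "\<dots> \<in> S"
    by (intro subspace_sum[OF S] subspace_scale[OF S] G)
  finally show ?thesis .
qed

end

context vertex_algebra begin

lemma Y_iterate_vanishes: "vanishes (\<lambda>j. Y (Y a (int j) b) (f j) c)"
  using Y_vanishes[of a 0 b] by (rule vanishes_compose) simp_all

abbreviation F where "F \<equiv> li_filtration"

lemma F_subspace: "subspace (F p)"
  unfolding li_filtration_def by (rule subspace_span)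

lemmas F_closed [simp, intro] = subspace_0[OF F_subspace] subspace_add[OF F_subspace]
  subspace_scale[OF F_subspace] subspace_diff[OF F_subspace] subspace_neg[OF F_subspace]
  subspace_sum[OF F_subspace]

lemma F_mono: "p \<le> q \<Longrightarrow> F q \<subseteq> F p"
  unfolding li_filtration_def by (rule span_mono) auto

lemma F_monoD: "v \<in> F q \<Longrightarrow> p \<le> q \<Longrightarrow> v \<in> F p"
  using F_mono by blast

lemma F_monomial: "sum_list (map snd xs) \<ge> p \<Longrightarrow> li_monomial xs \<in> F p"
  unfolding li_filtration_def by (rule span_base) blast

lemma F_0 [simp]: "v \<in> F 0"
  using F_monomial[of 0 "[(v, 0)]"] by (simp add: li_monomial_def Y_creation)

lemma F_induct [consumes 1, case_names zero add scale monomial]: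
  assumes "v \<in> F p" "P 0" "\<And>u v. P u \<Longrightarrow> P v \<Longrightarrow> P (u + v)" "\<And>c v. P v \<Longrightarrow> P (c *s v)"
    "\<And>xs. sum_list (map snd xs) \<ge> p \<Longrightarrow> P (li_monomial xs)"
  shows "P v"
proof -
  have "subspace {v. P v}" using assms by (auto simp: subspace_def)
  from span_induct[OF _ this] assms(1,5) show ?thesis
    unfolding li_filtration_def by blast
qed

lemma F_negative_mode:
  assumes "v \<in> F p" shows "Y a (- int n - 1) v \<in> F (p + n)"
  using assms
proof (induction rule: F_induct)
  case (monomial xs)
  then show ?case
    using F_monomial[of "p + n" "(a, n) # xs"] by (simp add: li_monomial_def)
qed auto

lemma F_negative_mode': "v \<in> F p \<Longrightarrow> m < 0 \<Longrightarrow> int q \<le> int p - m - 1 \<Longrightarrow> Y a m v \<in> F q"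
  using F_monoD[OF F_negative_mode[of v p a "nat (- m - 1)"], of q] by auto

text \<open>Commute the mode past the leftmost factor of the monomial.\<close>
lemma F_monomial_nonneg_mode:
  "Y a (int m) (li_monomial xs) \<in> F (sum_list (map snd xs) - m)"
proof (induction xs arbitrary: a m)
  case Nil
  then show ?case by (simp add: li_monomial_def Y_vac_right)
next
  case (Cons x xs)
  obtain b n where x: "x = (b, n)" by fastforce
  let ?u = "li_monomial xs" and ?s = "sum_list (map snd xs)"
  have u: "?u \<in> F ?s" by (rule F_monomial) simp
  have "Y a (int m) (li_monomial (x # xs)) =
      Y b (- int n - 1) (Y a (int m) ?u)
      + binsum (int m) (\<lambda>j. Y (Y a (int j) b) (int m + (- int n - 1) - int j) ?u)"
    unfolding commutator[of a "int m" b "- int n - 1" ?u, symmetric] by (simp add: x li_monomial_def)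
  also have "\<dots> \<in> F (sum_list (map snd (x # xs)) - m)"
  proof (intro F_closed binsum_subspace F_subspace)
    show "Y b (- int n - 1) (Y a (int m) ?u) \<in> F (sum_list (map snd (x # xs)) - m)"
      using F_negative_mode'[OF Cons.IH[of a m], of "- int n - 1"] by (simp add: x)
    show "vanishes (\<lambda>j. Y (Y a (int j) b) (int m + (- int n - 1) - int j) ?u)"
      by (rule Y_iterate_vanishes)
    fix j
    show "Y (Y a (int j) b) (int m + (- int n - 1) - int j) ?u \<in> F (sum_list (map snd (x # xs)) - m)"
    proof (cases "int m + (- int n - 1) - int j < 0")
      case True
      then show ?thesis by (intro F_negative_mode'[OF u]) (auto simp: x)
    next
      case False
      then have 1: "int m + (- int n - 1) - int j = int (m - n - 1 - j)" by simp
      show ?thesis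
        unfolding 1 by (rule F_monoD[OF Cons.IH]) (use False in \<open>auto simp: x\<close>)
    qed
  qed
  finally show ?case .
qed

lemma F_nonneg_mode:
  assumes "v \<in> F p" shows "Y a (int m) v \<in> F (p - m)"
  using assms
proof (induction rule: F_induct)
  case (monomial xs)
  then show ?case
    by (intro F_monoD[OF F_monomial_nonneg_mode[of a m xs]]) simp
qed auto

lemma F_monomial_mode:
  assumes "v \<in> F j"
  shows "Y (li_monomial xs) k v \<in> F (nat (int (sum_list (map snd xs)) + int j - (if k < 0 then k + 1 else k)))"
  using assms
proof (induction xs arbitrary: v j k)
  case Nil
  then show ?case by (auto simp: li_monomial_def Y_vac_left)
next
  case (Cons x xs)
  obtain b n where x: "x = (b, n)" by fastforce
  let ?u = "li_monomial xs" and ?s = "sum_list (map snd xs)"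
  define q where "q = nat (int (sum_list (map snd (x # xs))) + int j - (if k < 0 then k + 1 else k))"
  have "Y (li_monomial (x # xs)) k v = altsum (- int n - 1) (\<lambda>s. Y b (- int n - 1 - int s) (Y ?u (k + int s) v)
      - (-1) powi (- int n - 1) *s Y ?u (- int n - 1 + k - int s) (Y b (int s) v))"
    unfolding iterate[symmetric] by (simp add: x li_monomial_def)
  also have "\<dots> \<in> F q"
  proof (intro altsum_subspace F_subspace F_closed)
    show "vanishes (\<lambda>s. Y b (- int n - 1 - int s) (Y ?u (k + int s) v)
      - (-1) powi (- int n - 1) *s Y ?u (- int n - 1 + k - int s) (Y b (int s) v))"
      using eventually_conj[OF Y_vanishes[of ?u k v] Y_vanishes[of b 0 v]]
      by (rule eventually_mono) simp
  next
    fix s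
    show "Y b (- int n - 1 - int s) (Y ?u (k + int s) v) \<in> F q"
      by (rule F_negative_mode'[OF Cons.IH[OF Cons.prems, of "k + int s"]]) (auto simp: q_def x)
    have 1: "Y b (int s) v \<in> F (j - s)" by (rule F_nonneg_mode[OF Cons.prems])
    show "Y ?u (- int n - 1 + k - int s) (Y b (int s) v) \<in> F q"
      by (rule F_monoD[OF Cons.IH[OF 1]]) (auto simp: q_def x)
  qed
  finally show ?case by (simp add: q_def)
qed

text \<open>
  The bound \<open>i + j - k - 1\<close> improves by one for nonnegative \<open>k\<close>, because the commutators of modes
  raise the Li degree: \<open>gr V\<close> is commutative. The control of Zhu's relations to leading order rests
  on that extra degree.
\<close>
lemma F_mode:
  assumes "a \<in> F i" "b \<in> F j" "int q \<le> int i + int j - (if k < 0 then k + 1 else k) \<or> q = 0"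
  shows "Y a k b \<in> F q"
proof (cases "q = 0")
  case False
  with assms(3) have q: "int q \<le> int i + int j - (if k < 0 then k + 1 else k)" by blast
  from assms(1) show ?thesis
  proof (induction rule: F_induct)
    case (monomial xs)
    then show ?case
      using q by (intro F_monoD[OF F_monomial_mode[OF assms(2), of xs k]]) auto
  qed auto
qed simp

lemma F_T: "a \<in> F p \<Longrightarrow> T a \<in> F (Suc p)"
  unfolding T_def by (rule F_mode[of _ p _ 0]) auto

lemma mem_li_symbol: "b \<in> li_symbol p a \<longleftrightarrow> b - a \<in> F (Suc p)"
proof
  assume "b \<in> li_symbol p a" then show "b - a \<in> F (Suc p)" by (auto simp: li_symbol_def)
next
  assume "b - a \<in> F (Suc p)"
  then show "b \<in> li_symbol p a" unfolding li_symbol_def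
    by (intro CollectI exI[of _ "b - a"]) simp
qed

lemma li_symbol_self [simp]: "a \<in> li_symbol p a"
  by (simp add: mem_li_symbol)

lemma li_symbol_eq_iff: "li_symbol p a = li_symbol p b \<longleftrightarrow> a - b \<in> F (Suc p)"
proof
  assume "li_symbol p a = li_symbol p b"
  then show "a - b \<in> F (Suc p)" using li_symbol_self[of a p] by (simp add: mem_li_symbol)
next
  assume *: "a - b \<in> F (Suc p)"
  have "x - a \<in> F (Suc p) \<longleftrightarrow> x - b \<in> F (Suc p)" for x
    using F_closed(2)[OF _ *, of "x - a"] F_closed(4)[OF _ *, of "x - b"] by auto
  then show "li_symbol p a = li_symbol p b" by (auto simp: mem_li_symbol)
qed

lemma li_symbol_binop:
  assumes "\<And>a' b'. a' - a \<in> F (Suc p) \<Longrightarrow> b' - b \<in> F (Suc p) \<Longrightarrow> f a' b' - f a b \<in> F (Suc p)"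
  shows "(\<Union>a'\<in>li_symbol p a. \<Union>b'\<in>li_symbol p b. li_symbol p (f a' b')) = li_symbol p (f a b)"
proof -
  have *: "li_symbol p (f a' b') = li_symbol p (f a b)"
    if "a' \<in> li_symbol p a" "b' \<in> li_symbol p b" for a' b'
    unfolding li_symbol_eq_iff using that by (intro assms) (simp_all only: mem_li_symbol)
  have **: "(\<Union>b'\<in>li_symbol p b. li_symbol p (f a' b')) = li_symbol p (f a b)"
    if "a' \<in> li_symbol p a" for a'
    by (rule UN_constant_eq[OF li_symbol_self]) (rule ballI, rule *[OF that])
  show ?thesis by (rule UN_constant_eq[OF li_symbol_self]) (rule ballI, rule **)
qed

lemma R_V_ops:
  "carrier R_V = range (li_symbol 0)"
  "\<one>\<^bsub>R_V\<^esub> = li_symbol 0 vac"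
  "\<zero>\<^bsub>R_V\<^esub> = li_symbol 0 0"
  "li_symbol 0 a \<otimes>\<^bsub>R_V\<^esub> li_symbol 0 b = li_symbol 0 (Y a (-1) b)"
  "li_symbol 0 a \<oplus>\<^bsub>R_V\<^esub> li_symbol 0 b = li_symbol 0 (a + b)"
  "c \<odot>\<^bsub>R_V\<^esub> li_symbol 0 a = li_symbol 0 (c *s a)"
proof -
  show "li_symbol 0 a \<otimes>\<^bsub>R_V\<^esub> li_symbol 0 b = li_symbol 0 (Y a (-1) b)"
    unfolding R_V_def monoid.simps partial_object.simps
  proof (subst li_symbol_binop)
    fix a' b' assume *: "a' - a \<in> F (Suc 0)" "b' - b \<in> F (Suc 0)"
    have "Y (a' - a) (-1) b' \<in> F (Suc 0)" "Y a (-1) (b' - b) \<in> F (Suc 0)"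
      using F_mode[OF *(1), of b' 0] F_mode[OF _ *(2), of a 0] by auto
    then have "Y (a' - a) (-1) b' + Y a (-1) (b' - b) \<in> F (Suc 0)" by (rule F_closed)
    then show "Y a' (-1) b' - Y a (-1) b \<in> F (Suc 0)" by simp
  qed simp
  show "li_symbol 0 a \<oplus>\<^bsub>R_V\<^esub> li_symbol 0 b = li_symbol 0 (a + b)"
    unfolding R_V_def ring.simps
  proof (subst li_symbol_binop)
    fix a' b' assume *: "a' - a \<in> F (Suc 0)" "b' - b \<in> F (Suc 0)"
    from F_closed(2)[OF this] show "a' + b' - (a + b) \<in> F (Suc 0)" by (simp add: add_diff_add)
  qed simp
  have "li_symbol 0 (c *s a') = li_symbol 0 (c *s a)" if "a' \<in> li_symbol 0 a" for a'
    using that by (simp add: li_symbol_eq_iff mem_li_symbol flip: scale_right_diff_distrib)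
  then show "c \<odot>\<^bsub>R_V\<^esub> li_symbol 0 a = li_symbol 0 (c *s a)"
    unfolding R_V_def module.simps by (intro UN_constant_eq[OF li_symbol_self] ballI)
qed (simp_all add: R_V_def)

lemma normal_product_commute: "Y a (-1) b - Y b (-1) a \<in> F (Suc 0)"
proof -
  have "Y a (-1) (Y b (-1) vac) - Y b (-1) (Y a (-1) vac) \<in> F (Suc 0)"
    unfolding commutator[of a "-1" b]
    by (auto intro!: Y_iterate_vanishes binsum_subspace F_subspace F_mode[of _ 0 _ 0])
  then show ?thesis by (simp add: Y_creation)
qed

lemma normal_product_assoc: "Y (Y a (-1) b) (-1) c - Y a (-1) (Y b (-1) c) \<in> F (Suc 0)"
proof -
  let ?G = "\<lambda>j. Y a (-1 - int j) (Y b (-1 + int j) c) - (-1) powi (-1) *s Y b (-1 + -1 - int j) (Y a (int j) c)"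
  have v: "vanishes ?G"
    using eventually_conj[OF Y_vanishes[of b "-1" c] Y_vanishes[of a 0 c]]
    by (rule eventually_mono) simp
  have "altsum (-1) ?G - ?G 0 \<in> F (Suc 0)"
    by (rule altsum_subspace_head[OF F_subspace _ v]) (auto intro!: F_mode[of _ 0 _ 0])
  moreover have "Y b (-2) (Y a 0 c) \<in> F (Suc 0)" by (rule F_mode[of _ 0 _ 0]) auto
  ultimately have "altsum (-1) ?G - ?G 0 + Y b (-2) (Y a 0 c) \<in> F (Suc 0)" by (rule F_closed)
  then show ?thesis unfolding iterate[symmetric] by simp
qed

proposition R_V_algebra: "algebra complex_ring R_V"
proof (rule algebraI)
  show "cring complex_ring" by (rule cring_from_type_algebra)
  show "cring R_V"
  proof (rule cringI)
    show "abelian_group R_V"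
    proof (rule abelian_groupI)
      fix x assume "x \<in> carrier R_V"
      then obtain a where a: "x = li_symbol 0 a" by (auto simp: R_V_ops)
      show "\<exists>y\<in>carrier R_V. y \<oplus>\<^bsub>R_V\<^esub> x = \<zero>\<^bsub>R_V\<^esub>"
        by (rule bexI[of _ "li_symbol 0 (- a)"]) (auto simp: R_V_ops a)
    qed (auto simp: R_V_ops algebra_simps)
    show "Group.comm_monoid R_V"
    proof (rule comm_monoidI)
      fix x y z assume "x \<in> carrier R_V" "y \<in> carrier R_V" "z \<in> carrier R_V"
      then show "x \<otimes>\<^bsub>R_V\<^esub> y \<otimes>\<^bsub>R_V\<^esub> z = x \<otimes>\<^bsub>R_V\<^esub> (y \<otimes>\<^bsub>R_V\<^esub> z)"
        by (auto simp: R_V_ops li_symbol_eq_iff[THEN iffD2, OF normal_product_assoc])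
    next
      fix x y assume "x \<in> carrier R_V" "y \<in> carrier R_V"
      then obtain a b where ab: "x = li_symbol 0 a" "y = li_symbol 0 b" by (auto simp: R_V_ops)
      show "x \<otimes>\<^bsub>R_V\<^esub> y = y \<otimes>\<^bsub>R_V\<^esub> x"
        unfolding ab R_V_ops by (rule li_symbol_eq_iff[THEN iffD2, OF normal_product_commute])
    qed (auto simp: R_V_ops Y_vac_left)
  qed (auto simp: R_V_ops)
qed (auto simp: R_V_ops ring_of_type_algebra_def scale_left_distrib scale_right_distrib)

end

section \<open>Linear functionals and weights\<close>

context vertex_algebra begin

definition functional :: "('v \<Rightarrow> complex) \<Rightarrow> bool" where
  "functional f \<longleftrightarrow> (\<forall>a b. f (a + b) = f a + f b) \<and> (\<forall>c a. f (c *s a) = c * f a)"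

lemma functional_simps:
  assumes "functional f"
  shows "f (a + b) = f a + f b" "f (c *s a) = c * f a" "f 0 = 0" "f (- a) = - f a"
    "f (a - b) = f a - f b" "f (sum g S) = (\<Sum>i\<in>S. f (g i))"
proof -
  show add: "f (a + b) = f a + f b" for a b using assms by (simp add: functional_def)
  show "f (c *s a) = c * f a" for c a using assms by (simp add: functional_def)
  from this[of 0 0] show zero: "f 0 = 0" by simp
  from \<open>\<And>c a. f (c *s a) = c * f a\<close>[of "-1" a] show neg: "f (- a) = - f a" for a
    using assms by (metis functional_def mult_minus1 scale_minus_left scale_one)
  show "f (a - b) = f a - f b" using add[of a "- b"] neg[of b] by simp
  show "f (sum g S) = (\<Sum>i\<in>S. f (g i))"
    by (induction S rule: infinite_finite_induct) (simp_all add: zero add)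
qed

lemma functional_binsum:
  assumes "functional f" "vanishes G"
  shows "f (binsum n G) = cmul.binsum n (\<lambda>j. f (G j))"
proof -
  from assms(2) obtain N where N: "\<And>j. j \<ge> N \<Longrightarrow> G j = 0"
    by (auto simp: eventually_sequentially)
  have "binsum n G = (\<Sum>j<N. (of_int n gchoose j) *s G j)"
    using N by (rule binsum_eq)
  moreover have "cmul.binsum n (\<lambda>j. f (G j)) = (\<Sum>j<N. (of_int n gchoose j) * f (G j))"
    using N by (intro cmul.binsum_eq) (simp add: functional_simps[OF assms(1)])
  ultimately show ?thesis by (simp add: functional_simps[OF assms(1)])
qed

lemma functional_altsum:
  assumes "functional f" "vanishes G"
  shows "f (altsum n G) = cmul.altsum n (\<lambda>j. f (G j))"
  unfolding altsum_def cmul.altsum_def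
  by (simp add: functional_binsum[OF assms(1) vanishes_sign[OF assms(2)]] functional_simps[OF assms(1)])

lemma functional_emode: "functional f \<Longrightarrow> functional (\<lambda>v. f (emode a k p v))"
  by (simp add: functional_def)

lemma functional_altsum_head:
  assumes "functional f" "vanishes G" "\<And>j. f (G (Suc j)) = 0"
  shows "f (altsum n G) = f (G 0)"
proof -
  obtain N where "altsum n G = G 0 + (\<Sum>j<N. ((-1) ^ Suc j * (of_int n gchoose Suc j)) *s (G (Suc j)))"
    using altsum_head[OF assms(2)] by blast
  then show ?thesis using assms(3) by (simp add: functional_simps[OF assms(1)])
qed

lemma functional_emode_head:
  assumes f: "functional f" and z: "\<And>u. f (Y b (p + 1 + int u) c) = 0"
  shows "f (emode b k p c) = f (Y b p c)"
proof -
  obtain N where N: "\<And>j. j \<ge> N \<Longrightarrow> Y b (p + int j) c = 0"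
    using Y_vanishes[of b p c] by (auto simp: eventually_sequentially)
  have "emode b k p c = (\<Sum>j<Suc N. (of_int k gchoose j) *s Y b (p + int j) c)"
    unfolding emode_def using N by (intro binsum_eq) simp
  also have "f \<dots> = f (Y b p c)"
    unfolding sum.lessThan_Suc_shift
    using z by (simp add: functional_simps[OF f] add.assoc)
  finally show ?thesis .
qed

end

locale N_graded_vertex_algebra = graded_vertex_algebra scale vac Y H
  for scale :: "complex \<Rightarrow> 'v::ab_group_add \<Rightarrow> 'v" (infixr \<open>*s\<close> 75) and vac Y H +
  assumes N_graded: N_graded
    and weight_decomposition: "internal_direct_sum UNIV (\<lambda>n. weight_space (of_nat n)) UNIV"
begin

definition W :: "int \<Rightarrow> 'v set" where "W w = weight_space (of_int w)"

lemma H_simps: "H (a + b) = H a + H b" "H (c *s a) = c *s H a" "H 0 = 0"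
proof -
  interpret l: Vector_Spaces.linear scale scale H by (rule H_linear)
  show "H (a + b) = H a + H b" "H (c *s a) = c *s H a" "H 0 = 0"
    by (rule l.add l.scale l.zero)+
qed

lemma W_subspace: "subspace (W w)"
  by (auto simp: subspace_def W_def weight_space_def H_simps scale_right_distrib scale_left_commute)

lemmas W_closed [simp] = subspace_0[OF W_subspace] subspace_add[OF W_subspace]
  subspace_scale[OF W_subspace] subspace_diff[OF W_subspace] subspace_neg[OF W_subspace]
  subspace_sum[OF W_subspace]

lemma W_negative: "a \<in> W w \<Longrightarrow> w < 0 \<Longrightarrow> a = 0"
proof (rule ccontr)
  assume "a \<in> W w" "w < 0" "a \<noteq> 0"
  then have "of_int w \<in> (\<nat> :: complex set)"
    using N_graded by (auto simp: N_graded_def W_def weight_space_def)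
  then obtain n where "(of_int w :: complex) = of_nat n" by (auto simp: Nats_def)
  then have "(of_int w :: complex) = of_int (int n)" by simp
  then have "w = int n" by (simp only: of_int_eq_iff)
  with \<open>w < 0\<close> show False by simp
qed

lemma Y_weight:
  assumes "a \<in> W \<alpha>" "b \<in> W \<beta>" "w = \<alpha> + \<beta> - k - 1"
  shows "Y a k b \<in> W w"
proof -
  have "H (Y a k b) = of_int (- k - 1) *s Y a k b + of_int \<alpha> *s Y a k b + of_int \<beta> *s Y a k b"
    using H_commutator[of a k b] assms(1,2)
    unfolding W_def weight_space_def by (simp add: diff_eq_eq)
  also have "\<dots> = of_int (- k - 1 + \<alpha> + \<beta>) *s Y a k b"
    by (simp only: scale_left_distrib of_int_add)
  also have "- k - 1 + \<alpha> + \<beta> = w" using assms(3) by simp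
  finally show ?thesis by (simp add: W_def weight_space_def)
qed

lemma vac_weight: "vac \<in> W 0"
  using H_commutator[of vac "-1" vac] by (simp add: W_def weight_space_def Y_vac_left Y_creation)

lemma T_weight: "a \<in> W \<alpha> \<Longrightarrow> w = \<alpha> + 1 \<Longrightarrow> T a \<in> W w"
  unfolding T_def by (rule Y_weight[OF _ vac_weight]) auto

definition decomposes :: "'v \<Rightarrow> (nat \<Rightarrow> 'v) \<Rightarrow> bool" where
  "decomposes v f \<longleftrightarrow> (\<forall>n. f n \<in> W (int n)) \<and> finite {n. f n \<noteq> 0} \<and> v = (\<Sum>n | f n \<noteq> 0. f n)"

lemma decomposes_unique: "\<exists>!f. decomposes v f"
  using weight_decomposition by (simp add: internal_direct_sum_def decomposes_def W_def)

text \<open>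
  Integer weights, with zero components in negative weight, avoid case distinctions for
  the weight \<open>deg a + deg b - k - 1\<close> of \<open>a\<^bsub>(k)\<^esub>b\<close>.
\<close>
definition wcomp :: "int \<Rightarrow> 'v \<Rightarrow> 'v" where
  "wcomp w v = (if w < 0 then 0 else (THE f. decomposes v f) (nat w))"

lemma decomposes_wcomp: "decomposes v (\<lambda>n. wcomp (int n) v)"
  using theI'[OF decomposes_unique[of v]] by (simp add: wcomp_def)

lemma wcomp_eqI: "decomposes v f \<Longrightarrow> wcomp (int n) v = f n"
  using decomposes_unique[of v] decomposes_wcomp[of v] by metis

lemma decomposesI:
  assumes "\<And>n. f n \<in> W (int n)" "\<And>n. n \<ge> N \<Longrightarrow> f n = 0" "v = (\<Sum>n<N. f n)"
  shows "decomposes v f"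
proof -
  have *: "{n. f n \<noteq> 0} \<subseteq> {..<N}"
  proof (rule subsetI)
    fix n assume "n \<in> {n. f n \<noteq> 0}"
    then show "n \<in> {..<N}" using assms(2)[of n] by (cases "N \<le> n") auto
  qed
  have "(\<Sum>n | f n \<noteq> 0. f n) = (\<Sum>n<N. f n)"
    by (rule sum.mono_neutral_left) (use * in auto)
  with finite_subset[OF *] assms show ?thesis by (simp add: decomposes_def)
qed

lemma wcomp_sum:
  obtains N where "\<And>w. w \<ge> int N \<Longrightarrow> wcomp w v = 0" "v = (\<Sum>n<N. wcomp (int n) v)"
proof -
  have d: "finite {n. wcomp (int n) v \<noteq> 0}" "v = (\<Sum>n | wcomp (int n) v \<noteq> 0. wcomp (int n) v)"
    using decomposes_wcomp[of v] unfolding decomposes_def by blast+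
  obtain N where N: "{n. wcomp (int n) v \<noteq> 0} \<subseteq> {..<N}"
    using finite_nat_bounded[OF d(1)] by blast
  show ?thesis
  proof (rule that[of N])
    fix w assume w: "w \<ge> int N"
    show "wcomp w v = 0"
    proof (rule ccontr)
      assume "wcomp w v \<noteq> 0"
      with w have "nat w \<in> {n. wcomp (int n) v \<noteq> 0}" by simp
      with N have "nat w < N" by blast
      with w show False by simp
    qed
  next
    have "(\<Sum>n | wcomp (int n) v \<noteq> 0. wcomp (int n) v) = (\<Sum>n<N. wcomp (int n) v)"
      by (rule sum.mono_neutral_left) (use N in auto)
    with d(2) show "v = (\<Sum>n<N. wcomp (int n) v)" by simp
  qed
qed

lemma wcomp_mem [simp]: "wcomp w v \<in> W w"
  using decomposes_wcomp[of v] by (cases "w < 0") (auto simp: wcomp_def decomposes_def dest!: spec[of _ "nat w"])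

lemma wcomp_negative: "w < 0 \<Longrightarrow> wcomp w v = 0"
  by (simp add: wcomp_def)

lemma wcomp_of_mem: "v \<in> W u \<Longrightarrow> wcomp w v = (if w = u then v else 0)"
proof (cases "w < 0")
  case True then show "v \<in> W u \<Longrightarrow> ?thesis" using W_negative[of v u] by (auto simp: wcomp_negative)
next
  case False
  assume v: "v \<in> W u"
  show ?thesis
  proof (cases "u < 0")
    case True
    then have "v = 0" using v W_negative by blast
    moreover have "decomposes 0 (\<lambda>n. 0)" by (simp add: decomposes_def)
    ultimately show ?thesis using wcomp_eqI[of v "\<lambda>n. 0" "nat w"] False by simp
  next
    case u: False
    have "decomposes v (\<lambda>n. if n = nat u then v else 0)"
      by (rule decomposesI[of _ "Suc (nat u)"]) (use v u in auto)
    from wcomp_eqI[OF this, of "nat w"] False u show ?thesis by (auto simp: nat_eq_iff)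
  qed
qed

lemma wcomp_add [simp]: "wcomp w (a + b) = wcomp w a + wcomp w b"
proof (cases "w < 0")
  case False
  obtain N where N: "\<And>w. w \<ge> int N \<Longrightarrow> wcomp w a = 0" "a = (\<Sum>n<N. wcomp (int n) a)"
    using wcomp_sum[of a] by blast
  obtain M where M: "\<And>w. w \<ge> int M \<Longrightarrow> wcomp w b = 0" "b = (\<Sum>n<M. wcomp (int n) b)"
    using wcomp_sum[of b] by blast
  have 1: "a = (\<Sum>n<max N M. wcomp (int n) a)"
    by (subst N(2), rule sum.mono_neutral_left) (auto simp: N(1))
  have 2: "b = (\<Sum>n<max N M. wcomp (int n) b)"
    by (subst M(2), rule sum.mono_neutral_left) (auto simp: M(1))
  have "decomposes (a + b) (\<lambda>n. wcomp (int n) a + wcomp (int n) b)"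
    using 1 2 by (intro decomposesI[of _ "max N M"]) (auto simp: N(1) M(1) sum.distrib)
  from wcomp_eqI[OF this, of "nat w"] False show ?thesis by simp
qed (simp add: wcomp_negative)

lemma wcomp_scale [simp]: "wcomp w (c *s a) = c *s wcomp w a"
proof (cases "w < 0")
  case False
  obtain N where N: "\<And>w. w \<ge> int N \<Longrightarrow> wcomp w a = 0" "a = (\<Sum>n<N. wcomp (int n) a)"
    using wcomp_sum[of a] by blast
  have "decomposes (c *s a) (\<lambda>n. c *s wcomp (int n) a)"
    using N(2) by (intro decomposesI[of _ N]) (auto simp: N(1) simp flip: scale_sum_right)
  from wcomp_eqI[OF this, of "nat w"] False show ?thesis by simp
qed (simp add: wcomp_negative)

lemma wcomp_zero [simp]: "wcomp w 0 = 0"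
  using wcomp_scale[of w 0 0] by simp

lemma wcomp_sum' [simp]: "wcomp w (sum f S) = (\<Sum>i\<in>S. wcomp w (f i))"
  by (induction S rule: infinite_finite_induct) auto

lemma homogeneous_induct [case_names homogeneous add]:
  assumes "\<And>w v. v \<in> W w \<Longrightarrow> P v" "\<And>u v. P u \<Longrightarrow> P v \<Longrightarrow> P (u + v)"
  shows "P v"
proof -
  obtain N where "v = (\<Sum>n<N. wcomp (int n) v)" using wcomp_sum[of v] by blast
  moreover have "P (\<Sum>n<N. wcomp (int n) v)" for N
  proof (induction N)
    case 0 show ?case using assms(1)[OF W_closed(1)] by simp
  next
    case (Suc N) then show ?case using assms(1)[OF wcomp_mem] by (simp add: assms(2))
  qed
  ultimately show ?thesis by metis
qed

lemma wcomp_Y: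
  assumes "a \<in> W \<alpha>"
  shows "wcomp w (Y a k v) = Y a k (wcomp (w - \<alpha> + k + 1) v)"
proof (induction v rule: homogeneous_induct)
  case (homogeneous u v)
  then have "Y a k v \<in> W (\<alpha> + u - k - 1)" using Y_weight[OF assms] by blast
  with homogeneous show ?case by (auto simp: wcomp_of_mem)
qed simp

lemma F_monomial_wcomp:
  "wcomp w (li_monomial xs) \<in> F (sum_list (map snd xs))
    \<and> (w < int (sum_list (map snd xs)) \<longrightarrow> wcomp w (li_monomial xs) = 0)"
proof (induction xs arbitrary: w)
  case Nil
  then show ?case by (simp add: wcomp_negative)
next
  case (Cons x xs)
  obtain a n where x: "x = (a, n)" by fastforce
  let ?u = "li_monomial xs"
  obtain N where N: "a = (\<Sum>i<N. wcomp (int i) a)" using wcomp_sum[of a] by blast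
  have "li_monomial (x # xs) = (\<Sum>i<N. Y (wcomp (int i) a) (- int n - 1) ?u)"
    by (subst Y_left(6)[symmetric]) (simp add: x li_monomial_def flip: N)
  then have *: "wcomp w (li_monomial (x # xs)) =
      (\<Sum>i<N. Y (wcomp (int i) a) (- int n - 1) (wcomp (w - int i - int n) ?u))"
    by (simp add: wcomp_Y[OF wcomp_mem] algebra_simps)
  have "Y (wcomp (int i) a) (- int n - 1) (wcomp (w - int i - int n) ?u) \<in> F (sum_list (map snd (x # xs)))" for i
    using F_negative_mode[of "wcomp (w - int i - int n) ?u" "sum_list (map snd xs)" _ n] Cons.IH
    by (simp add: x add.commute)
  moreover have "wcomp (w - int i - int n) ?u = 0" if "w < int (sum_list (map snd (x # xs)))" for i
    using that Cons.IH by (simp add: x)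
  ultimately show ?case unfolding * by (auto intro!: F_closed)
qed

lemma F_wcomp: "v \<in> F p \<Longrightarrow> wcomp w v \<in> F p"
proof (induction rule: F_induct)
  case (monomial xs)
  then show ?case using F_monomial_wcomp by (blast intro: F_monoD)
qed auto

lemma F_wcomp_zero: "v \<in> F p \<Longrightarrow> w < int p \<Longrightarrow> wcomp w v = 0"
proof (induction rule: F_induct)
  case (monomial xs)
  then have "w < int (sum_list (map snd xs))" by simp
  then show ?case using F_monomial_wcomp by blast
qed auto

lemma F_weight_zero: "v \<in> F p \<Longrightarrow> v \<in> W w \<Longrightarrow> w < int p \<Longrightarrow> v = 0"
  using F_wcomp_zero[of v p w] by (simp add: wcomp_of_mem)

lemma F_homogeneous_induct [consumes 1, case_names homogeneous add]:
  assumes "v \<in> F p" "\<And>w v. v \<in> W w \<Longrightarrow> v \<in> F p \<Longrightarrow> P v" "\<And>u v. P u \<Longrightarrow> P v \<Longrightarrow> P (u + v)"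
  shows "P v"
proof -
  obtain N where "v = (\<Sum>n<N. wcomp (int n) v)" using wcomp_sum[of v] by blast
  moreover have "P (\<Sum>n<N. wcomp (int n) v)" for N
  proof (induction N)
    case 0 show ?case using assms(2)[OF W_closed(1) F_closed(1)] by simp
  next
    case (Suc N) then show ?case using assms(2)[OF wcomp_mem F_wcomp[OF assms(1)]] by (simp add: assms(3))
  qed
  ultimately show ?thesis by metis
qed

end

section \<open>Zhu's relations to leading order\<close>

context N_graded_vertex_algebra begin

text \<open>
  The element \<open>a \<circ> b\<close> has components in weights up to \<open>deg a + deg b + 1\<close>. The functional kills those
  Zhu elements whose top weight is below \<open>N\<close>.
\<close>
definition zhu_below :: "int \<Rightarrow> ('v \<Rightarrow> complex) \<Rightarrow> bool" where
  "zhu_below N f \<longleftrightarrow> (\<forall>\<alpha> \<beta> a b. a \<in> W \<alpha> \<longrightarrow> b \<in> W \<beta> \<longrightarrow> \<alpha> + \<beta> + 1 < N \<longrightarrow> f (emode a \<alpha> (-2) b) = 0)"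

text \<open>
  In the top weight \<open>N\<close> itself, only Zhu elements of Li degree at least \<open>s\<close> are required to be killed.
  As \<open>s\<close> decreases to \<open>0\<close> this becomes the full condition in weight \<open>N\<close>.
\<close>
definition zhu_at :: "int \<Rightarrow> nat \<Rightarrow> ('v \<Rightarrow> complex) \<Rightarrow> bool" where
  "zhu_at N s f \<longleftrightarrow> (\<forall>\<alpha> \<beta> i j a b. a \<in> W \<alpha> \<longrightarrow> b \<in> W \<beta> \<longrightarrow> a \<in> F i \<longrightarrow> b \<in> F j
      \<longrightarrow> \<alpha> + \<beta> + 1 = N \<longrightarrow> i + j \<ge> s \<longrightarrow> f (emode a \<alpha> (-2) b) = 0)"

text \<open>
  The residue of the derivative of \<open>x\<^bsup>\<alpha>+1\<^esup> z\<^bsup>-p\<^esup> Y(a,z)b\<close> is zero. It trades a pole of order \<open>p + 1\<close>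
  at \<open>z = 0\<close> for poles of order \<open>p\<close>, so that all higher poles reduce to Zhu's relations.
\<close>
lemma zhu_step:
  assumes f: "functional f"
  shows "of_int p * f (emode a \<alpha> (- p - 1) b) =
    f (emode (T a) (\<alpha> + 1) (- p) b) + of_int (\<alpha> + 1 - p) * f (emode a \<alpha> (- p) b)"
proof -
  have "emode a (\<alpha> + 1) (- p - 1) b = emode a \<alpha> (- p - 1) b + emode a \<alpha> (- p) b"
    using pascalD[OF pascal_emode[of a b], of \<alpha> "- p - 1"] by simp
  moreover have "emode (T a) (\<alpha> + 1) (- p) b =
      of_int p *s emode a (\<alpha> + 1) (- p - 1) b - of_int (\<alpha> + 1) *s emode a \<alpha> (- p) b"
    using emode_T[of a "\<alpha> + 1" "- p" b] by simp
  ultimately show ?thesis by (simp add: functional_simps[OF f] distrib_left left_diff_distrib)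
qed

lemma zhu_pole:
  assumes f: "functional f" "zhu_below N f" and b: "b \<in> W \<beta>"
  shows "a \<in> W \<alpha> \<Longrightarrow> \<alpha> + \<beta> + int p + 1 < N \<Longrightarrow> f (emode a \<alpha> (- int p - 2) b) = 0"
proof (induction p arbitrary: a \<alpha>)
  case 0
  then show ?case using f(2) b by (auto simp: zhu_below_def)
next
  case (Suc p)
  have "f (emode (T a) (\<alpha> + 1) (- int p - 2) b) = 0"
    using Suc.prems by (intro Suc.IH T_weight[of a \<alpha>]) auto
  moreover have "f (emode a \<alpha> (- int p - 2) b) = 0"
    using Suc.prems by (intro Suc.IH) auto
  ultimately have "of_int (int p + 2) * f (emode a \<alpha> (- int (Suc p) - 2) b) = 0"
    using zhu_step[OF f(1), of "int p + 2" a \<alpha> b] by (simp add: algebra_simps)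
  then show ?case by (simp only: mult_eq_0_iff of_int_eq_0_iff) auto
qed

lemma zhu_pole_shift:
  assumes f: "functional f" "zhu_below N f" and a: "a \<in> W \<alpha>" and b: "b \<in> W \<beta>"
  shows "m \<le> p \<Longrightarrow> \<alpha> + \<beta> + int p + 1 < N \<Longrightarrow> f (emode a (\<alpha> + int m) (- int p - 2) b) = 0"
proof (induction m arbitrary: p)
  case 0
  then show ?case using zhu_pole[OF f b a] by simp
next
  case (Suc m)
  then obtain q where q: "p = Suc q" by (cases p) auto
  have "f (emode a (\<alpha> + int m) (- int p - 2) b) = 0" "f (emode a (\<alpha> + int m) (- int q - 2) b) = 0"
    using Suc.prems q by (intro Suc.IH; simp)+
  then show ?case
    using pascalD[OF pascal_emode[of a b], of "\<alpha> + int m" "- int p - 2"]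
    by (simp add: functional_simps[OF f(1)] q algebra_simps)
qed

text \<open>
  Raising the power of \<open>x\<close> only adds terms of lower weight, and these are already killed.
\<close>
lemma zhu_pole_shift_top:
  assumes f: "functional f" "zhu_below N f" and a: "a \<in> W \<alpha>" and b: "b \<in> W \<beta>"
  shows "m \<le> p \<Longrightarrow> \<alpha> + \<beta> + int p + 1 \<le> N \<Longrightarrow>
     f (emode a (\<alpha> + int m) (- int p - 2) b) = f (emode a \<alpha> (- int p - 2) b)"
proof (induction m)
  case (Suc m)
  then obtain q where q: "p = Suc q" by (cases p) auto
  have "f (emode a (\<alpha> + int m) (- int q - 2) b) = 0"
    using Suc.prems q by (intro zhu_pole_shift[OF f a b]) auto
  then show ?case
    using pascalD[OF pascal_emode[of a b], of "\<alpha> + int m" "- int p - 2"] Suc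
    by (simp add: functional_simps[OF f(1)] q algebra_simps)
qed simp

text \<open>
  In the top weight the Li degree has to be watched: passing from \<open>a\<close> to \<open>T a\<close> raises it by one and
  thereby makes up for the lower pole order.
\<close>
lemma zhu_pole_top:
  assumes f: "functional f" "zhu_below N f" "zhu_at N s f" and b: "b \<in> W \<beta>" "b \<in> F j"
  shows "a \<in> W \<alpha> \<Longrightarrow> a \<in> F i \<Longrightarrow> \<alpha> + \<beta> + int p + 1 = N \<Longrightarrow> i + j + p \<ge> s \<Longrightarrow>
     f (emode a \<alpha> (- int p - 2) b) = 0"
proof (induction p arbitrary: a \<alpha> i)
  case 0
  then show ?case using f(3) b by (auto simp: zhu_at_def)
next
  case (Suc p)
  have "f (emode (T a) (\<alpha> + 1) (- int p - 2) b) = 0"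
    using Suc.prems by (intro Suc.IH[of _ _ "Suc i"] T_weight[of a \<alpha>] F_T) auto
  moreover have "f (emode a \<alpha> (- int p - 2) b) = 0"
    using Suc.prems by (intro zhu_pole[OF f(1,2) b(1)]) auto
  ultimately have "of_int (int p + 2) * f (emode a \<alpha> (- int (Suc p) - 2) b) = 0"
    using zhu_step[OF f(1), of "int p + 2" a \<alpha> b] by (simp add: algebra_simps)
  then show ?case by (simp only: mult_eq_0_iff of_int_eq_0_iff) auto
qed

text \<open>
  The Borcherds identity with \<open>n = -1\<close> and the test function
  \<open>x\<^sub>1\<^sup>\<alpha> z\<^sub>1\<^bsup>-1\<^esup> x\<^sub>2\<^sup>\<beta> z\<^sub>2\<^bsup>-1\<^esup>\<close>. Its leading terms are the three terms of the Leibniz rule; all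
  others have higher poles and Li degree at least \<open>s\<close>, or lower weight, and are killed by
  \<open>f\<close>. The hypothesis allows the Li degree \<open>s - 1\<close>, one below what \<open>f\<close> is known to kill.
\<close>
lemma zhu_leibniz:
  assumes f: "functional f" "zhu_below N f" "zhu_at N s f"
    and a: "a \<in> W \<alpha>" "a \<in> F i" and b: "b \<in> W \<beta>" "b \<in> F j" and c: "c \<in> W \<gamma>" "c \<in> F l"
    and N: "\<alpha> + \<beta> + \<gamma> + 1 = N" and s: "i + j + l + 1 \<ge> s"
  shows "f (emode (Y a (-1) b) (\<alpha> + \<beta>) (-2) c) =
    f (emode a \<alpha> (-2) (Y b (-1) c)) + f (emode b \<beta> (-2) (Y a (-1) c))"
proof -
  obtain J where J: "\<And>n. n \<ge> J \<Longrightarrow> Y a (-1 + int n) b = 0"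
    using Y_vanishes[of a "-1" b] by (auto simp: eventually_sequentially)
  define G where "G j = emode a \<alpha> (-1 + -1 - int j) (emode b \<beta> (-1 + int j) c)
     - (-1) powi -1 *s emode b \<beta> (-1 + -1 - int j) (emode a \<alpha> (-1 + int j) c)" for j
  have B: "altsum (-1) G = (\<Sum>n<Suc J. taylor n (\<lambda>k p. emode (Y a (-1 + int n) b) (k + \<beta>) (p + -1) c) \<alpha> (-1))"
    unfolding G_def using J by (intro emode_borcherds) simp
  \<comment> \<open>replacing the inner residue by its leading mode changes the weight only downwards\<close>
  have inner: "f (emode u \<mu> (- int n - 2) (emode v \<nu> (-1 + int n) c)) = f (emode u \<mu> (- int n - 2) (Y v (-1 + int n) c))"
    if "u \<in> W \<mu>" "v \<in> W \<nu>" "\<mu> + \<nu> + \<gamma> + 1 = N" for u v \<mu> \<nu> n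
  proof (rule functional_emode_head[OF functional_emode[OF f(1)]])
    fix u'
    have "Y v (-1 + int n + 1 + int u') c \<in> W (\<nu> + \<gamma> - (-1 + int n + 1 + int u') - 1)"
      using that c(1) by (intro Y_weight[of v \<nu> c \<gamma>]) auto
    then show "f (emode u \<mu> (- int n - 2) (Y v (-1 + int n + 1 + int u') c)) = 0"
      using that by (intro zhu_pole[OF f(1,2)]) auto
  qed
  \<comment> \<open>the terms after the first in the expansion of \<open>(z\<^sub>1 - z\<^sub>2)\<^bsup>-1\<^esup>\<close> have Li degree at least \<open>s\<close>\<close>
  have tail: "f (emode u \<mu> (- int (Suc n) - 2) (emode v \<nu> (-1 + int (Suc n)) c)) = 0"
    if u: "u \<in> W \<mu>" "u \<in> F i'" "v \<in> W \<nu>" "v \<in> F j'" and N': "\<mu> + \<nu> + \<gamma> + 1 = N" "i' + j' + l + 1 \<ge> s" for u v \<mu> \<nu> i' j' n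
  proof -
    have "Y v (-1 + int (Suc n)) c \<in> F (j' + l - n)"
      by (rule F_mode[OF u(4) c(2)]) auto
    moreover have "Y v (-1 + int (Suc n)) c \<in> W (\<nu> + \<gamma> - int n - 1)"
      using u c(1) by (intro Y_weight[of v \<nu> c \<gamma>]) auto
    ultimately show ?thesis
      unfolding inner[OF u(1,3) N'(1)] using u N'
      by (intro zhu_pole_top[OF f, of _ _ _ _ _ i']) auto
  qed
  have G_vanishes: "vanishes G"
    using eventually_conj[OF emode_vanishes[of b \<beta> "-1" c] emode_vanishes[of a \<alpha> "-1" c]]
    unfolding G_def by (rule eventually_mono) simp
  have "f (altsum (-1) G) = f (G 0)"
  proof (rule functional_altsum_head[OF f(1) G_vanishes])
    fix n
    show "f (G (Suc n)) = 0"
      using tail[OF a b N s, of n] tail[OF b a, of n] N s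
      by (simp add: G_def functional_simps[OF f(1)] algebra_simps)
  qed
  also have "f (G 0) = f (emode a \<alpha> (-2) (Y b (-1) c)) + f (emode b \<beta> (-2) (Y a (-1) c))"
    using inner[OF a(1) b(1) N, of 0] inner[OF b(1) a(1), of 0] N
    by (simp add: G_def functional_simps[OF f(1)])
  finally have lhs: "f (altsum (-1) G) = \<dots>" .
  \<comment> \<open>derivatives of \<open>x\<^sub>1\<^sup>\<alpha>\<close> lower the weight; derivatives of \<open>z\<^sub>1\<^bsup>-1\<^esup>\<close> alone keep it and raise the pole order\<close>
  have terms: "f (emode (Y a (-1 + int n) b) (\<alpha> - int i' + \<beta>) (-1 - int (n - i') + -1) c) = 0"
    if "i' \<le> n" "n \<noteq> 0" for n i'
  proof -
    let ?d = "Y a (-1 + int n) b"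
    have d: "?d \<in> W (\<alpha> + \<beta> - int n)" using a(1) b(1) by (intro Y_weight[of a \<alpha> b \<beta>]) auto
    have *: "\<alpha> - int i' + \<beta> = (\<alpha> + \<beta> - int n) + int (n - i')" "-1 - int (n - i') + -1 = - int (n - i') - 2"
      using that by auto
    show ?thesis
    proof (cases "i' = 0")
      case True
      have "?d \<in> F (i + j - (n - 1))" using that by (intro F_mode[OF a(2) b(2)]) auto
      then have "f (emode ?d (\<alpha> + \<beta> - int n) (- int n - 2) c) = 0"
        using d N s that by (intro zhu_pole_top[OF f c]) auto
      then show ?thesis
        unfolding * using zhu_pole_shift_top[OF f(1,2) d c(1), of n n] True N by simp
    next
      case False
      then show ?thesis
        unfolding * using that N by (intro zhu_pole_shift[OF f(1,2) d c(1)]) auto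
    qed
  qed
  have "f (altsum (-1) G) = (\<Sum>n<Suc J. f (taylor n (\<lambda>k p. emode (Y a (-1 + int n) b) (k + \<beta>) (p + -1) c) \<alpha> (-1)))"
    unfolding B by (simp only: functional_simps[OF f(1)])
  also have "\<dots> = f (taylor 0 (\<lambda>k p. emode (Y a (-1 + int 0) b) (k + \<beta>) (p + -1) c) \<alpha> (-1))
     + (\<Sum>n<J. f (taylor (Suc n) (\<lambda>k p. emode (Y a (-1 + int (Suc n)) b) (k + \<beta>) (p + -1) c) \<alpha> (-1)))"
    by (rule sum.lessThan_Suc_shift)
  also have "(\<Sum>n<J. f (taylor (Suc n) (\<lambda>k p. emode (Y a (-1 + int (Suc n)) b) (k + \<beta>) (p + -1) c) \<alpha> (-1))) = 0"
  proof (intro sum.neutral ballI)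
    fix n
    show "f (taylor (Suc n) (\<lambda>k p. emode (Y a (-1 + int (Suc n)) b) (k + \<beta>) (p + -1) c) \<alpha> (-1)) = 0"
      unfolding taylor_def functional_simps[OF f(1)]
      by (intro sum.neutral ballI) (simp only: terms atMost_iff mult_zero_right Suc_not_Zero nat.distinct HOL.simp_thms)
  qed
  also have "f (taylor 0 (\<lambda>k p. emode (Y a (-1 + int 0) b) (k + \<beta>) (p + -1) c) \<alpha> (-1)) =
      f (emode (Y a (-1) b) (\<alpha> + \<beta>) (-2) c)"
    by (simp add: taylor_def)
  finally show ?thesis using lhs by simp
qed

text \<open>
  The commutator of the operations \<open>a \<circ> -\<close> and \<open>b \<circ> -\<close>. It is a sum of residues of
  \<open>Y(a\<^bsub>(n)\<^esub>b, z)c\<close> with poles of order at least four, and is killed by \<open>f\<close>.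
\<close>
lemma zhu_contraction:
  assumes f: "functional f" "zhu_below N f" "zhu_at N s f"
    and a: "a \<in> W \<alpha>" "a \<in> F i" and b: "b \<in> W \<beta>" "b \<in> F j" and c: "c \<in> W \<gamma>" "c \<in> F l"
    and N: "\<alpha> + \<beta> + \<gamma> + 2 = N" and s: "i + j + l + 2 \<ge> s"
  shows "f (emode a \<alpha> (-2) (Y b (-2) c)) = f (emode b \<beta> (-2) (Y a (-2) c))"
proof -
  obtain J where J: "\<And>n. n \<ge> J \<Longrightarrow> Y a (0 + int n) b = 0"
    using Y_vanishes[of a 0 b] by (auto simp: eventually_sequentially)
  have inner: "f (emode u \<mu> (-2) (emode v \<nu> (-2) c)) = f (emode u \<mu> (-2) (Y v (-2) c))"
    if "u \<in> W \<mu>" "v \<in> W \<nu>" "\<mu> + \<nu> + \<gamma> + 2 = N" for u v \<mu> \<nu>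
  proof (rule functional_emode_head[OF functional_emode[OF f(1)]])
    fix u'
    have "Y v (-2 + 1 + int u') c \<in> W (\<nu> + \<gamma> - (-2 + 1 + int u') - 1)"
      using that c(1) by (intro Y_weight[of v \<nu> c \<gamma>]) auto
    then show "f (emode u \<mu> (-2) (Y v (-2 + 1 + int u') c)) = 0"
      using that zhu_pole[OF f(1,2), of _ _ u \<mu> 0] by auto
  qed
  have terms: "f (emode (Y a (0 + int n) b) (\<alpha> - int i' + \<beta>) (-2 - int (n - i') + -2) c) = 0"
    if "i' \<le> n" for n i'
  proof -
    let ?d = "Y a (0 + int n) b"
    have d: "?d \<in> W (\<alpha> + \<beta> - int n - 1)" using a(1) b(1) by (intro Y_weight[of a \<alpha> b \<beta>]) auto
    have *: "\<alpha> - int i' + \<beta> = (\<alpha> + \<beta> - int n - 1) + int (n + 1 - i')"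
      "-2 - int (n - i') + -2 = - int (n + 2 - i') - 2"
      using that by auto
    show ?thesis
    proof (cases "i' = 0")
      case True
      have "?d \<in> F (i + j - n)" by (intro F_mode[OF a(2) b(2)]) auto
      then have "f (emode ?d (\<alpha> + \<beta> - int n - 1) (- int (n + 2) - 2) c) = 0"
        using d N s that by (intro zhu_pole_top[OF f c]) auto
      then show ?thesis
        unfolding * using zhu_pole_shift_top[OF f(1,2) d c(1), of "n + 1" "n + 2"] True N by simp
    next
      case False
      then show ?thesis
        unfolding * using that N by (intro zhu_pole_shift[OF f(1,2) d c(1)]) auto
    qed
  qed
  have "emode a \<alpha> (-2) (emode b \<beta> (-2) c) - emode b \<beta> (-2) (emode a \<alpha> (-2) c) =
     (\<Sum>n<J. taylor n (\<lambda>k p. emode (Y a (0 + int n) b) (k + \<beta>) (p + -2) c) \<alpha> (-2))"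
    using emode_borcherds[of J a 0 b \<alpha> "-2" \<beta> "-2" c, OF J] by simp
  then have "f (emode a \<alpha> (-2) (emode b \<beta> (-2) c)) - f (emode b \<beta> (-2) (emode a \<alpha> (-2) c)) =
     (\<Sum>n<J. f (taylor n (\<lambda>k p. emode (Y a (0 + int n) b) (k + \<beta>) (p + -2) c) \<alpha> (-2)))"
    by (simp only: functional_simps[OF f(1), symmetric])
  also have "\<dots> = 0"
  proof (intro sum.neutral ballI)
    fix n
    show "f (taylor n (\<lambda>k p. emode (Y a (0 + int n) b) (k + \<beta>) (p + -2) c) \<alpha> (-2)) = 0"
      unfolding taylor_def functional_simps[OF f(1)]
      by (intro sum.neutral ballI) (simp only: terms atMost_iff mult_zero_right)
  qed
  finally show ?thesis
    using inner[OF a(1) b(1) N] inner[OF b(1) a(1)] N by simp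
qed

text \<open>
  The bilinear form \<open>(a, b) \<mapsto> f(a \<circ> b)\<close>, restricted to the pairs of top weight \<open>N\<close>. It is the
  prescription \<open>\<phi>\<close> for the value at \<open>\<partial>a \<cdot> b\<close>.
\<close>
definition pairing :: "int \<Rightarrow> ('v \<Rightarrow> complex) \<Rightarrow> 'v \<Rightarrow> 'v \<Rightarrow> complex" where
  "pairing N f a b = (\<Sum>\<alpha>\<in>{0..<N}. f (emode (wcomp \<alpha> a) \<alpha> (-2) (wcomp (N - 1 - \<alpha>) b)))"

lemma pairing_linear:
  assumes "functional f"
  shows "pairing N f (a + a') b = pairing N f a b + pairing N f a' b"
    "pairing N f (c *s a) b = c * pairing N f a b"
    "pairing N f a (b + b') = pairing N f a b + pairing N f a b'"
    "pairing N f a (c *s b) = c * pairing N f a b"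
    "pairing N f 0 b = 0" "pairing N f a 0 = 0"
  by (simp_all add: pairing_def functional_simps[OF assms] sum.distrib sum_distrib_left)

lemma pairing_homogeneous:
  assumes f: "functional f" and a: "a \<in> W \<alpha>" and b: "b \<in> W \<beta>"
  shows "pairing N f a b = (if \<alpha> + \<beta> + 1 = N then f (emode a \<alpha> (-2) b) else 0)"
proof (cases "\<alpha> \<in> {0..<N}")
  case True
  have "pairing N f a b = (\<Sum>\<mu>\<in>{0..<N}. if \<mu> = \<alpha> then (if \<alpha> + \<beta> + 1 = N then f (emode a \<alpha> (-2) b) else 0) else 0)"
    unfolding pairing_def
    by (rule sum.cong[OF HOL.refl]) (auto simp: wcomp_of_mem[OF a] wcomp_of_mem[OF b] functional_simps[OF f])
  with True show ?thesis by simp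
next
  case False
  then have "a = 0 \<or> \<alpha> \<ge> N" using W_negative[OF a] by auto
  moreover have "pairing N f a b = 0"
    unfolding pairing_def
    by (intro sum.neutral ballI) (use False in \<open>auto simp: wcomp_of_mem[OF a] functional_simps[OF f]\<close>)
  moreover have "\<alpha> + \<beta> + 1 = N \<Longrightarrow> \<alpha> \<ge> N \<Longrightarrow> b = 0" using W_negative[OF b] by auto
  ultimately show ?thesis by (auto simp: functional_simps[OF f])
qed

lemma pairing_zero:
  assumes "functional f" "zhu_at N s f" "a \<in> F i" "b \<in> F j" "i + j \<ge> s"
  shows "pairing N f a b = 0"
  unfolding pairing_def
proof (intro sum.neutral ballI)
  fix \<alpha>
  show "f (emode (wcomp \<alpha> a) \<alpha> (-2) (wcomp (N - 1 - \<alpha>) b)) = 0"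
    using assms F_wcomp[OF assms(3)] F_wcomp[OF assms(4)] unfolding zhu_at_def
    by (elim allE[of _ \<alpha>] allE[of _ "N - 1 - \<alpha>"] allE[of _ i] allE[of _ j] allE[of _ "wcomp \<alpha> a"]
        allE[of _ "wcomp (N - 1 - \<alpha>) b"]) auto
qed

lemma trilinear_homogeneous:
  fixes D :: "'v \<Rightarrow> 'v \<Rightarrow> 'v \<Rightarrow> complex"
  assumes "\<And>a a' b c. D (a + a') b c = D a b c + D a' b c" "\<And>a b b' c. D a (b + b') c = D a b c + D a b' c"
    "\<And>a b c c'. D a b (c + c') = D a b c + D a b c'"
    and hom: "\<And>\<alpha> \<beta> \<gamma> a b c. a \<in> W \<alpha> \<Longrightarrow> a \<in> F i \<Longrightarrow> b \<in> W \<beta> \<Longrightarrow> b \<in> F j \<Longrightarrow> c \<in> W \<gamma> \<Longrightarrow> c \<in> F l \<Longrightarrow> D a b c = 0"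
    and a: "a \<in> F i" and b: "b \<in> F j" and c: "c \<in> F l"
  shows "D a b c = 0"
proof -
  have 1: "D a b c = 0" if "a \<in> W \<alpha>" "a \<in> F i" "b \<in> W \<beta>" "b \<in> F j" for a b \<alpha> \<beta>
    using c by (induction rule: F_homogeneous_induct) (auto simp: assms(3) intro: hom[OF that])
  have 2: "D a b c = 0" if "a \<in> W \<alpha>" "a \<in> F i" for a \<alpha>
    using b by (induction rule: F_homogeneous_induct) (auto simp: assms(2) intro: 1[OF that])
  show ?thesis
    using a by (induction rule: F_homogeneous_induct) (auto simp: assms(1) intro: 2)
qed

lemma pairing_leibniz:
  assumes f: "functional f" "zhu_below N f" "zhu_at N s f"
    and "a \<in> F i" "b \<in> F j" "c \<in> F l" and s: "i + j + l + 1 \<ge> s"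
  shows "pairing N f (Y a (-1) b) c = pairing N f a (Y b (-1) c) + pairing N f b (Y a (-1) c)"
proof -
  have "pairing N f (Y a (-1) b) c - pairing N f a (Y b (-1) c) - pairing N f b (Y a (-1) c) = 0"
  proof (rule trilinear_homogeneous[where D = "\<lambda>a b c. pairing N f (Y a (-1) b) c - pairing N f a (Y b (-1) c)
       - pairing N f b (Y a (-1) c)", OF _ _ _ _ assms(4,5,6)])
    fix \<alpha> \<beta> \<gamma> a b c
    assume a: "a \<in> W \<alpha>" "a \<in> F i" and b: "b \<in> W \<beta>" "b \<in> F j" and c: "c \<in> W \<gamma>" "c \<in> F l"
    have "Y a (-1) b \<in> W (\<alpha> + \<beta>)" "Y b (-1) c \<in> W (\<beta> + \<gamma>)" "Y a (-1) c \<in> W (\<alpha> + \<gamma>)"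
      using a b c by (auto intro!: Y_weight)
    then show "pairing N f (Y a (-1) b) c - pairing N f a (Y b (-1) c) - pairing N f b (Y a (-1) c) = 0"
      using zhu_leibniz[OF f a b c _ s]
      by (simp add: pairing_homogeneous[OF f(1) _ c(1)] pairing_homogeneous[OF f(1) a(1)]
          pairing_homogeneous[OF f(1) b(1)] algebra_simps)
  qed (simp_all add: pairing_linear[OF f(1)])
  then show ?thesis by (simp add: algebra_simps)
qed

lemma pairing_contraction:
  assumes f: "functional f" "zhu_below N f" "zhu_at N s f"
    and "a \<in> F i" "b \<in> F j" "c \<in> F l" and s: "i + j + l + 2 \<ge> s"
  shows "pairing N f a (Y b (-2) c) = pairing N f b (Y a (-2) c)"
proof -
  have "pairing N f a (Y b (-2) c) - pairing N f b (Y a (-2) c) = 0"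
  proof (rule trilinear_homogeneous[where D = "\<lambda>a b c. pairing N f a (Y b (-2) c) - pairing N f b (Y a (-2) c)",
        OF _ _ _ _ assms(4,5,6)])
    fix \<alpha> \<beta> \<gamma> a b c
    assume a: "a \<in> W \<alpha>" "a \<in> F i" and b: "b \<in> W \<beta>" "b \<in> F j" and c: "c \<in> W \<gamma>" "c \<in> F l"
    have "Y b (-2) c \<in> W (\<beta> + \<gamma> + 1)" "Y a (-2) c \<in> W (\<alpha> + \<gamma> + 1)"
      using a b c by (auto intro!: Y_weight)
    then show "pairing N f a (Y b (-2) c) - pairing N f b (Y a (-2) c) = 0"
      using zhu_contraction[OF f a b c _ s]
      by (auto simp: pairing_homogeneous[OF f(1) a(1)] pairing_homogeneous[OF f(1) b(1)] algebra_simps)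
  qed (simp_all add: pairing_linear[OF f(1)])
  then show ?thesis by simp
qed

end

section \<open>Functionals on the associated graded algebra of a classically free vertex algebra\<close>

definition triples :: "nat \<Rightarrow> (nat \<times> nat \<times> nat) set" where
  "triples p = {(i, j, l). i + j + l = p}"

lemma sum_triples_left:
  "(\<Sum>n\<le>p. \<Sum>i\<le>n. g i (n - i) (p - n)) = (\<Sum>(i, j, l)\<in>triples p. g i j l :: 'a::comm_monoid_add)"
proof -
  have "(\<Sum>n\<le>p. \<Sum>i\<le>n. g i (n - i) (p - n)) = (\<Sum>(n, i)\<in>Sigma {..p} (\<lambda>n. {..n}). g i (n - i) (p - n))"
    by (rule sum.Sigma) simp_all
  also have "\<dots> = (\<Sum>(i, j, l)\<in>triples p. g i j l)"
    by (rule sum.reindex_bij_witness[of _ "\<lambda>(i, j, l). (i + j, i)" "\<lambda>(n, i). (i, n - i, p - n)"])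
       (auto simp: triples_def)
  finally show ?thesis .
qed

lemma sum_triples_right:
  "(\<Sum>i\<le>p. \<Sum>j\<le>p - i. g i j (p - i - j)) = (\<Sum>(i, j, l)\<in>triples p. g i j l :: 'a::comm_monoid_add)"
proof -
  have "(\<Sum>i\<le>p. \<Sum>j\<le>p - i. g i j (p - i - j)) = (\<Sum>(i, j)\<in>Sigma {..p} (\<lambda>i. {..p - i}). g i j (p - i - j))"
    by (rule sum.Sigma) simp_all
  also have "\<dots> = (\<Sum>(i, j, l)\<in>triples p. g i j l)"
    by (rule sum.reindex_bij_witness[of _ "\<lambda>(i, j, l). (i, j)" "\<lambda>(i, j). (i, j, p - i - j)"])
       (auto simp: triples_def)
  finally show ?thesis .
qed

lemma sum_triples_swap:
  "(\<Sum>(i, j, l)\<in>triples p. g j i l) = (\<Sum>(i, j, l)\<in>triples p. g i j l :: 'a::comm_monoid_add)"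
  by (rule sum.reindex_bij_witness[of _ "\<lambda>(i, j, l). (j, i, l)" "\<lambda>(i, j, l). (j, i, l)"])
     (auto simp: triples_def)

context vertex_algebra begin

lemma functional_extension:
  assumes S: "subspace S"
    and add: "\<And>a b. a \<in> S \<Longrightarrow> b \<in> S \<Longrightarrow> g (a + b) = g a + g b"
    and scale: "\<And>c a. a \<in> S \<Longrightarrow> g (c *s a) = c * g a"
  shows "\<exists>f. functional f \<and> (\<forall>a\<in>S. f a = g a)"
proof -
  have pair: "vector_space_pair scale ((*) :: complex \<Rightarrow> complex \<Rightarrow> complex)"
    by (rule vector_space_pair.intro) (rule vector_space_axioms cmul.vector_space_axioms)+
  obtain B where B: "B \<subseteq> S" "independent B" "S \<subseteq> span B" "card B = dim S"
    by (rule basis_exists[of S])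
  from vector_space_pair.linear_independent_extend[OF pair B(2), of g]
  obtain f where f: "Vector_Spaces.linear scale (*) f" "\<forall>x\<in>B. f x = g x" by (elim exE conjE)
  interpret f: Vector_Spaces.linear scale "(*)" f by (rule f(1))
  have linf: "functional f" by (simp add: functional_def f.add f.scale)
  have g0: "g 0 = 0" using scale[of 0 0] subspace_0[OF S] by simp
  have "subspace {a \<in> S. f a = g a}"
    unfolding subspace_def
    using S by (auto simp: subspace_0 subspace_add subspace_scale f.add f.scale f.zero add scale g0)
  moreover have "B \<subseteq> {a \<in> S. f a = g a}" using B(1) f(2) by auto
  ultimately have "span B \<subseteq> {a \<in> S. f a = g a}" by (rule span_minimal[rotated])
  with B(3) have "S \<subseteq> {a \<in> S. f a = g a}" by (rule subset_trans)
  then have "\<forall>a\<in>S. f a = g a" by auto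
  with linf show ?thesis by (intro exI conjI)
qed

lemma gr_component:
  assumes "f \<in> carrier gr" "x \<in> f p"
  shows "x \<in> F p" "f p = li_symbol p x"
proof -
  obtain a where a: "a \<in> F p" "f p = li_symbol p a" using assms(1) by (auto simp: gr_def)
  with assms(2) have x: "x - a \<in> F (Suc p)" by (simp add: mem_li_symbol)
  then have "x - a \<in> F p" by (rule F_monoD) simp
  from F_closed(2)[OF this a(1)] show "x \<in> F p" by simp
  from x show "f p = li_symbol p x" using a(2) li_symbol_eq_iff by metis
qed

definition gr_rep :: "(nat \<Rightarrow> 'v set) \<Rightarrow> nat \<Rightarrow> 'v" where
  "gr_rep f p = (SOME x. x \<in> f p)"

lemma gr_rep: "f \<in> carrier gr \<Longrightarrow> gr_rep f p \<in> f p"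
proof -
  assume "f \<in> carrier gr"
  then obtain a where "f p = li_symbol p a" by (auto simp: gr_def)
  then have "a \<in> f p" by simp
  then show ?thesis unfolding gr_rep_def by (rule someI)
qed

lemma gr_eqI:
  assumes "f \<in> carrier gr" "g \<in> carrier gr" "\<And>p. \<exists>x. x \<in> f p \<and> x \<in> g p"
  shows "f = g"
  using assms gr_component(2) by (metis ext)

lemma gr_add_mem: "x \<in> f p \<Longrightarrow> y \<in> g p \<Longrightarrow> x + y \<in> (f \<oplus>\<^bsub>gr\<^esub> g) p"
  unfolding gr_def ring.simps using li_symbol_self by blast

lemma gr_smult_mem: "x \<in> f p \<Longrightarrow> c *s x \<in> (c \<odot>\<^bsub>gr\<^esub> f) p"
  unfolding gr_def module.simps using li_symbol_self by blast

lemma gr_mult_mem: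
  assumes "\<And>p. a p \<in> f p" "\<And>p. b p \<in> g p"
  shows "(\<Sum>p\<le>n. Y (a p) (-1) (b (n - p))) \<in> (f \<otimes>\<^bsub>gr\<^esub> g) n"
proof -
  have "li_symbol n (\<Sum>p\<le>n. Y (a p) (-1) (b (n - p))) \<in>
      {li_symbol n (\<Sum>p\<le>n. Y (a p) (-1) (b (n - p))) | a b. \<forall>p\<le>n. a p \<in> f p \<and> b p \<in> g p}"
    using assms by blast
  then show ?thesis
    unfolding gr_def monoid.simps by (rule UnionI) simp
qed

lemma gr_deriv_mem:
  "0 \<in> deriv gr f 0" "x \<in> f q \<Longrightarrow> T x \<in> deriv gr f (Suc q)"
  unfolding gr_def diff_algebra.simps nat.case using li_symbol_self by blast+

definition gr_homogeneous :: "nat \<Rightarrow> 'v \<Rightarrow> nat \<Rightarrow> 'v set" where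
  "gr_homogeneous p v n = li_symbol n (if n = p then v else 0)"

lemma gr_homogeneous_mem: "(if n = p then v else 0) \<in> gr_homogeneous p v n"
  by (simp only: gr_homogeneous_def li_symbol_self)

lemma gr_homogeneous_carrier: "v \<in> F p \<Longrightarrow> gr_homogeneous p v \<in> carrier gr"
proof -
  assume v: "v \<in> F p"
  have "{n. gr_homogeneous p v n \<noteq> li_symbol n 0} \<subseteq> {p}" by (auto simp: gr_homogeneous_def)
  then have "finite {n. gr_homogeneous p v n \<noteq> li_symbol n 0}" by (rule finite_subset) simp
  with v show ?thesis by (auto simp: gr_def gr_homogeneous_def)
qed

text \<open>
  The degree \<open>p\<close> part of a bilinear form on \<open>V\<close>, carried over to \<open>gr V\<close> through arbitrary
  representatives of the symbols. It is well defined as soon as the form vanishes in Li degree \<open>p + 1\<close>.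
\<close>
definition gr_pairing :: "nat \<Rightarrow> ('v \<Rightarrow> 'v \<Rightarrow> complex) \<Rightarrow> (nat \<Rightarrow> 'v set) \<Rightarrow> (nat \<Rightarrow> 'v set) \<Rightarrow> complex" where
  "gr_pairing p P f g = (\<Sum>i\<le>p. P (gr_rep f i) (gr_rep g (p - i)))"

text \<open>
  If \<open>V\<close> is classically free, the Leibniz rule and the contraction symmetry are the only
  obstructions to finding a functional with prescribed values at the leading terms \<open>a\<^bsub>(-2)\<^esub>b\<close> in
  Li degree \<open>p + 1\<close>. The form is transported along the isomorphism of the jet algebra with
  \<open>gr V\<close>, and the functional given by exactness of the Koszul complex is transported back.
\<close>
proposition classically_free_pairing:
  assumes free: classically_free
    and P_add: "\<And>a a' b. P (a + a') b = P a b + P a' b" "\<And>a b b'. P a (b + b') = P a b + P a b'"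
    and P_scale: "\<And>c a b. P (c *s a) b = c * P a b" "\<And>c a b. P a (c *s b) = c * P a b"
    and P_zero: "\<And>i j a b. a \<in> F i \<Longrightarrow> b \<in> F j \<Longrightarrow> i + j \<ge> Suc p \<Longrightarrow> P a b = 0"
    and P_leibniz: "\<And>i j l a b c. a \<in> F i \<Longrightarrow> b \<in> F j \<Longrightarrow> c \<in> F l \<Longrightarrow> i + j + l = p \<Longrightarrow>
         P (Y a (-1) b) c = P a (Y b (-1) c) + P b (Y a (-1) c)"
    and P_contraction: "\<And>i j l a b c. a \<in> F i \<Longrightarrow> b \<in> F j \<Longrightarrow> c \<in> F l \<Longrightarrow> i + j + l + 1 = p \<Longrightarrow>
         P a (Y b (-2) c) = P b (Y a (-2) c)"
  obtains f where "functional f" "\<And>v. v \<in> F (Suc (Suc p)) \<Longrightarrow> f v = 0"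
    "\<And>i j a b. a \<in> F i \<Longrightarrow> b \<in> F j \<Longrightarrow> i + j = p \<Longrightarrow> f (Y a (-2) b) = P a b"
proof -
  let ?J = "jet_algebra R_V"
  obtain h where h: "h \<in> diff_algebra_hom ?J gr" and bij: "bij_betw h (carrier ?J) (carrier gr)"
    using free unfolding classically_free_def by blast
  have h_carrier: "h x \<in> carrier gr" if "x \<in> carrier ?J" for x
    using h that by (auto simp: diff_algebra_hom_def algebra_hom_def ring_hom_def)
  have h_ops: "h (x \<oplus>\<^bsub>?J\<^esub> y) = h x \<oplus>\<^bsub>gr\<^esub> h y" "h (x \<otimes>\<^bsub>?J\<^esub> y) = h x \<otimes>\<^bsub>gr\<^esub> h y"
    "h (c \<odot>\<^bsub>?J\<^esub> x) = c \<odot>\<^bsub>gr\<^esub> h x" "h (deriv ?J x) = deriv gr (h x)"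
    if "x \<in> carrier ?J" "y \<in> carrier ?J" for x y c
    using h that by (auto simp: diff_algebra_hom_def algebra_hom_def ring_hom_def)
  interpret J: diff_algebra ?J by (rule jet_algebra_diff_algebra[OF R_V_algebra])
  have J_smult: "c \<odot>\<^bsub>?J\<^esub> x \<in> carrier ?J" if "x \<in> carrier ?J" for c x
    using that by (simp add: J.smult_closed scalar_carrier[OF R_V_algebra])
  note closed = J.add.m_closed J.m_closed J_smult J.deriv_closed
  have P0: "P 0 b = 0" "P a 0 = 0" for a b
    using P_scale(1)[of 0 0 b] P_scale(2)[of a 0 0] by simp_all
  have P_sum: "P (sum g S) b = (\<Sum>i\<in>S. P (g i) b)" "P a (sum g S) = (\<Sum>i\<in>S. P a (g i))" for g :: "nat \<Rightarrow> 'v" and S a b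
    by (induction S rule: infinite_finite_induct) (simp_all add: P0 P_add)
  \<comment> \<open>independence of the representatives of the symbols\<close>
  have P_well: "P a b = P a' b'"
    if "f \<in> carrier gr" "g \<in> carrier gr" "a \<in> f i" "a' \<in> f i" "b \<in> g j" "b' \<in> g j" "i + j = p" for f g a a' b b' i j
  proof -
    have "a - a' \<in> F (Suc i)" "b - b' \<in> F (Suc j)" "b \<in> F j" "a' \<in> F i"
      using that gr_component(1)[OF that(1)] gr_component(1)[OF that(2)]
        gr_component(2)[OF that(1,4)] gr_component(2)[OF that(2,6)] by (simp_all add: mem_li_symbol)
    then have "P (a - a') b = 0" "P a' (b - b') = 0"
      using P_zero[of "a - a'" "Suc i" b j] P_zero[of a' i "b - b'" "Suc j"] that by auto
    moreover have "P a b = P (a - a') b + P a' (b - b') + P a' b'"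
      using P_add(1)[of "a - a'" a' b] P_add(2)[of a' "b - b'" b'] by simp
    ultimately show ?thesis by simp
  qed
  have gr_pairing_eq: "gr_pairing p P f g = (\<Sum>i\<le>p. P (a i) (b (p - i)))"
    if "f \<in> carrier gr" "g \<in> carrier gr" "\<And>i. a i \<in> f i" "\<And>i. b i \<in> g i" for f g a b
    unfolding gr_pairing_def
  proof (rule sum.cong[OF HOL.refl])
    fix i assume "i \<in> {..p}"
    then show "P (gr_rep f i) (gr_rep g (p - i)) = P (a i) (b (p - i))"
      by (intro P_well[of f g _ i _ _ "p - i"] gr_rep that) simp
  qed
  \<comment> \<open>the form on the jet algebra to which exactness is applied\<close>
  define \<phi> where "\<phi> x y = gr_pairing p P (h x) (h y)" for x y
  define r where "r x = gr_rep (h x)" for x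
  have r: "r x i \<in> h x i" "r x i \<in> F i" if "x \<in> carrier ?J" for x i
    using gr_rep[OF h_carrier[OF that]] gr_component(1)[OF h_carrier[OF that]] by (simp_all add: r_def)
  have \<phi>_eq: "\<phi> x y = (\<Sum>i\<le>p. P (a i) (b (p - i)))"
    if "x \<in> carrier ?J" "y \<in> carrier ?J" "\<And>i. a i \<in> h x i" "\<And>i. b i \<in> h y i" for x y a b
    unfolding \<phi>_def by (intro gr_pairing_eq h_carrier that)
  have mult_rep: "(\<Sum>q\<le>n. Y (r x q) (-1) (r y (n - q))) \<in> h (x \<otimes>\<^bsub>?J\<^esub> y) n"
    if "x \<in> carrier ?J" "y \<in> carrier ?J" for x y n
    unfolding h_ops[OF that] by (rule gr_mult_mem) (rule r(1)[OF that(1)], rule r(1)[OF that(2)])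
  have deriv_mult_rep: "(case n of 0 \<Rightarrow> 0 | Suc m \<Rightarrow> \<Sum>q\<le>m. Y (r x q) (-2) (r y (m - q))) \<in> h (deriv ?J x \<otimes>\<^bsub>?J\<^esub> y) n"
    if "x \<in> carrier ?J" "y \<in> carrier ?J" for x y n
  proof -
    define d where "d q = (case q of 0 \<Rightarrow> 0 | Suc q' \<Rightarrow> T (r x q'))" for q
    have "d q \<in> deriv gr (h x) q" for q
      unfolding d_def using gr_deriv_mem(1)[of "h x"] gr_deriv_mem(2)[of _ "h x"] r(1)[OF that(1)] by (cases q) auto
    then have "(\<Sum>q\<le>n. Y (d q) (-1) (r y (n - q))) \<in> h (deriv ?J x \<otimes>\<^bsub>?J\<^esub> y) n"
      using that r(1)[OF that(2)] by (simp add: h_ops closed gr_mult_mem)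
    moreover have "(\<Sum>q\<le>n. Y (d q) (-1) (r y (n - q))) =
        (case n of 0 \<Rightarrow> 0 | Suc m \<Rightarrow> \<Sum>q\<le>m. Y (r x q) (-2) (r y (m - q)))"
      unfolding d_def by (cases n) (simp_all add: sum.atMost_Suc_shift Y_T del: sum.atMost_Suc)
    ultimately show ?thesis by simp
  qed
  interpret K: jet_koszul R_V \<phi>
  proof (rule jet_koszul.intro[OF R_V_algebra])
    fix x y z assume x: "x \<in> carrier ?J" and y: "y \<in> carrier ?J" and z: "z \<in> carrier ?J"
    show "\<phi> (x \<oplus>\<^bsub>?J\<^esub> y) z = \<phi> x z + \<phi> y z"
      using \<phi>_eq[of "x \<oplus>\<^bsub>?J\<^esub> y" z "\<lambda>i. r x i + r y i" "r z"] \<phi>_eq[of x z "r x" "r z"] \<phi>_eq[of y z "r y" "r z"]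
        x y z by (simp add: closed r h_ops gr_add_mem P_add sum.distrib)
    show "\<phi> x (y \<oplus>\<^bsub>?J\<^esub> z) = \<phi> x y + \<phi> x z"
      using \<phi>_eq[of x "y \<oplus>\<^bsub>?J\<^esub> z" "r x" "\<lambda>i. r y i + r z i"] \<phi>_eq[of x y "r x" "r y"] \<phi>_eq[of x z "r x" "r z"]
        x y z by (simp add: closed r h_ops gr_add_mem P_add sum.distrib)
    have "\<phi> (x \<otimes>\<^bsub>?J\<^esub> y) z = (\<Sum>n\<le>p. P (\<Sum>q\<le>n. Y (r x q) (-1) (r y (n - q))) (r z (p - n)))"
      using x y z by (intro \<phi>_eq closed mult_rep r)
    also have "\<dots> = (\<Sum>n\<le>p. \<Sum>i\<le>n. P (Y (r x i) (-1) (r y (n - i))) (r z (p - n)))"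
      by (simp only: P_sum)
    also have "\<dots> = (\<Sum>(i, j, l)\<in>triples p. P (Y (r x i) (-1) (r y j)) (r z l))"
      by (rule sum_triples_left)
    also have "\<dots> = (\<Sum>(i, j, l)\<in>triples p. P (r x i) (Y (r y j) (-1) (r z l)) + P (r y j) (Y (r x i) (-1) (r z l)))"
      by (intro sum.cong HOL.refl) (auto simp: triples_def intro!: P_leibniz r x y z)
    also have "\<dots> = (\<Sum>(i, j, l)\<in>triples p. P (r x i) (Y (r y j) (-1) (r z l)))
        + (\<Sum>(i, j, l)\<in>triples p. P (r y j) (Y (r x i) (-1) (r z l)))"
      by (simp add: sum.distrib case_prod_unfold)
    also have "(\<Sum>(i, j, l)\<in>triples p. P (r y j) (Y (r x i) (-1) (r z l))) =
        (\<Sum>(i, j, l)\<in>triples p. P (r y i) (Y (r x j) (-1) (r z l)))"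
      by (rule sum_triples_swap)
    finally have 1: "\<phi> (x \<otimes>\<^bsub>?J\<^esub> y) z = (\<Sum>(i, j, l)\<in>triples p. P (r x i) (Y (r y j) (-1) (r z l)))
        + (\<Sum>(i, j, l)\<in>triples p. P (r y i) (Y (r x j) (-1) (r z l)))" .
    have 2: "\<phi> u (v \<otimes>\<^bsub>?J\<^esub> z) = (\<Sum>(i, j, l)\<in>triples p. P (r u i) (Y (r v j) (-1) (r z l)))"
      if "u \<in> carrier ?J" "v \<in> carrier ?J" for u v
    proof -
      have "\<phi> u (v \<otimes>\<^bsub>?J\<^esub> z) = (\<Sum>i\<le>p. P (r u i) (\<Sum>q\<le>p - i. Y (r v q) (-1) (r z (p - i - q))))"
        using that z by (intro \<phi>_eq closed mult_rep r)
      then show ?thesis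
        using sum_triples_right[of "\<lambda>i j l. P (r u i) (Y (r v j) (-1) (r z l))" p] by (simp only: P_sum)
    qed
    show "\<phi> (x \<otimes>\<^bsub>?J\<^esub> y) z = \<phi> x (y \<otimes>\<^bsub>?J\<^esub> z) + \<phi> y (x \<otimes>\<^bsub>?J\<^esub> z)"
      unfolding 1 2[OF x y] 2[OF y x] ..
    have 3: "\<phi> u (deriv ?J v \<otimes>\<^bsub>?J\<^esub> z) =
        (case p of 0 \<Rightarrow> 0 | Suc m \<Rightarrow> \<Sum>(i, j, l)\<in>triples m. P (r u i) (Y (r v j) (-2) (r z l)))"
      if "u \<in> carrier ?J" "v \<in> carrier ?J" for u v
    proof -
      have "\<phi> u (deriv ?J v \<otimes>\<^bsub>?J\<^esub> z) = (\<Sum>i\<le>p. P (r u i)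
          (case p - i of 0 \<Rightarrow> 0 | Suc m \<Rightarrow> \<Sum>q\<le>m. Y (r v q) (-2) (r z (m - q))))"
        using that z by (intro \<phi>_eq closed deriv_mult_rep r)
      also have "\<dots> = (case p of 0 \<Rightarrow> 0 | Suc m \<Rightarrow> \<Sum>(i, j, l)\<in>triples m. P (r u i) (Y (r v j) (-2) (r z l)))"
      proof (cases p)
        case (Suc m)
        have "(\<Sum>i\<le>p. P (r u i) (case p - i of 0 \<Rightarrow> 0 | Suc m \<Rightarrow> \<Sum>q\<le>m. Y (r v q) (-2) (r z (m - q)))) =
          (\<Sum>i\<le>m. P (r u i) (\<Sum>q\<le>m - i. Y (r v q) (-2) (r z (m - i - q))))"
          unfolding Suc sum.atMost_Suc by (simp add: P0 Suc_diff_le)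
        then show ?thesis
          using sum_triples_right[of "\<lambda>i j l. P (r u i) (Y (r v j) (-2) (r z l))" m]
          by (simp only: P_sum Suc nat.case)
      qed (simp add: P0)
      finally show ?thesis .
    qed
    show "\<phi> x (deriv ?J y \<otimes>\<^bsub>?J\<^esub> z) = \<phi> y (deriv ?J x \<otimes>\<^bsub>?J\<^esub> z)"
    proof (cases p)
      case (Suc m)
      have "(\<Sum>(i, j, l)\<in>triples m. P (r x i) (Y (r y j) (-2) (r z l))) =
          (\<Sum>(i, j, l)\<in>triples m. P (r y j) (Y (r x i) (-2) (r z l)))"
        by (intro sum.cong HOL.refl) (auto simp: triples_def Suc intro!: P_contraction r x y z)
      also have "\<dots> = (\<Sum>(i, j, l)\<in>triples m. P (r y i) (Y (r x j) (-2) (r z l)))"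
        by (rule sum_triples_swap)
      finally show ?thesis unfolding 3[OF x y] 3[OF y x] by (simp add: Suc)
    qed (simp add: 3[OF x y] 3[OF y x])
  next
    fix x y c assume x: "x \<in> carrier ?J" and y: "y \<in> carrier ?J"
    show "\<phi> (c \<odot>\<^bsub>?J\<^esub> x) y = c * \<phi> x y"
      using \<phi>_eq[of "c \<odot>\<^bsub>?J\<^esub> x" y "\<lambda>i. c *s r x i" "r y"] \<phi>_eq[of x y "r x" "r y"]
        x y by (simp add: closed r h_ops gr_smult_mem P_scale sum_distrib_left)
    show "\<phi> x (c \<odot>\<^bsub>?J\<^esub> y) = c * \<phi> x y"
      using \<phi>_eq[of x "c \<odot>\<^bsub>?J\<^esub> y" "r x" "\<lambda>i. c *s r y i"] \<phi>_eq[of x y "r x" "r y"]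
        x y by (simp add: closed r h_ops gr_smult_mem P_scale sum_distrib_left)
  qed
  define k where "k = the_inv_into (carrier ?J) h"
  have k: "k g \<in> carrier ?J" "h (k g) = g" if "g \<in> carrier gr" for g
    using that bij by (auto simp: k_def bij_betw_def the_inv_into_into f_the_inv_into_f)
  have kI: "k g = x" if "x \<in> carrier ?J" "g \<in> carrier gr" "\<And>n. \<exists>v. v \<in> g n \<and> v \<in> h x n" for g x
  proof -
    have "g = h x" using that h_carrier by (intro gr_eqI) auto
    then show ?thesis using that bij by (simp add: k_def bij_betw_def the_inv_into_f_f)
  qed
  \<comment> \<open>the functional on \<open>F\<^bsup>p+1\<^esup>V\<close> that factors through its symbols in degree \<open>p + 1\<close>\<close>
  define g where "g v = K.lift (k (gr_homogeneous (Suc p) v))" for v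
  have g_add: "g (a + b) = g a + g b" if "a \<in> F (Suc p)" "b \<in> F (Suc p)" for a b
  proof -
    let ?h = "gr_homogeneous (Suc p)"
    have c: "?h a \<in> carrier gr" "?h b \<in> carrier gr" "?h (a + b) \<in> carrier gr"
      using that by (auto intro!: gr_homogeneous_carrier)
    have "k (?h (a + b)) = k (?h a) \<oplus>\<^bsub>?J\<^esub> k (?h b)"
    proof (rule kI)
      show "k (?h a) \<oplus>\<^bsub>?J\<^esub> k (?h b) \<in> carrier ?J" using k(1)[OF c(1)] k(1)[OF c(2)] by simp
      fix n
      have "(if n = Suc p then a else 0) + (if n = Suc p then b else 0) \<in> h (k (?h a) \<oplus>\<^bsub>?J\<^esub> k (?h b)) n"
        unfolding h_ops(1)[OF k(1)[OF c(1)] k(1)[OF c(2)]] k(2)[OF c(1)] k(2)[OF c(2)]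
        by (intro gr_add_mem gr_homogeneous_mem)
      moreover have "(if n = Suc p then a else 0) + (if n = Suc p then b else 0) \<in> ?h (a + b) n"
        using gr_homogeneous_mem[of n "Suc p" "a + b"] by auto
      ultimately show "\<exists>v. v \<in> ?h (a + b) n \<and> v \<in> h (k (?h a) \<oplus>\<^bsub>?J\<^esub> k (?h b)) n" by blast
    qed (rule c)
    then show ?thesis using k c by (simp add: g_def K.jet_koszul_exact)
  qed
  have g_scale: "g (c *s a) = c * g a" if "a \<in> F (Suc p)" for a c
  proof -
    let ?h = "gr_homogeneous (Suc p)"
    have c: "?h a \<in> carrier gr" "?h (c *s a) \<in> carrier gr"
      using that by (auto intro!: gr_homogeneous_carrier)
    have "k (?h (c *s a)) = c \<odot>\<^bsub>?J\<^esub> k (?h a)"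
    proof (rule kI)
      show "c \<odot>\<^bsub>?J\<^esub> k (?h a) \<in> carrier ?J" by (rule J_smult[OF k(1)[OF c(1)]])
      fix n
      have "c *s (if n = Suc p then a else 0) \<in> h (c \<odot>\<^bsub>?J\<^esub> k (?h a)) n"
        unfolding h_ops(3)[OF k(1)[OF c(1)] k(1)[OF c(1)]] k(2)[OF c(1)]
        by (intro gr_smult_mem gr_homogeneous_mem)
      moreover have "c *s (if n = Suc p then a else 0) \<in> ?h (c *s a) n"
        using gr_homogeneous_mem[of n "Suc p" "c *s a"] by auto
      ultimately show "\<exists>v. v \<in> ?h (c *s a) n \<and> v \<in> h (c \<odot>\<^bsub>?J\<^esub> k (?h a)) n" by blast
    qed (rule c)
    then show ?thesis using k c by (simp add: g_def K.jet_koszul_exact)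
  qed
  obtain f where f: "functional f" "\<And>a. a \<in> F (Suc p) \<Longrightarrow> f a = g a"
    using functional_extension[of "F (Suc p)" g, OF F_subspace g_add g_scale] by auto
  show ?thesis
  proof (rule that[OF f(1)])
    fix v assume v: "v \<in> F (Suc (Suc p))"
    have v': "v \<in> F (Suc p)" using v by (rule F_monoD) simp
    have "gr_homogeneous (Suc p) v = gr_homogeneous (Suc p) 0"
      using v by (auto simp: fun_eq_iff gr_homogeneous_def li_symbol_eq_iff)
    then have "g v = g 0" by (simp add: g_def)
    then show "f v = 0" using f v' functional_simps(3)[OF f(1)] by simp
  next
    fix i j a b assume a: "a \<in> F i" and b: "b \<in> F j" and ij: "i + j = p"
    define x where "x = k (gr_homogeneous i a)"
    define y where "y = k (gr_homogeneous j b)"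
    have x: "x \<in> carrier ?J" "h x = gr_homogeneous i a"
      and y: "y \<in> carrier ?J" "h y = gr_homogeneous j b"
      using k gr_homogeneous_carrier a b by (simp_all add: x_def y_def)
    have ab: "Y a (-2) b \<in> F (Suc p)" using ij by (intro F_mode[OF a b]) auto
    define d where "d n = (case n of 0 \<Rightarrow> 0 | Suc q \<Rightarrow> T (if q = i then a else 0))" for n
    have d: "d n \<in> deriv gr (h x) n" for n
      unfolding d_def x(2) using gr_deriv_mem(1)[of "gr_homogeneous i a"] gr_deriv_mem(2)[of _ "gr_homogeneous i a"] gr_homogeneous_mem by (cases n) auto
    have "k (gr_homogeneous (Suc p) (Y a (-2) b)) = deriv ?J x \<otimes>\<^bsub>?J\<^esub> y"
    proof (rule kI)
      show "gr_homogeneous (Suc p) (Y a (-2) b) \<in> carrier gr" by (rule gr_homogeneous_carrier[OF ab])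
      show "deriv ?J x \<otimes>\<^bsub>?J\<^esub> y \<in> carrier ?J" using x y by (simp add: closed)
      fix n
      have "(\<Sum>q\<le>n. Y (d q) (-1) (if n - q = j then b else 0)) \<in> h (deriv ?J x \<otimes>\<^bsub>?J\<^esub> y) n"
        unfolding h_ops(2)[OF J.deriv_closed[OF x(1)] y(1)] h_ops(4)[OF x(1) x(1)] y(2)
        by (intro gr_mult_mem[of d _ "\<lambda>q. if q = j then b else 0"] d gr_homogeneous_mem)
      moreover have "(\<Sum>q\<le>n. Y (d q) (-1) (if n - q = j then b else 0)) = (if n = Suc p then Y a (-2) b else 0)"
      proof -
        have "Y (d q) (-1) (if n - q = j then b else 0) = (if q = Suc i then (if n = Suc p then Y a (-2) b else 0) else 0)"
          if "q \<le> n" for q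
          using that ij by (cases q) (auto simp: d_def Y_T)
        then have "(\<Sum>q\<le>n. Y (d q) (-1) (if n - q = j then b else 0)) =
           (\<Sum>q\<le>n. if q = Suc i then (if n = Suc p then Y a (-2) b else 0) else 0)"
          by (intro sum.cong HOL.refl) auto
        also have "\<dots> = (if n = Suc p then Y a (-2) b else 0)"
          using ij by auto
        finally show ?thesis .
      qed
      ultimately show "\<exists>v. v \<in> gr_homogeneous (Suc p) (Y a (-2) b) n \<and> v \<in> h (deriv ?J x \<otimes>\<^bsub>?J\<^esub> y) n"
        using gr_homogeneous_mem[of n "Suc p" "Y a (-2) b"] by auto
    qed
    then have "f (Y a (-2) b) = \<phi> x y"
      using f(2)[OF ab] x(1) y(1) by (simp add: g_def K.jet_koszul_exact)
    also have "\<dots> = (\<Sum>q\<le>p. P (if q = i then a else 0) (if p - q = j then b else 0))"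
      using x y by (intro \<phi>_eq[of x y "\<lambda>q. if q = i then a else 0" "\<lambda>q. if q = j then b else 0"])
        (simp_all only: gr_homogeneous_mem)
    also have "\<dots> = (\<Sum>q\<le>p. if q = i then P a b else 0)"
      using ij by (intro sum.cong HOL.refl) (auto simp: P0)
    also have "\<dots> = P a b" using ij by simp
    finally show "f (Y a (-2) b) = P a b" .
  qed
qed

end

section \<open>A functional that kills Zhu's relations\<close>

context N_graded_vertex_algebra begin

text \<open>The leading term, by weight, of a residue against \<open>x\<^sup>k z\<^sup>p\<close> is the mode \<open>a\<^bsub>(p)\<^esub>b\<close>.\<close>
lemma wcomp_emode:
  assumes a: "a \<in> W \<alpha>" and b: "b \<in> W \<beta>" and w: "w \<ge> \<alpha> + \<beta> - p - 1"
  shows "wcomp w (emode a k p b) = (if w = \<alpha> + \<beta> - p - 1 then Y a p b else 0)"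
proof -
  obtain N where N: "\<And>j. j \<ge> N \<Longrightarrow> Y a (p + int j) b = 0"
    using Y_vanishes[of a p b] by (auto simp: eventually_sequentially)
  have "emode a k p b = (\<Sum>j<Suc N. (of_int k gchoose j) *s Y a (p + int j) b)"
    unfolding emode_def using N by (intro binsum_eq) simp
  moreover have "wcomp w (Y a (p + int j) b) = (if w = \<alpha> + \<beta> - (p + int j) - 1 then Y a (p + int j) b else 0)" for j
    using Y_weight[OF a b HOL.refl, of "p + int j"] by (rule wcomp_of_mem)
  ultimately have "wcomp w (emode a k p b) =
      (\<Sum>j<Suc N. (of_int k gchoose j) *s (if w = \<alpha> + \<beta> - (p + int j) - 1 then Y a (p + int j) b else 0))"
    by simp
  also have "\<dots> = (\<Sum>j<Suc N. if j = 0 then (if w = \<alpha> + \<beta> - p - 1 then Y a p b else 0) else 0)"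
    using w by (intro sum.cong HOL.refl) auto
  finally show ?thesis by simp
qed

text \<open>
  The Li filtration satisfies \<open>F\<^sup>p V\<^sub>w = 0\<close> for \<open>w < p\<close>, so the descending induction on the Li degree can start.
\<close>
lemma zhu_at_large:
  assumes f: "functional f" and s: "int s \<ge> N"
  shows "zhu_at N s f"
  unfolding zhu_at_def
proof (intro allI impI)
  fix \<alpha> \<beta> i j a b
  assume *: "a \<in> W \<alpha>" "b \<in> W \<beta>" "a \<in> F i" "b \<in> F j" "\<alpha> + \<beta> + 1 = N" "s \<le> i + j"
  then have "\<alpha> < int i \<or> \<beta> < int j" using s by auto
  then have "a = 0 \<or> b = 0" using * F_weight_zero by blast
  then show "f (emode a \<alpha> (-2) b) = 0" by (auto simp: functional_simps[OF f])
qed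

text \<open>
  The functional \<open>\<mu>\<close> represents, in Li degree \<open>p\<close>, the defect \<open>f(a \<circ> b)\<close> by the leading term of
  \<open>a \<circ> b\<close>. Subtracting its weight \<open>N\<close> part removes the defect. Zhu elements of lower top weight
  do not have a component of weight \<open>N\<close>, so nothing that was achieved before is lost.
\<close>
lemma zhu_improve:
  assumes free: classically_free and f: "functional f" "zhu_below N f" "zhu_at N (Suc p) f"
  shows "\<exists>f'. functional f' \<and> zhu_below N f' \<and> zhu_at N p f' \<and> (\<forall>v. wcomp N v = 0 \<longrightarrow> f' v = f v)"
proof -
  obtain \<mu> where \<mu>: "functional \<mu>" "\<And>v. v \<in> F (Suc (Suc p)) \<Longrightarrow> \<mu> v = 0"
    "\<And>i j a b. a \<in> F i \<Longrightarrow> b \<in> F j \<Longrightarrow> i + j = p \<Longrightarrow> \<mu> (Y a (-2) b) = pairing N f a b"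
  proof (rule classically_free_pairing[OF free, of "pairing N f" p])
    show "pairing N f (Y a (-1) b) c = pairing N f a (Y b (-1) c) + pairing N f b (Y a (-1) c)"
      if "a \<in> F i" "b \<in> F j" "c \<in> F l" "i + j + l = p" for i j l a b c
      using that by (intro pairing_leibniz[OF f that(1,2,3)]) simp
    show "pairing N f a (Y b (-2) c) = pairing N f b (Y a (-2) c)"
      if "a \<in> F i" "b \<in> F j" "c \<in> F l" "i + j + l + 1 = p" for i j l a b c
      using that by (intro pairing_contraction[OF f that(1,2,3)]) simp
    show "pairing N f a b = 0" if "a \<in> F i" "b \<in> F j" "Suc p \<le> i + j" for i j a b
      using that by (intro pairing_zero[OF f(1,3)])
  qed (simp_all add: pairing_linear[OF f(1)])
  define f' where "f' v = f v - \<mu> (wcomp N v)" for v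
  have "functional f'"
    unfolding functional_def f'_def
    by (simp add: functional_simps[OF f(1)] functional_simps[OF \<mu>(1)] algebra_simps)
  moreover have "zhu_below N f'"
    unfolding zhu_below_def
  proof (intro allI impI)
    fix \<alpha> \<beta> a b assume *: "a \<in> W \<alpha>" "b \<in> W \<beta>" "\<alpha> + \<beta> + 1 < N"
    then have "f (emode a \<alpha> (-2) b) = 0" using f(2) by (simp add: zhu_below_def)
    moreover have "wcomp N (emode a \<alpha> (-2) b) = 0"
      using wcomp_emode[OF *(1,2), of "-2" N] * by simp
    ultimately show "f' (emode a \<alpha> (-2) b) = 0"
      by (simp add: f'_def functional_simps[OF \<mu>(1)])
  qed
  moreover have "zhu_at N p f'"
    unfolding zhu_at_def
  proof (intro allI impI)
    fix \<alpha> \<beta> i j a b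
    assume *: "a \<in> W \<alpha>" "b \<in> W \<beta>" "a \<in> F i" "b \<in> F j" "\<alpha> + \<beta> + 1 = N" "p \<le> i + j"
    have w: "wcomp N (emode a \<alpha> (-2) b) = Y a (-2) b"
      using wcomp_emode[OF *(1,2), of "-2" N] * by simp
    show "f' (emode a \<alpha> (-2) b) = 0"
    proof (cases "i + j = p")
      case True
      then show ?thesis
        using \<mu>(3)[OF *(3,4)] pairing_homogeneous[OF f(1) *(1,2)] *(5) by (simp add: f'_def w)
    next
      case False
      have "Y a (-2) b \<in> F (Suc (Suc p))" using False *(6) by (intro F_mode[OF *(3,4)]) auto
      moreover have "f (emode a \<alpha> (-2) b) = 0"
        using f(3) * False unfolding zhu_at_def by (metis Suc_leI le_neq_implies_less)
      ultimately show ?thesis by (simp add: f'_def w \<mu>(2))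
    qed
  qed
  moreover have "\<forall>v. wcomp N v = 0 \<longrightarrow> f' v = f v"
    by (simp add: f'_def functional_simps[OF \<mu>(1)])
  ultimately show ?thesis by blast
qed

lemma zhu_extend:
  assumes free: classically_free and f: "functional f" "zhu_below N f"
  shows "\<exists>f'. functional f' \<and> zhu_below (N + 1) f' \<and> (\<forall>v. wcomp N v = 0 \<longrightarrow> f' v = f v)"
proof -
  have "\<exists>f'. functional f' \<and> zhu_below N f' \<and> zhu_at N (nat N - n) f' \<and> (\<forall>v. wcomp N v = 0 \<longrightarrow> f' v = f v)" for n
  proof (induction n)
    case 0
    then show ?case using f zhu_at_large[OF f(1), of N "nat N"] by (intro exI[of _ f]) auto
  next
    case (Suc n)
    then obtain f' where f': "functional f'" "zhu_below N f'" "zhu_at N (nat N - n) f'"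
      "\<forall>v. wcomp N v = 0 \<longrightarrow> f' v = f v" by blast
    show ?case
    proof (cases "nat N - n")
      case 0
      with f' show ?thesis by (intro exI[of _ f']) auto
    next
      case (Suc p)
      then have "nat N - Suc n = p" by simp
      moreover obtain f'' where "functional f''" "zhu_below N f''" "zhu_at N p f''"
        "\<forall>v. wcomp N v = 0 \<longrightarrow> f'' v = f' v"
        using zhu_improve[OF free f'(1,2), of p] f'(3) Suc by auto
      ultimately show ?thesis using f'(4) by (intro exI[of _ f'']) auto
    qed
  qed
  from this[of "nat N"] obtain f' where f': "functional f'" "zhu_below N f'" "zhu_at N 0 f'"
    "\<forall>v. wcomp N v = 0 \<longrightarrow> f' v = f v" by auto
  have "zhu_below (N + 1) f'"
    unfolding zhu_below_def
  proof (intro allI impI)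
    fix \<alpha> \<beta> a b assume *: "a \<in> W \<alpha>" "b \<in> W \<beta>" "\<alpha> + \<beta> + 1 < N + 1"
    show "f' (emode a \<alpha> (-2) b) = 0"
    proof (cases "\<alpha> + \<beta> + 1 = N")
      case True
      then show ?thesis using f'(3) * unfolding zhu_at_def by (metis F_0 le0)
    next
      case False
      then show ?thesis using f'(2) * by (simp add: zhu_below_def)
    qed
  qed
  with f' show ?thesis by blast
qed

text \<open>
  The corrections made for the weight \<open>N\<close> change the functional only in that weight, so the
  sequence of corrected functionals is eventually constant at every vector.
\<close>
proposition zhu_functional_extension:
  assumes free: classically_free and f: "functional f" "zhu_below N f"
  shows "\<exists>\<psi>. functional \<psi> \<and> (\<forall>\<alpha> a b. a \<in> W \<alpha> \<longrightarrow> \<psi> (emode a \<alpha> (-2) b) = 0)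
    \<and> (\<forall>v. (\<forall>w\<ge>N. wcomp w v = 0) \<longrightarrow> \<psi> v = f v)"
proof -
  have "\<exists>g. \<forall>n. (functional (g n) \<and> zhu_below (N + int n) (g n) \<and> (n = 0 \<longrightarrow> g n = f))
      \<and> (\<forall>v. wcomp (N + int n) v = 0 \<longrightarrow> g (Suc n) v = g n v)"
  proof (rule dependent_nat_choice)
    show "\<exists>x. functional x \<and> zhu_below (N + int 0) x \<and> (0 = 0 \<longrightarrow> x = f)" using f by auto
  next
    fix x n assume "functional x \<and> zhu_below (N + int n) x \<and> (n = 0 \<longrightarrow> x = f)"
    then show "\<exists>y. (functional y \<and> zhu_below (N + int (Suc n)) y \<and> (Suc n = 0 \<longrightarrow> y = f))
        \<and> (\<forall>v. wcomp (N + int n) v = 0 \<longrightarrow> y v = x v)"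
      using zhu_extend[OF free, of x "N + int n"] by (auto simp: algebra_simps)
  qed
  then obtain g where g: "\<And>n. functional (g n)" "\<And>n. zhu_below (N + int n) (g n)" "g 0 = f"
    "\<And>n v. wcomp (N + int n) v = 0 \<Longrightarrow> g (Suc n) v = g n v" by blast
  have stable: "g (m + d) v = g m v" if "\<forall>w\<ge>N + int m. wcomp w v = 0" for v m d
    using that by (induction d) (auto simp: g(4))
  define \<psi> where "\<psi> v = (SOME x. eventually (\<lambda>n. g n v = x) sequentially)" for v
  have ev: "eventually (\<lambda>n. g n v = \<psi> v) sequentially" for v
  proof -
    obtain M where M: "\<And>w. w \<ge> int M \<Longrightarrow> wcomp w v = 0" using wcomp_sum[of v] by blast
    have "eventually (\<lambda>n. g n v = g (nat (int M - N)) v) sequentially"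
      unfolding eventually_sequentially
    proof (intro exI[of _ "nat (int M - N)"] allI impI)
      fix n assume "nat (int M - N) \<le> n"
      then obtain d where "n = nat (int M - N) + d" using le_Suc_ex by blast
      then show "g n v = g (nat (int M - N)) v" using stable[of "nat (int M - N)" v d] M by simp
    qed
    then show ?thesis unfolding \<psi>_def by (rule someI)
  qed
  have eqI: "\<psi> v = x" if "eventually (\<lambda>n. g n v = x) sequentially" for v x
    using eventually_conj[OF ev[of v] that] by (auto simp: eventually_sequentially)
  have "functional \<psi>"
    unfolding functional_def
  proof (intro conjI allI)
    fix a b show "\<psi> (a + b) = \<psi> a + \<psi> b"
      by (rule eqI, rule eventually_mono[OF eventually_conj[OF ev[of a] ev[of b]]])
         (auto simp: functional_simps[OF g(1)])
  next
    fix c a show "\<psi> (c *s a) = c * \<psi> a"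
      by (rule eqI, rule eventually_mono[OF ev[of a]]) (auto simp: functional_simps[OF g(1)])
  qed
  moreover have "\<psi> (emode a \<alpha> (-2) b) = 0" if a: "a \<in> W \<alpha>" for \<alpha> a b
  proof (induction b rule: homogeneous_induct)
    case (homogeneous \<beta> b)
    show ?case
    proof (rule eqI, unfold eventually_sequentially, intro exI[of _ "nat (\<alpha> + \<beta> + 2 - N)"] allI impI)
      fix n assume "nat (\<alpha> + \<beta> + 2 - N) \<le> n"
      then have "\<alpha> + \<beta> + 1 < N + int n" by simp
      then show "g n (emode a \<alpha> (-2) b) = 0"
        using g(2)[of n] a homogeneous unfolding zhu_below_def by blast
    qed
  next
    case (add u v)
    then show ?case by (simp add: functional_simps[OF \<open>functional \<psi>\<close>])
  qed
  moreover have "\<psi> v = f v" if "\<forall>w\<ge>N. wcomp w v = 0" for v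
  proof (rule eqI)
    have "g n v = f v" for n using stable[of 0 v n] that g(3) by simp
    then show "eventually (\<lambda>n. g n v = f v) sequentially" by simp
  qed
  ultimately show ?thesis by (intro exI[of _ \<psi>]) blast
qed

lemma functional_nonzero:
  assumes "a \<noteq> 0" obtains f where "functional f" "f a \<noteq> 0"
proof -
  have pair: "vector_space_pair scale ((*) :: complex \<Rightarrow> complex \<Rightarrow> complex)"
    by (rule vector_space_pair.intro) (rule vector_space_axioms cmul.vector_space_axioms)+
  have "independent {a}" using assms by simp
  from vector_space_pair.linear_independent_extend[OF pair this, of "\<lambda>_. 1"]
  obtain f where f: "Vector_Spaces.linear scale (*) f" "f a = (1::complex)" by auto
  interpret f: Vector_Spaces.linear scale "(*)" f by (rule f(1))
  show ?thesis by (rule that[of f]) (simp_all add: functional_def f.add f.scale f(2))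
qed

text \<open>
  In the lowest positive weight \<open>d\<close> any functional will do: a Zhu element \<open>u \<circ> v\<close> of top weight at most
  \<open>d\<close> has \<open>deg u < d\<close>, so \<open>u\<close> is a multiple of the vacuum and the leading term \<open>u\<^bsub>(-2)\<^esub>v\<close> is zero.
\<close>
theorem zhu_functional_exists:
  assumes free: classically_free and cft: "weight_space 0 = span {vac}" and nt: nontrivial
  shows "\<exists>\<psi> d a. functional \<psi> \<and> (\<forall>\<alpha> a b. a \<in> W \<alpha> \<longrightarrow> \<psi> (emode a \<alpha> (-2) b) = 0)
    \<and> d > 0 \<and> a \<in> W d \<and> \<psi> a \<noteq> 0"
proof -
  have W0: "W 0 = span {vac}" using cft by (simp add: W_def)
  have "\<exists>d>0. \<exists>a\<in>W (int d). a \<noteq> 0"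
  proof (rule ccontr)
    assume *: "\<not> ?thesis"
    have "v \<in> span {vac}" for v
    proof (induction v rule: homogeneous_induct)
      case (homogeneous w v)
      show ?case
      proof (cases "w > 0")
        case True
        then have "v = 0" using * homogeneous by (metis zero_less_imp_eq_int)
        then show ?thesis by (simp add: span_zero)
      next
        case False
        then show ?thesis using homogeneous W_negative[OF homogeneous] W0
          by (cases "w = 0") (auto simp: span_zero)
      qed
    qed (rule span_add)
    then show False using nt by (auto simp: nontrivial_def)
  qed
  define d where "d = (LEAST d. d > 0 \<and> (\<exists>a\<in>W (int d). a \<noteq> 0))"
  have d: "d > 0 \<and> (\<exists>a\<in>W (int d). a \<noteq> 0)"
    unfolding d_def by (rule LeastI_ex) (use \<open>\<exists>d>0. \<exists>a\<in>W (int d). a \<noteq> 0\<close> in blast)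
  have min: "v = 0" if "v \<in> W w" "0 < w" "w < int d" for v w
  proof -
    have "nat w < d" using that by simp
    from not_less_Least[OF this[unfolded d_def]] show ?thesis using that by auto
  qed
  from d obtain a where a: "a \<in> W (int d)" "a \<noteq> 0" by blast
  obtain e where e: "functional e" "e a \<noteq> 0" using functional_nonzero[OF a(2)] by blast
  define f where "f v = e (wcomp (int d) v)" for v
  have f: "functional f"
    unfolding functional_def f_def by (simp add: functional_simps[OF e(1)])
  have "zhu_below (int d + 1) f"
    unfolding zhu_below_def
  proof (intro allI impI)
    fix \<alpha> \<beta> u v assume *: "u \<in> W \<alpha>" "v \<in> W \<beta>" "\<alpha> + \<beta> + 1 < int d + 1"
    have "wcomp (int d) (emode u \<alpha> (-2) v) = 0"
    proof (cases "u = 0 \<or> v = 0")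
      case False
      then have "\<alpha> \<ge> 0" "\<beta> \<ge> 0" using * W_negative[of u \<alpha>] W_negative[of v \<beta>] by force+
      with * min[of u \<alpha>] False have "\<alpha> = 0" by force
      with * W0 have "u \<in> span {vac}" by simp
      then obtain c where "u = c *s vac" by (auto simp: span_singleton)
      then have "Y u (-2) v = 0" by (simp add: Y_vac_left)
      then show ?thesis using wcomp_emode[OF *(1,2), of "-2" "int d"] * by simp
    qed auto
    then show "f (emode u \<alpha> (-2) v) = 0" by (simp add: f_def functional_simps[OF e(1)])
  qed
  from zhu_functional_extension[OF free f this]
  obtain \<psi> where \<psi>: "functional \<psi>" "\<And>\<alpha> a b. a \<in> W \<alpha> \<Longrightarrow> \<psi> (emode a \<alpha> (-2) b) = 0"
    "\<And>v. (\<forall>w\<ge>int d + 1. wcomp w v = 0) \<Longrightarrow> \<psi> v = f v" by blast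
  have "\<psi> a = f a" by (rule \<psi>(3)) (auto simp: wcomp_of_mem[OF a(1)])
  then have "\<psi> a \<noteq> 0" using e(2) by (simp add: f_def wcomp_of_mem[OF a(1)])
  with \<psi> a d show ?thesis by (intro exI[of _ \<psi>] exI[of _ "int d"] exI[of _ a]) auto
qed

end

section \<open>Modes acting on functionals\<close>

text \<open>
  The Pascal array with the values \<open>B k\<close> on the antidiagonal \<open>k + p = C\<close> and zero for large \<open>k\<close>.
  With \<open>y = x/z\<close> one has \<open>z = (y - 1)\<^bsup>-1\<^esup>\<close>, and near \<open>x = 0\<close> the factor
  \<open>z\<^sup>u = (-1)\<^sup>u (1 - y)\<^bsup>-u\<^esup>\<close> is expanded in powers of \<open>y\<close>; here \<open>u = k + p - C\<close>.
\<close>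
definition diagonal_extension :: "int \<Rightarrow> (int \<Rightarrow> complex) \<Rightarrow> int \<Rightarrow> int \<Rightarrow> complex" where
  "diagonal_extension C B k p = (-1) powi (k + p - C) * cmul.altsum (C - k - p) (\<lambda>t. B (k + int t))"

lemma pascal_diagonal_extension:
  assumes "\<And>k. vanishes (\<lambda>t. B (k + int t))"
  shows "pascal (diagonal_extension C B)"
  unfolding pascal_def
proof (intro allI)
  fix k p
  let ?u = "k + p - C"
  have "cmul.altsum (C - k - p) (\<lambda>t. B (k + int t)) =
      cmul.altsum (C - k - p - 1) (\<lambda>t. B (k + int t)) - cmul.altsum (C - k - p - 1) (\<lambda>t. B (k + 1 + int t))"
    using cmul.altsum_pascal[OF assms[of k], of "C - k - p - 1"] by (simp add: algebra_simps)
  moreover have "((-1) powi (?u + 1) :: complex) = - ((-1) powi ?u)"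
    by (simp add: power_int_add)
  moreover have "C - (k + 1) - p = C - k - p - 1" "C - k - (p + 1) = C - k - p - 1"
    "k + 1 + p - C = ?u + 1" "k + (p + 1) - C = ?u + 1" by simp_all
  ultimately show "diagonal_extension C B (k + 1) p = diagonal_extension C B k p + diagonal_extension C B k (p + 1)"
    unfolding diagonal_extension_def by (simp only: right_diff_distrib) simp
qed

lemma diagonal_extension_diagonal: "k + p = C \<Longrightarrow> diagonal_extension C B k p = B k"
  unfolding diagonal_extension_def by auto

lemma diagonal_extension_zero: "(\<And>m. m \<ge> k \<Longrightarrow> B m = 0) \<Longrightarrow> diagonal_extension C B k p = 0"
  unfolding diagonal_extension_def by (simp add: cmul.altsum_all_zero)

text \<open>
  Let \<open>A k2 p2 k1 p1\<close> be an iterated residue at \<open>x\<^sub>2 = 0\<close> and \<open>z\<^sub>1 = 0\<close> against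
  \<open>x\<^sub>2\<^bsup>k2\<^esup> z\<^sub>2\<^bsup>p2\<^esup> x\<^sub>1\<^bsup>k1\<^esup> z\<^sub>1\<^bsup>p1\<^esup>\<close>. Since \<open>x\<^sub>1 - x\<^sub>2 = z\<^sub>1 - z\<^sub>2\<close> is close to \<open>1\<close> there, its \<open>n\<close>-th
  power may be expanded in powers of \<open>z\<^sub>1/z\<^sub>2\<close> (left) or of \<open>x\<^sub>2/x\<^sub>1\<close> (right). The induction on \<open>n\<close>
  uses that both sides obey the recurrence given by multiplication with this difference.
\<close>
proposition kernel_expansions_agree:
  fixes A :: "int \<Rightarrow> int \<Rightarrow> int \<Rightarrow> int \<Rightarrow> complex"
  assumes P2: "\<And>k1 p1. pascal (\<lambda>k2 p2. A k2 p2 k1 p1)" and P1: "\<And>k2 p2. pascal (A k2 p2)"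
    and L2: "\<And>k2 p2 k1 p1. k2 \<ge> L2 \<Longrightarrow> A k2 p2 k1 p1 = 0"
    and L1: "\<And>k2 p2 k1 p1. p1 \<ge> L1 \<Longrightarrow> A k2 p2 k1 p1 = 0"
  shows "cmul.altsum n (\<lambda>j. (-1) powi n * A k2 (p2 + n - int j) k1 (p1 + int j)) =
    cmul.altsum n (\<lambda>j. A (k2 + int j) p2 (k1 + n - int j) p1)"
proof -
  define U where "U n k2 p2 k1 p1 = cmul.altsum n (\<lambda>j. (-1) powi n * A k2 (p2 + n - int j) k1 (p1 + int j))" for n k2 p2 k1 p1
  define V where "V n k2 p2 k1 p1 = cmul.altsum n (\<lambda>j. A (k2 + int j) p2 (k1 + n - int j) p1)" for n k2 p2 k1 p1
  have vU: "vanishes (\<lambda>j. c * A k2 (f j) k1 (p1 + int j))" for c k2 f k1 p1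
    unfolding eventually_sequentially by (rule exI[of _ "nat (L1 - p1)"]) (auto simp: L1)
  have vV: "vanishes (\<lambda>j. A (k2 + int j) p2 (f j) p1)" for k2 p2 f p1
    unfolding eventually_sequentially by (rule exI[of _ "nat (L2 - k2)"]) (auto simp: L2)
  have sign: "((-1) powi (n + 1) :: complex) = - ((-1) powi n)" for n
    by (simp add: power_int_add)
  have U_step: "U (n + 1) k2 p2 k1 p1 = U n k2 p2 k1 (p1 + 1) - U n k2 (p2 + 1) k1 p1" for n k2 p2 k1 p1
  proof -
    have "U (n + 1) k2 p2 k1 p1 =
        cmul.altsum n (\<lambda>j. - ((-1) powi n * A k2 (p2 + 1 + n - int j) k1 (p1 + int j)))
        - cmul.altsum n (\<lambda>j. - ((-1) powi n * A k2 (p2 + n - int j) k1 (p1 + 1 + int j)))"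
      unfolding U_def cmul.altsum_pascal[OF vU] sign by (simp add: algebra_simps)
    from this[unfolded cmul.altsum_minus[OF vU]] show ?thesis
      unfolding U_def[of n] by simp
  qed
  have V_step: "V (n + 1) k2 p2 k1 p1 = V n k2 p2 (k1 + 1) p1 - V n (k2 + 1) p2 k1 p1" for n k2 p2 k1 p1
    unfolding V_def cmul.altsum_pascal[OF vV] by (simp add: algebra_simps)
  have U_pascal1: "pascal (U n k2 p2)" and U_pascal2: "pascal (\<lambda>k2 p2. U n k2 p2 k1 p1)" for n k2 p2 k1 p1
  proof -
    have "pascal (\<lambda>k1 p1. U n k2 p2 k1 p1)"
      unfolding U_def by (intro cmul.pascal_altsum cmul.pascal_scale pascal_shift'(4) P1 vU)
    then show "pascal (U n k2 p2)" by simp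
    have "pascal (\<lambda>k2 p2. A k2 (p2 + n - int j) k1 (p1 + int j))" for j
      using pascal_shift'(4)[OF P2, of "n - int j"] by (simp add: algebra_simps)
    then show "pascal (\<lambda>k2 p2. U n k2 p2 k1 p1)"
      unfolding U_def by (intro cmul.pascal_altsum cmul.pascal_scale vU)
  qed
  have U_step': "U (n + 1) k2 p2 k1 p1 = U n k2 p2 (k1 + 1) p1 - U n (k2 + 1) p2 k1 p1" for n k2 p2 k1 p1
    using U_step pascalD[OF U_pascal1[of n k2 p2], of k1 p1] pascalD[OF U_pascal2[of n k1 p1], of k2 p2]
    by simp
  have "\<forall>k2 p2 k1 p1. U n k2 p2 k1 p1 = V n k2 p2 k1 p1"
  proof (induction n rule: int_induct[where k = 0])
    case base
    show ?case by (simp add: U_def V_def)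
  next
    case (step1 n)
    then show ?case by (simp add: U_step' V_step)
  next
    case (step2 n)
    have step: "U (n - 1) k2 p2 (k1 + 1) p1 - V (n - 1) k2 p2 (k1 + 1) p1 =
        U (n - 1) (k2 + 1) p2 k1 p1 - V (n - 1) (k2 + 1) p2 k1 p1" for k2 p2 k1 p1
    proof -
      have "U (n - 1) k2 p2 (k1 + 1) p1 - U (n - 1) (k2 + 1) p2 k1 p1 =
          V (n - 1) k2 p2 (k1 + 1) p1 - V (n - 1) (k2 + 1) p2 k1 p1"
        using step2(2) U_step'[of "n - 1" k2 p2 k1 p1] V_step[of "n - 1" k2 p2 k1 p1] by simp
      then have "U (n - 1) k2 p2 (k1 + 1) p1 = V (n - 1) k2 p2 (k1 + 1) p1
          - V (n - 1) (k2 + 1) p2 k1 p1 + U (n - 1) (k2 + 1) p2 k1 p1"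
        by (simp only: diff_eq_eq)
      then show ?thesis by simp
    qed
    show ?case
    proof (intro allI)
      fix k2 p2 k1 p1
      have "U (n - 1) k2 p2 k1 p1 - V (n - 1) k2 p2 k1 p1 =
          U (n - 1) (k2 + int t) p2 (k1 - int t) p1 - V (n - 1) (k2 + int t) p2 (k1 - int t) p1" for t
      proof (induction t)
        case (Suc t)
        have e: "k2 + int t + 1 = k2 + int (Suc t)" "k1 - int (Suc t) + 1 = k1 - int t" by simp_all
        show ?case unfolding Suc.IH using step[of "k2 + int t" p2 "k1 - int (Suc t)" p1, unfolded e] .
      qed simp
      \<comment> \<open>the difference of the two sides is unchanged when a power of \<open>x\<^sub>1\<close> is moved to \<open>x\<^sub>2\<close>, up to where both vanish\<close>
      from this[of "nat (L2 - k2)"]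
      have "U (n - 1) k2 p2 k1 p1 - V (n - 1) k2 p2 k1 p1 = 0"
        by (simp add: U_def V_def L2 cmul.altsum_all_zero)
      then show "U (n - 1) k2 p2 k1 p1 = V (n - 1) k2 p2 k1 p1" by simp
    qed
  qed
  then show ?thesis by (simp add: U_def V_def)
qed

context N_graded_vertex_algebra begin

text \<open>
  For such \<open>f\<close> the residues of \<open>f(Y(a,z)v)\<close> at \<open>x = 1\<close> behave as those of a rational function
  with a pole of order at most \<open>deg a + n\<close> at \<open>x = 0\<close> and of order \<open>x\<^bsup>-deg a\<^esup>\<close> at
  infinity: the first inequality removes the pole at \<open>0\<close>, the second makes the residue at infinity zero.
\<close>
definition level :: "int \<Rightarrow> ('v \<Rightarrow> complex) \<Rightarrow> bool" where
  "level n f \<longleftrightarrow> functional f \<and>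
    (\<forall>\<alpha> a k p v. a \<in> W \<alpha> \<longrightarrow> k \<ge> \<alpha> + n \<longrightarrow> k + p \<le> \<alpha> - 2 \<longrightarrow> f (emode a k p v) = 0)"

lemma level_functional: "level n f \<Longrightarrow> functional f"
  by (simp add: level_def)

lemma levelD: "level n f \<Longrightarrow> a \<in> W \<alpha> \<Longrightarrow> k \<ge> \<alpha> + n \<Longrightarrow> k + p \<le> \<alpha> - 2 \<Longrightarrow> f (emode a k p v) = 0"
  by (simp add: level_def)

lemma level_zero_functional [simp]: "level n (\<lambda>v. 0)"
  by (simp add: level_def functional_def)

lemma functional_add: "functional f \<Longrightarrow> functional g \<Longrightarrow> functional (\<lambda>v. f v + g v)"
  unfolding functional_def by (simp only: distrib_left add.assoc add.left_commute) simp

lemma functional_scale: "functional f \<Longrightarrow> functional (\<lambda>v. c * f v)"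
  unfolding functional_def by (simp only: distrib_left mult.left_commute) simp

lemma level_add: "level n f \<Longrightarrow> level n g \<Longrightarrow> level n (\<lambda>v. f v + g v)"
  by (simp add: level_def functional_add)

lemma level_scale: "level n f \<Longrightarrow> level n (\<lambda>v. c * f v)"
  by (simp add: level_def functional_scale)

text \<open>
  The functionals that kill Zhu's elements are exactly the ones of level \<open>0\<close>: higher powers of \<open>z\<^bsup>-1\<^esup>\<close>
  and of \<open>x\<close> are reduced to \<open>x\<^sup>\<alpha> z\<^bsup>-2\<^esup>\<close> as before.
\<close>
lemma level_zeroI:
  assumes f: "functional f" and z: "\<And>\<alpha> a b. a \<in> W \<alpha> \<Longrightarrow> f (emode a \<alpha> (-2) b) = 0"
  shows "level 0 f"
  unfolding level_def
proof (intro conjI allI impI f)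
  fix \<alpha> a k p v assume *: "a \<in> W \<alpha>" "k \<ge> \<alpha> + 0" "k + p \<le> \<alpha> - 2"
  define m where "m = nat (k - \<alpha>)"
  define q where "q = nat (- p - 2)"
  have mq: "k = \<alpha> + int m" "p = - int q - 2" "m \<le> q" using * by (auto simp: m_def q_def)
  show "f (emode a k p v) = 0"
  proof (induction v rule: homogeneous_induct)
    case (homogeneous \<beta> v)
    have "zhu_below (\<alpha> + \<beta> + int q + 2) f" using z by (simp add: zhu_below_def)
    from zhu_pole_shift[OF f this *(1) homogeneous mq(3)] show ?case by (simp add: mq)
  qed (simp add: functional_simps[OF f])
qed

lemma emode_vac: "emode vac k p v = (if p \<le> -1 then (of_int k gchoose nat (- 1 - p)) *s v else 0)"
proof -
  have "emode vac k p v = (\<Sum>j<Suc (nat (- 1 - p)). (of_int k gchoose j) *s Y vac (p + int j) v)"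
    unfolding emode_def by (rule binsum_eq) (auto simp: Y_vac_left)
  also have "\<dots> = (\<Sum>j<Suc (nat (- 1 - p)). if j = nat (- 1 - p) then (if p \<le> -1 then (of_int k gchoose nat (- 1 - p)) *s v else 0) else 0)"
    by (intro sum.cong HOL.refl) (auto simp: Y_vac_left)
  finally show ?thesis by simp
qed

lemma level_negative: "level n f \<Longrightarrow> n < 0 \<Longrightarrow> f = (\<lambda>v. 0)"
proof
  fix v assume "level n f" "n < 0"
  then have "f (emode vac (-1) (-1) v) = 0" by (intro levelD[OF _ vac_weight]) auto
  then show "f v = 0" by (simp add: emode_vac)
qed

text \<open>
  The residue at \<open>x = 0\<close> of \<open>x\<^sup>k z\<^sup>p f(Y(a,z)v)\<close> for homogeneous \<open>a\<close> of weight \<open>\<alpha>\<close>. On the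
  antidiagonal \<open>k + p = \<alpha> - 2\<close> there is no residue at infinity, so it is minus the residue at
  \<open>x = 1\<close>. The residues on all other antidiagonals follow from \<open>x = 1 + z\<close>. The mode
  \<open>a\<^bsub>(k)\<^esub>\<close> acts on functionals by \<open>dual_mode f \<alpha> a k 0\<close>.
\<close>
definition dual_mode :: "('v \<Rightarrow> complex) \<Rightarrow> int \<Rightarrow> 'v \<Rightarrow> int \<Rightarrow> int \<Rightarrow> 'v \<Rightarrow> complex" where
  "dual_mode f \<alpha> a k p v = diagonal_extension (\<alpha> - 2) (\<lambda>m. - f (emode a m (\<alpha> - 2 - m) v)) k p"

lemma dual_mode_vanishes:
  assumes f: "level n f" and a: "a \<in> W \<alpha>"
  shows "vanishes (\<lambda>t. - f (emode a (k + int t) (\<alpha> - 2 - (k + int t)) v))"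
  unfolding eventually_sequentially
proof (intro exI[of _ "nat (\<alpha> + n - k)"] allI impI)
  fix t assume "t \<ge> nat (\<alpha> + n - k)"
  then have "f (emode a (k + int t) (\<alpha> - 2 - (k + int t)) v) = 0" by (intro levelD[OF f a]) auto
  then show "- f (emode a (k + int t) (\<alpha> - 2 - (k + int t)) v) = 0" by simp
qed

lemma pascal_dual_mode: "level n f \<Longrightarrow> a \<in> W \<alpha> \<Longrightarrow> pascal (\<lambda>k p. dual_mode f \<alpha> a k p v)"
  unfolding dual_mode_def by (rule pascal_diagonal_extension) (rule dual_mode_vanishes)

text \<open>The residue theorem: there is no residue at infinity.\<close>
lemma dual_mode_eq:
  assumes f: "level n f" and a: "a \<in> W \<alpha>" and kp: "k + p \<le> \<alpha> - 2"
  shows "dual_mode f \<alpha> a k p v = - f (emode a k p v)"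
proof -
  have 1: "pascal (\<lambda>k p. - f (emode a k p v))"
    using pascal_emode[of a v] by (simp add: pascal_def functional_simps[OF level_functional[OF f]])
  show ?thesis
  proof (rule pascal_eq_below[OF pascal_dual_mode[OF f a] 1 _ kp])
    fix k p assume *: "k + p = \<alpha> - 2"
    then have "p = \<alpha> - 2 - k" by simp
    then show "dual_mode f \<alpha> a k p v = - f (emode a k p v)"
      unfolding dual_mode_def diagonal_extension_diagonal[OF *] by simp
  qed
qed

lemma dual_mode_zero:
  assumes f: "level n f" and a: "a \<in> W \<alpha>" and k: "k \<ge> \<alpha> + n"
  shows "dual_mode f \<alpha> a k p v = 0"
  unfolding dual_mode_def
proof (rule diagonal_extension_zero)
  fix m assume "m \<ge> k"
  with k have "f (emode a m (\<alpha> - 2 - m) v) = 0" by (intro levelD[OF f a]) auto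
  then show "- f (emode a m (\<alpha> - 2 - m) v) = 0" by simp
qed

lemma dual_mode_of_zero [simp]: "dual_mode (\<lambda>v. 0) \<alpha> a k p = (\<lambda>v. 0)"
  by (simp add: dual_mode_def diagonal_extension_def fun_eq_iff)

lemma dual_mode_functional:
  assumes f: "level n f" and a: "a \<in> W \<alpha>"
  shows "functional (dual_mode f \<alpha> a k p)"
proof -
  note fs = functional_simps[OF level_functional[OF f]]
  have "cmul.altsum m (\<lambda>t. - f (emode a (k + int t) (\<alpha> - 2 - (k + int t)) (v + w))) =
      cmul.altsum m (\<lambda>t. - f (emode a (k + int t) (\<alpha> - 2 - (k + int t)) v))
      + cmul.altsum m (\<lambda>t. - f (emode a (k + int t) (\<alpha> - 2 - (k + int t)) w))" for m v w
    by (subst cmul.altsum_add[symmetric]) (simp_all only: dual_mode_vanishes[OF f a] emode_right fs minus_add_distrib)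
  moreover have "cmul.altsum m (\<lambda>t. - f (emode a (k + int t) (\<alpha> - 2 - (k + int t)) (c *s v))) =
      c * cmul.altsum m (\<lambda>t. - f (emode a (k + int t) (\<alpha> - 2 - (k + int t)) v))" for m c v
    by (subst cmul.altsum_scale[symmetric]) (simp_all only: dual_mode_vanishes[OF f a] emode_right fs mult_minus_right)
  ultimately show ?thesis
    unfolding functional_def dual_mode_def diagonal_extension_def by (simp only: distrib_left mult.left_commute) simp
qed

lemma dual_mode_left_linear:
  assumes f: "level n f" and a: "a \<in> W \<alpha>" "a' \<in> W \<alpha>"
  shows "dual_mode f \<alpha> (a + a') k p v = dual_mode f \<alpha> a k p v + dual_mode f \<alpha> a' k p v"
    "dual_mode f \<alpha> (c *s a) k p v = c * dual_mode f \<alpha> a k p v"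
proof -
  note fs = functional_simps[OF level_functional[OF f]]
  have "cmul.altsum m (\<lambda>t. - f (emode (a + a') (k + int t) (\<alpha> - 2 - (k + int t)) v)) =
      cmul.altsum m (\<lambda>t. - f (emode a (k + int t) (\<alpha> - 2 - (k + int t)) v))
      + cmul.altsum m (\<lambda>t. - f (emode a' (k + int t) (\<alpha> - 2 - (k + int t)) v))" for m
    by (subst cmul.altsum_add[symmetric])
       (simp_all only: dual_mode_vanishes[OF f a(1)] dual_mode_vanishes[OF f a(2)] emode_left fs minus_add_distrib)
  then show "dual_mode f \<alpha> (a + a') k p v = dual_mode f \<alpha> a k p v + dual_mode f \<alpha> a' k p v"
    unfolding dual_mode_def diagonal_extension_def by (simp only: distrib_left)
  have "cmul.altsum m (\<lambda>t. - f (emode (c *s a) (k + int t) (\<alpha> - 2 - (k + int t)) v)) =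
      c * cmul.altsum m (\<lambda>t. - f (emode a (k + int t) (\<alpha> - 2 - (k + int t)) v))" for m
    by (subst cmul.altsum_scale[symmetric]) (simp_all only: dual_mode_vanishes[OF f a(1)] emode_left fs mult_minus_right)
  then show "dual_mode f \<alpha> (c *s a) k p v = c * dual_mode f \<alpha> a k p v"
    unfolding dual_mode_def diagonal_extension_def by (simp only: mult.left_commute)
qed

lemma dual_mode_functional_linear:
  assumes f: "level n f" and g: "level m g" and a: "a \<in> W \<alpha>"
  shows "dual_mode (\<lambda>v. f v + g v) \<alpha> a k p v = dual_mode f \<alpha> a k p v + dual_mode g \<alpha> a k p v"
    "dual_mode (\<lambda>v. c * f v) \<alpha> a k p v = c * dual_mode f \<alpha> a k p v"
proof -
  have "cmul.altsum r (\<lambda>t. - (f (emode a (k + int t) (\<alpha> - 2 - (k + int t)) v) + g (emode a (k + int t) (\<alpha> - 2 - (k + int t)) v))) =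
      cmul.altsum r (\<lambda>t. - f (emode a (k + int t) (\<alpha> - 2 - (k + int t)) v))
      + cmul.altsum r (\<lambda>t. - g (emode a (k + int t) (\<alpha> - 2 - (k + int t)) v))" for r
    by (subst cmul.altsum_add[symmetric])
       (simp_all only: dual_mode_vanishes[OF f a] dual_mode_vanishes[OF g a] minus_add_distrib)
  then show "dual_mode (\<lambda>v. f v + g v) \<alpha> a k p v = dual_mode f \<alpha> a k p v + dual_mode g \<alpha> a k p v"
    unfolding dual_mode_def diagonal_extension_def by (simp only: distrib_left)
  have "cmul.altsum r (\<lambda>t. - (c * f (emode a (k + int t) (\<alpha> - 2 - (k + int t)) v))) =
      c * cmul.altsum r (\<lambda>t. - f (emode a (k + int t) (\<alpha> - 2 - (k + int t)) v))" for r
    by (subst cmul.altsum_scale[symmetric]) (simp_all only: dual_mode_vanishes[OF f a] mult_minus_right)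
  then show "dual_mode (\<lambda>v. c * f v) \<alpha> a k p v = c * dual_mode f \<alpha> a k p v"
    unfolding dual_mode_def diagonal_extension_def by (simp only: mult.left_commute)
qed

lemma dual_mode_vac: "level n f \<Longrightarrow> dual_mode f 0 vac k 0 v = (if k = -1 then f v else 0)"
proof -
  assume f: "level n f"
  note fs = functional_simps[OF level_functional[OF f]]
  consider "k \<le> -2" | "k = -1" | "k \<ge> 0" by linarith
  then show ?thesis
  proof cases
    case 1
    then show ?thesis using dual_mode_eq[OF f vac_weight, of k 0 v] by (simp add: emode_vac fs)
  next
    case 2
    have "pascal (\<lambda>k p. dual_mode f 0 vac k p v)" by (rule pascal_dual_mode[OF f vac_weight])
    from pascalD[OF this, of "-1" "-1"]
    have "dual_mode f 0 vac (-1) 0 v = dual_mode f 0 vac 0 (-1) v - dual_mode f 0 vac (-1) (-1) v" by simp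
    moreover have "dual_mode f 0 vac (-1) (-1) v = - f v"
      using dual_mode_eq[OF f vac_weight, of "-1" "-1" v] by (simp add: emode_vac fs)
    moreover have "dual_mode f 0 vac 0 (-1) v = 0"
      unfolding dual_mode_def
    proof (rule diagonal_extension_zero)
      fix m :: int assume "m \<ge> 0"
      then have "(of_int m gchoose nat (1 + m) :: complex) = 0"
        using binomial_gbinomial[of "nat m" "nat (1 + m)", where 'a = complex] by (simp add: nat_add_distrib binomial_eq_0)
      with \<open>m \<ge> 0\<close> show "- f (emode vac m (0 - 2 - m) v) = 0" by (simp add: emode_vac fs)
    qed
    ultimately show ?thesis using 2 by simp
  next
    case 3
    have "dual_mode f 0 vac k 0 v = 0"
      unfolding dual_mode_def
    proof (rule diagonal_extension_zero)
      fix m :: int assume "m \<ge> k"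
      with 3 have "m \<ge> 0" by simp
      then have "(of_int m gchoose nat (1 + m) :: complex) = 0"
        using binomial_gbinomial[of "nat m" "nat (1 + m)", where 'a = complex] by (simp add: nat_add_distrib binomial_eq_0)
      with \<open>m \<ge> 0\<close> show "- f (emode vac m (0 - 2 - m) v) = 0" by (simp add: emode_vac fs)
    qed
    with 3 show ?thesis by simp
  qed
qed

text \<open>
  The bound \<open>m \<ge> n\<close> is not the natural one, but it is what the commutator formula at \<open>x = 1\<close> gives
  directly. It already suffices to apply a second mode and to prove the Borcherds identity, from
  which the sharp bound follows afterwards.
\<close>
lemma dual_mode_level_weak:
  assumes f: "level n f" and a: "a \<in> W \<alpha>" and m: "m \<ge> n" "m \<ge> n + \<alpha> - k0 - 1"
  shows "level m (dual_mode f \<alpha> a k0 p0)"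
  unfolding level_def
proof (intro conjI allI impI)
  show "functional (dual_mode f \<alpha> a k0 p0)" by (rule dual_mode_functional[OF f a])
  note fs = functional_simps[OF level_functional[OF f]]
  fix \<beta> b k2 p2 v assume b: "b \<in> W \<beta>" and k2: "k2 \<ge> \<beta> + m" "k2 + p2 \<le> \<beta> - 2"
  show "dual_mode f \<alpha> a k0 p0 (emode b k2 p2 v) = 0"
  proof (rule pascal_zero_from_diagonal[OF pascal_dual_mode[OF f a], of k0 "\<alpha> - 2" _ "\<alpha> + n"])
    show "dual_mode f \<alpha> a k p (emode b k2 p2 v) = 0" if "\<alpha> + n \<le> k" for k p
      using that by (rule dual_mode_zero[OF f a])
    fix k p assume kp: "k0 \<le> k" "k + p \<le> \<alpha> - 2"
    obtain J where J: "\<And>j. j \<ge> J \<Longrightarrow> Y a (0 + int j) b = 0"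
      using Y_vanishes[of a 0 b] by (auto simp: eventually_sequentially)
    have "emode a k p (emode b k2 p2 v) = emode b k2 p2 (emode a k p v)
      + (\<Sum>j<J. taylor j (\<lambda>k p. emode (Y a (0 + int j) b) (k + k2) (p + p2) v) k p)"
      using emode_borcherds[of J a 0 b k p k2 p2 v, OF J] by (simp add: diff_eq_eq add.commute)
    also have "f \<dots> = 0"
    proof -
      have "f (emode b k2 p2 (emode a k p v)) = 0" using k2 m by (intro levelD[OF f b]) auto
      moreover have "f (emode (Y a (0 + int j) b) (k - int i + k2) (p - int (j - i) + p2) v) = 0" if "i \<le> j" for i j
      proof (rule levelD[OF f])
        show "Y a (0 + int j) b \<in> W (\<alpha> + \<beta> - int j - 1)" by (rule Y_weight[OF a b]) simp
      qed (use that kp k2 m in auto)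
      ultimately show ?thesis by (simp add: fs taylor_def)
    qed
    finally show "dual_mode f \<alpha> a k p (emode b k2 p2 v) = 0" by (simp add: dual_mode_eq[OF f a kp(2)])
  qed simp
qed

end

section \<open>The Borcherds identity for modes acting on functionals\<close>

context N_graded_vertex_algebra begin

lemma dual_mode_zero_functional: "level n f \<Longrightarrow> a \<in> W \<alpha> \<Longrightarrow> k \<ge> \<alpha> + n \<Longrightarrow> dual_mode f \<alpha> a k p = (\<lambda>v. 0)"
  by (rule ext) (rule dual_mode_zero)

lemma dual_mode_level_weak':
  assumes "level l f" "b \<in> W \<beta>"
  shows "level (max l (l + \<beta> - k - 1)) (dual_mode f \<beta> b k p)"
  using dual_mode_level_weak[OF assms] by simp

lemma pascal_dual_mode_inner:
  assumes f: "level l f" and b: "b \<in> W \<beta>" and a: "a \<in> W \<alpha>"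
  shows "pascal (\<lambda>k p. dual_mode (dual_mode f \<beta> b k p) \<alpha> a k' p' v)"
  unfolding pascal_def
proof (intro allI)
  fix k p
  have "dual_mode f \<beta> b (k + 1) p = (\<lambda>v. dual_mode f \<beta> b k p v + dual_mode f \<beta> b k (p + 1) v)"
    by (rule ext) (rule pascalD[OF pascal_dual_mode[OF f b]])
  then show "dual_mode (dual_mode f \<beta> b (k + 1) p) \<alpha> a k' p' v =
      dual_mode (dual_mode f \<beta> b k p) \<alpha> a k' p' v + dual_mode (dual_mode f \<beta> b k (p + 1)) \<alpha> a k' p' v"
    using dual_mode_functional_linear(1)[OF dual_mode_level_weak'[OF f b] dual_mode_level_weak'[OF f b] a] by simp
qed

text \<open>
  The residue theorem is applied in both variables, first to \<open>x\<^sub>2\<close> and then to \<open>x\<^sub>1\<close>, with the change of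
  expansion of \<open>(x\<^sub>1 - x\<^sub>2)\<^sup>n\<close> in between. The two bounds exclude residues at infinity.
\<close>
lemma dual_mode_pair_expand:
  assumes f: "level l f" and a: "a \<in> W \<alpha>" and b: "b \<in> W \<beta>"
    and k2: "k2 + p2 + n \<le> \<beta> - 2" and k1: "k1 + p1 + n \<le> \<alpha> - 2"
  shows "cmul.altsum n (\<lambda>j. (-1) powi n * f (emode b k2 (p2 + n - int j) (emode a k1 (p1 + int j) v))) =
    cmul.altsum n (\<lambda>j. dual_mode (dual_mode f \<beta> b (k2 + int j) p2) \<alpha> a (k1 + n - int j) p1 v)"
proof -
  obtain L where L: "\<forall>k p. p \<ge> L \<longrightarrow> emode a k p v = 0" using emode_bound by blast
  define A where "A k2 p2 k1 p1 = dual_mode f \<beta> b k2 p2 (emode a k1 p1 v)" for k2 p2 k1 p1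
  have fs: "functional (dual_mode f \<beta> b k2 p2)" for k2 p2 by (rule dual_mode_functional[OF f b])
  have eq: "cmul.altsum n (\<lambda>j. (-1) powi n * A k2 (p2 + n - int j) k1 (p1 + int j)) =
      cmul.altsum n (\<lambda>j. A (k2 + int j) p2 (k1 + n - int j) p1)"
  proof (rule kernel_expansions_agree[where ?L1.0 = L and ?L2.0 = "\<beta> + l"])
    show "pascal (\<lambda>k2 p2. A k2 p2 k1 p1)" for k1 p1
      unfolding A_def by (rule pascal_dual_mode[OF f b])
    show "pascal (A k2 p2)" for k2 p2
      using pascal_emode[of a v] by (simp add: A_def pascal_def functional_simps[OF fs])
    show "A k2 p2 k1 p1 = 0" if "\<beta> + l \<le> k2" for k2 p2 k1 p1
      unfolding A_def using that by (rule dual_mode_zero[OF f b])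
    show "A k2 p2 k1 p1 = 0" if "L \<le> p1" for k2 p2 k1 p1
      using that L by (simp add: A_def functional_simps[OF fs])
  qed
  have v1: "vanishes (\<lambda>j. (-1) powi n * A k2 (p2 + n - int j) k1 (p1 + int j))"
    unfolding eventually_sequentially A_def
    by (rule exI[of _ "nat (L - p1)"]) (use L in \<open>auto simp: functional_simps[OF fs]\<close>)
  have v2: "vanishes (\<lambda>j. A (k2 + int j) p2 (k1 + n - int j) p1)"
    unfolding eventually_sequentially A_def
    by (rule exI[of _ "nat (\<beta> + l - k2)"]) (auto simp: dual_mode_zero[OF f b])
  have "(-1) powi n * f (emode b k2 (p2 + n - int j) (emode a k1 (p1 + int j) v)) =
      - ((-1) powi n * A k2 (p2 + n - int j) k1 (p1 + int j))" for j
    using dual_mode_eq[OF f b, of k2 "p2 + n - int j"] k2 by (simp add: A_def)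
  moreover have "dual_mode (dual_mode f \<beta> b (k2 + int j) p2) \<alpha> a (k1 + n - int j) p1 v = - A (k2 + int j) p2 (k1 + n - int j) p1" for j
    unfolding A_def using k1 by (intro dual_mode_eq[OF dual_mode_level_weak'[OF f b] a]) simp
  ultimately show ?thesis
    by (simp only: cmul.altsum_minus[OF v1] cmul.altsum_minus[OF v2] eq)
qed

text \<open>
  Where all residues at infinity vanish, this is minus the functional \<open>f\<close> applied to the identity at
  \<open>x = 1\<close>. The roles of \<open>a\<close> and \<open>b\<close> are exchanged because a functional is precomposed with the modes,
  and the sign is that of the residue theorem. The general case follows by Pascal's recurrence in
  \<open>(k1, p1)\<close> and \<open>(k2, p2)\<close>.
\<close>
proposition dual_mode_borcherds:
  assumes f: "level l f" and a: "a \<in> W \<alpha>" and b: "b \<in> W \<beta>"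
    and J: "\<And>j. j \<ge> J \<Longrightarrow> Y a (n + int j) b = 0"
  shows "cmul.altsum n (\<lambda>j. dual_mode (dual_mode f \<beta> b (k2 + int j) p2) \<alpha> a (k1 + n - int j) p1 v
        - (-1) powi n * dual_mode (dual_mode f \<alpha> a (k1 + int j) p1) \<beta> b (k2 + n - int j) p2 v) =
    (\<Sum>j<J. cmul.taylor j (\<lambda>k p. dual_mode f (\<alpha> + \<beta> - n - int j - 1) (Y a (n + int j) b) (k + k2) (p + p2) v) k1 p1)"
proof -
  have d: "Y a (n + int j) b \<in> W (\<alpha> + \<beta> - n - int j - 1)" for j
    by (rule Y_weight[OF a b]) simp
  define G where "G k1 p1 k2 p2 j = dual_mode (dual_mode f \<beta> b (k2 + int j) p2) \<alpha> a (k1 + n - int j) p1 v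
        - (-1) powi n * dual_mode (dual_mode f \<alpha> a (k1 + int j) p1) \<beta> b (k2 + n - int j) p2 v" for k1 p1 k2 p2 j
  define B where "B k1 p1 k2 p2 j = cmul.taylor j (\<lambda>k p. dual_mode f (\<alpha> + \<beta> - n - int j - 1) (Y a (n + int j) b) (k + k2) (p + p2) v) k1 p1" for k1 p1 k2 p2 j
  define D where "D k1 p1 k2 p2 = cmul.altsum n (G k1 p1 k2 p2) - (\<Sum>j<J. B k1 p1 k2 p2 j)" for k1 p1 k2 p2
  have v1: "vanishes (\<lambda>j. c * dual_mode (dual_mode f \<beta> b (k2 + int j) p2) \<alpha> a (k1 + n - int j) p1 v)" for c k2 p2 k1 p1
    unfolding eventually_sequentially
    by (rule exI[of _ "nat (\<beta> + l - k2)"]) (auto simp: dual_mode_zero_functional[OF f b])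
  have v2: "vanishes (\<lambda>j. c * dual_mode (dual_mode f \<alpha> a (k1 + int j) p1) \<beta> b (k2 + n - int j) p2 v)" for c k2 p2 k1 p1
    unfolding eventually_sequentially
    by (rule exI[of _ "nat (\<alpha> + l - k1)"]) (auto simp: dual_mode_zero_functional[OF f a])
  have G_vanishes: "vanishes (G k1 p1 k2 p2)" for k1 p1 k2 p2
    using eventually_conj[OF v1[of 1 k2 p2 k1 p1] v2[of "(-1) powi n" k1 p1 k2 p2]]
    unfolding G_def by (rule eventually_mono) simp
  have sh1: "pascal (\<lambda>k1 p1. dual_mode g \<alpha> a (k1 + n - int j) p1 v)" if "level m g" for g m j
    using pascal_shift[OF pascal_dual_mode[OF that a], of "n - int j" 0] by (simp add: algebra_simps)
  have sh2: "pascal (\<lambda>k2 p2. dual_mode g \<beta> b (k2 + n - int j) p2 v)" if "level m g" for g m j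
    using pascal_shift[OF pascal_dual_mode[OF that b], of "n - int j" 0] by (simp add: algebra_simps)
  have G1: "pascal (\<lambda>k1 p1. G k1 p1 k2 p2 j)" for k2 p2 j
    unfolding G_def
    by (intro pascal_diff cmul.pascal_scale sh1[OF dual_mode_level_weak'[OF f b]] pascal_shift'(6)[OF pascal_dual_mode_inner[OF f a b]])
  have G2: "pascal (\<lambda>k2 p2. G k1 p1 k2 p2 j)" for k1 p1 j
    unfolding G_def
    by (intro pascal_diff cmul.pascal_scale sh2[OF dual_mode_level_weak'[OF f a]] pascal_shift'(6)[OF pascal_dual_mode_inner[OF f b a]])
  have B1: "pascal (\<lambda>k1 p1. B k1 p1 k2 p2 j)" for k2 p2 j
    unfolding B_def by (intro cmul.pascal_taylor pascal_shift pascal_dual_mode[OF f d])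
  have B2: "pascal (\<lambda>k2 p2. B k1 p1 k2 p2 j)" for k1 p1 j
    unfolding B_def cmul.taylor_def
  proof (intro cmul.pascal_sum cmul.pascal_scale)
    fix i
    show "pascal (\<lambda>k2 p2. dual_mode f (\<alpha> + \<beta> - n - int j - 1) (Y a (n + int j) b) (k1 - int i + k2) (p1 - int (j - i) + p2) v)"
      using pascal_shift[OF pascal_dual_mode[OF f d[of j]], of "k1 - int i" "p1 - int (j - i)"] by (simp add: add.commute)
  qed
  have D1: "pascal (\<lambda>k1 p1. D k1 p1 k2 p2)" for k2 p2
    unfolding D_def by (intro pascal_diff cmul.pascal_altsum cmul.pascal_sum G1 G_vanishes B1)
  have D2: "pascal (\<lambda>k2 p2. D k1 p1 k2 p2)" for k1 p1
    unfolding D_def by (intro pascal_diff cmul.pascal_altsum cmul.pascal_sum G2 G_vanishes B2)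
  have B_zero: "B k1 p1 k2 p2 j = 0" if "k1 + k2 \<ge> \<alpha> + \<beta> - n - 1 + l" for k1 p1 k2 p2 j
    unfolding B_def cmul.taylor_def
  proof (intro sum.neutral ballI)
    fix i assume "i \<in> {..j}"
    then have "dual_mode f (\<alpha> + \<beta> - n - int j - 1) (Y a (n + int j) b) (k1 - int i + k2) (p1 - int (j - i) + p2) v = 0"
      using that by (intro dual_mode_zero[OF f d]) auto
    then show "(of_int k1 gchoose i) * (of_int p1 gchoose (j - i)) *
       dual_mode f (\<alpha> + \<beta> - n - int j - 1) (Y a (n + int j) b) (k1 - int i + k2) (p1 - int (j - i) + p2) v = 0" by simp
  qed
  \<comment> \<open>enough decay at infinity for the residue theorem; \<open>\<bar>n\<bar>\<close> accounts for the factor \<open>(x\<^sub>1 - x\<^sub>2)\<^sup>n\<close>\<close>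
  have core: "D k1 p1 k2 p2 = 0" if c1: "k1 + p1 \<le> \<alpha> - 2 - \<bar>n\<bar>" and c2: "k2 + p2 \<le> \<beta> - 2 - \<bar>n\<bar>" for k1 p1 k2 p2
  proof -
    note fs = functional_simps[OF level_functional[OF f]]
    define E1 where "E1 j = f (emode a k1 (p1 + n - int j) (emode b k2 (p2 + int j) v))" for j
    define E2 where "E2 j = f (emode b k2 (p2 + n - int j) (emode a k1 (p1 + int j) v))" for j
    have vE1: "vanishes (\<lambda>j. c * E1 j)" for c
      using emode_vanishes[of b k2 p2 v] unfolding E1_def by (rule eventually_mono) (simp add: fs)
    have vE2: "vanishes (\<lambda>j. c * E2 j)" for c
      using emode_vanishes[of a k1 p1 v] unfolding E2_def by (rule eventually_mono) (simp add: fs)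
    have sq: "((-1) powi n * (-1) powi n :: complex) = 1"
      by (simp flip: power_int_mult_distrib)
    define S where "S j = emode a k1 (p1 + n - int j) (emode b k2 (p2 + int j) v)
        - (-1) powi n *s emode b k2 (p2 + n - int j) (emode a k1 (p1 + int j) v)" for j
    have S_vanishes: "vanishes S"
      using eventually_conj[OF emode_vanishes[of b k2 p2 v] emode_vanishes[of a k1 p1 v]]
      unfolding S_def by (rule eventually_mono) simp
    have "f (altsum n S) = cmul.altsum n (\<lambda>j. E1 j - (-1) powi n * E2 j)"
      unfolding functional_altsum[OF level_functional[OF f] S_vanishes] by (simp add: S_def E1_def E2_def fs)
    also have "\<dots> = cmul.altsum n E1 - cmul.altsum n (\<lambda>j. (-1) powi n * E2 j)"
      using vE1[of 1] vE2[of "(-1) powi n"] by (intro cmul.altsum_diff) simp_all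
    also have "cmul.altsum n (\<lambda>j. (-1) powi n * E2 j) =
        cmul.altsum n (\<lambda>j. dual_mode (dual_mode f \<beta> b (k2 + int j) p2) \<alpha> a (k1 + n - int j) p1 v)"
      unfolding E2_def using c1 c2 by (intro dual_mode_pair_expand[OF f a b]) auto
    also have "cmul.altsum n E1 = cmul.altsum n (\<lambda>j. (-1) powi n * ((-1) powi n * E1 j))"
      by (simp only: mult.assoc[symmetric] sq mult_1)
    also have "\<dots> = (-1) powi n * cmul.altsum n (\<lambda>j. (-1) powi n * E1 j)"
      by (rule cmul.altsum_scale[OF vE1])
    also have "cmul.altsum n (\<lambda>j. (-1) powi n * E1 j) =
        cmul.altsum n (\<lambda>j. dual_mode (dual_mode f \<alpha> a (k1 + int j) p1) \<beta> b (k2 + n - int j) p2 v)"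
      unfolding E1_def using c1 c2 by (intro dual_mode_pair_expand[OF f b a]) auto
    finally have lhs: "f (altsum n S) =
       (-1) powi n * cmul.altsum n (\<lambda>j. dual_mode (dual_mode f \<alpha> a (k1 + int j) p1) \<beta> b (k2 + n - int j) p2 v)
       - cmul.altsum n (\<lambda>j. dual_mode (dual_mode f \<beta> b (k2 + int j) p2) \<alpha> a (k1 + n - int j) p1 v)" .
    have "altsum n S = (\<Sum>j<J. taylor j (\<lambda>k p. emode (Y a (n + int j) b) (k + k2) (p + p2) v) k1 p1)"
      unfolding S_def using J by (rule emode_borcherds)
    then have "f (altsum n S) = (\<Sum>j<J. f (taylor j (\<lambda>k p. emode (Y a (n + int j) b) (k + k2) (p + p2) v) k1 p1))"
      by (simp only: fs)
    also have "\<dots> = (\<Sum>j<J. - B k1 p1 k2 p2 j)"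
    proof (rule sum.cong[OF HOL.refl])
      fix j
      have "f (emode (Y a (n + int j) b) (k1 - int i + k2) (p1 - int (j - i) + p2) v) =
          - dual_mode f (\<alpha> + \<beta> - n - int j - 1) (Y a (n + int j) b) (k1 - int i + k2) (p1 - int (j - i) + p2) v"
        if "i \<le> j" for i
        using dual_mode_eq[OF f d[of j], of "k1 - int i + k2" "p1 - int (j - i) + p2" v] that c1 c2 by auto
      then show "f (taylor j (\<lambda>k p. emode (Y a (n + int j) b) (k + k2) (p + p2) v) k1 p1) = - B k1 p1 k2 p2 j"
        by (simp add: taylor_def B_def cmul.taylor_def fs sum_negf)
    qed
    finally have rhs: "f (altsum n S) = - (\<Sum>j<J. B k1 p1 k2 p2 j)" by (simp add: sum_negf)
    have "cmul.altsum n (G k1 p1 k2 p2) =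
        cmul.altsum n (\<lambda>j. dual_mode (dual_mode f \<beta> b (k2 + int j) p2) \<alpha> a (k1 + n - int j) p1 v)
       - (-1) powi n * cmul.altsum n (\<lambda>j. dual_mode (dual_mode f \<alpha> a (k1 + int j) p1) \<beta> b (k2 + n - int j) p2 v)"
      unfolding G_def using v1[of 1] v2[of 1] v2[of "(-1) powi n"]
      by (subst cmul.altsum_diff) (simp_all add: cmul.altsum_scale)
    also have "\<dots> = - f (altsum n S)" unfolding lhs by simp
    finally show ?thesis unfolding D_def rhs by simp
  qed
  have half: "D k1 p1 k2 p2 = 0" if c2: "k2 + p2 \<le> \<beta> - 2 - \<bar>n\<bar>" for k1 p1 k2 p2
  proof (rule pascal_zero_from_diagonal[OF D1, of k1 "\<alpha> - 2 - \<bar>n\<bar>"])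
    show "D k p k2 p2 = 0" if "k + p \<le> \<alpha> - 2 - \<bar>n\<bar>" for k p
      using that c2 by (rule core)
    \<comment> \<open>beyond any possible pole at \<open>x\<^sub>1 = 0\<close>\<close>
    fix k p assume k: "k \<ge> \<bar>\<alpha>\<bar> + \<bar>\<beta>\<bar> + \<bar>l\<bar> + \<bar>n\<bar> + \<bar>k2\<bar> + \<bar>\<beta> + l - k2\<bar> + 1 + \<bar>\<alpha>\<bar> + \<bar>l\<bar> + \<bar>\<beta>\<bar>"
    have "G k p k2 p2 j = 0" for j
    proof -
      have "dual_mode (dual_mode f \<beta> b (k2 + int j) p2) \<alpha> a (k + n - int j) p v = 0"
      proof (cases "k2 + int j \<ge> \<beta> + l")
        case True
        then show ?thesis by (simp add: dual_mode_zero_functional[OF f b])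
      next
        case False
        then show ?thesis using k by (intro dual_mode_zero[OF dual_mode_level_weak'[OF f b] a]) auto
      qed
      moreover have "dual_mode f \<alpha> a (k + int j) p = (\<lambda>v. 0)"
        using k by (intro dual_mode_zero_functional[OF f a]) auto
      ultimately show ?thesis by (simp add: G_def)
    qed
    moreover have "B k p k2 p2 j = 0" for j using k by (intro B_zero) auto
    ultimately show "D k p k2 p2 = 0" by (simp add: D_def cmul.altsum_all_zero)
  qed simp
  have "D k1 p1 k2 p2 = 0"
  proof (rule pascal_zero_from_diagonal[OF D2, of k2 "\<beta> - 2 - \<bar>n\<bar>"])
    show "D k1 p1 k p = 0" if "k + p \<le> \<beta> - 2 - \<bar>n\<bar>" for k p
      using that by (rule half)
    \<comment> \<open>beyond any possible pole at \<open>x\<^sub>2 = 0\<close>\<close>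
    fix k p assume k: "k \<ge> \<bar>\<alpha>\<bar> + \<bar>\<beta>\<bar> + \<bar>l\<bar> + \<bar>n\<bar> + \<bar>k1\<bar> + \<bar>\<alpha> + l - k1\<bar> + 1 + \<bar>\<alpha>\<bar> + \<bar>l\<bar> + \<bar>\<beta>\<bar>"
    have "G k1 p1 k p j = 0" for j
    proof -
      have "dual_mode (dual_mode f \<alpha> a (k1 + int j) p1) \<beta> b (k + n - int j) p v = 0"
      proof (cases "k1 + int j \<ge> \<alpha> + l")
        case True
        then show ?thesis by (simp add: dual_mode_zero_functional[OF f a])
      next
        case False
        then show ?thesis using k by (intro dual_mode_zero[OF dual_mode_level_weak'[OF f a] b]) auto
      qed
      moreover have "dual_mode f \<beta> b (k + int j) p = (\<lambda>v. 0)"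
        using k by (intro dual_mode_zero_functional[OF f b]) auto
      ultimately show ?thesis by (simp add: G_def)
    qed
    moreover have "B k1 p1 k p j = 0" for j using k by (intro B_zero) auto
    ultimately show "D k1 p1 k p = 0" by (simp add: D_def cmul.altsum_all_zero)
  qed simp
  then show ?thesis by (simp add: D_def G_def[abs_def] B_def)
qed

text \<open>
  In the Borcherds identity for \<open>a\<^bsub>(\<alpha>+n)\<^esub>\<close>, which kills \<open>f\<close>, only the products with \<open>a\<close> outermost
  survive. All but the first of them vanish by induction, because the inner mode is closer to the one
  that kills \<open>f\<close>. The modes of the products \<open>a\<^bsub>(j)\<^esub>b\<close> vanish on \<open>f\<close> by the pole bounds.
\<close>
lemma dual_mode_pair_zero:
  assumes f: "level n f" and a: "a \<in> W \<alpha>" and b: "b \<in> W \<beta>"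
  shows "k + m \<ge> \<alpha> + \<beta> + n - 1 \<Longrightarrow> dual_mode (dual_mode f \<beta> b m p2) \<alpha> a k p1 v = 0"
proof (induction "nat (\<beta> + n - m)" arbitrary: m k rule: less_induct)
  case less
  show ?case
  proof (cases "m \<ge> \<beta> + n")
    case True
    then show ?thesis by (simp add: dual_mode_zero_functional[OF f b])
  next
    case False
    \<comment> \<open>chosen so that the first term of the identity for \<open>a\<^bsub>(\<alpha>+n)\<^esub>\<close> and \<open>b\<^bsub>(m)\<^esub>\<close> is \<open>a\<^bsub>(k)\<^esub>b\<^bsub>(m)\<^esub>f\<close>\<close>
    define n' where "n' = k - (\<alpha> + n)"
    obtain J where J: "\<And>j. j \<ge> J \<Longrightarrow> Y a (n' + int j) b = 0"
      using Y_vanishes[of a n' b] by (auto simp: eventually_sequentially)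
    define G where "G j = dual_mode (dual_mode f \<beta> b (m + int j) p2) \<alpha> a (k - int j) p1 v" for j
    have second: "dual_mode f \<alpha> a (\<alpha> + n + int j) p1 = (\<lambda>v. 0)" for j
      by (rule dual_mode_zero_functional[OF f a]) simp
    have k: "\<alpha> + n + n' = k" by (simp add: n'_def)
    have "cmul.altsum n' G = (\<Sum>j<J. cmul.taylor j (\<lambda>k p. dual_mode f (\<alpha> + \<beta> - n' - int j - 1)
        (Y a (n' + int j) b) (k + m) (p + p2) v) (\<alpha> + n) p1)"
      using dual_mode_borcherds[OF f a b J, of J m p2 "\<alpha> + n" p1 v] by (simp add: second G_def[abs_def] k)
    also have "\<dots> = 0"
    proof (intro sum.neutral ballI)
      fix j
      have "dual_mode f (\<alpha> + \<beta> - n' - int j - 1) (Y a (n' + int j) b) (\<alpha> + n - int i + m) q v = 0" if "i \<le> j" for i q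
      proof (rule dual_mode_zero[OF f])
        show "Y a (n' + int j) b \<in> W (\<alpha> + \<beta> - n' - int j - 1)" by (rule Y_weight[OF a b]) simp
      qed (use less.prems that k in auto)
      then show "cmul.taylor j (\<lambda>k p. dual_mode f (\<alpha> + \<beta> - n' - int j - 1)
        (Y a (n' + int j) b) (k + m) (p + p2) v) (\<alpha> + n) p1 = 0"
        unfolding cmul.taylor_def by (intro sum.neutral ballI) simp
    qed
    finally have "cmul.altsum n' G = 0" .
    moreover have "G (Suc j) = 0" for j
      unfolding G_def using less.prems False by (intro less.hyps) auto
    moreover have "vanishes G"
      unfolding eventually_sequentially G_def
      by (rule exI[of _ "nat (\<beta> + n - m)"]) (auto simp: dual_mode_zero_functional[OF f b])
    ultimately have "G 0 = 0"
      by (metis (no_types, lifting) cmul.altsum_head add.right_neutral mult_zero_right sum.neutral)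
    then show ?thesis by (simp add: G_def)
  qed
qed

text \<open>
  A pole bound for \<open>b\<^bsub>(k)\<^esub>f\<close> is the vanishing of pairs of modes on \<open>f\<close>, by the residue theorem.
\<close>
proposition dual_mode_level:
  assumes f: "level n f" and b: "b \<in> W \<beta>" and m: "m = n + \<beta> - k - 1"
  shows "level m (dual_mode f \<beta> b k p)"
  unfolding level_def
proof (intro conjI allI impI)
  show "functional (dual_mode f \<beta> b k p)" by (rule dual_mode_functional[OF f b])
  fix \<alpha> a k' p' v assume a: "a \<in> W \<alpha>" and *: "k' \<ge> \<alpha> + m" "k' + p' \<le> \<alpha> - 2"
  have "dual_mode (dual_mode f \<beta> b k p) \<alpha> a k' p' v = 0"
    using * m by (intro dual_mode_pair_zero[OF f a b]) auto
  then show "dual_mode f \<beta> b k p (emode a k' p' v) = 0"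
    using dual_mode_eq[OF dual_mode_level_weak'[OF f b] a *(2)] by simp
qed

end

section \<open>The admissible module of functionals\<close>

lemmas fun_apply = plus_fun_apply zero_fun_apply minus_apply uminus_apply
\<comment> \<open>elements of the module are functions and must not be expanded pointwise\<close>
declare fun_apply [simp del]

context complex_vector_space begin

lemma binsum_sums:
  assumes "vanishes G"
  shows "\<exists>N. (\<forall>j\<ge>N. G j = 0) \<and> (\<forall>n. binsum n G = (\<Sum>j<N. scale (of_int n gchoose j) (G j)))
    \<and> (\<forall>n. altsum n G = (\<Sum>j<N. scale ((-1) ^ j * (of_int n gchoose j)) (G j)))"
proof -
  from assms obtain N where N: "\<And>j. j \<ge> N \<Longrightarrow> G j = 0"
    by (auto simp: eventually_sequentially)
  have "binsum n G = (\<Sum>j<N. scale (of_int n gchoose j) (G j))" for n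
    using N by (rule binsum_eq)
  moreover have "altsum n G = (\<Sum>j<N. scale ((-1) ^ j * (of_int n gchoose j)) (G j))" for n
    using N by (rule altsum_eq)
  ultimately show ?thesis using N by (intro exI[of _ N] conjI allI impI)
qed

end

context N_graded_vertex_algebra begin

lemma word_scale_vector_space: "complex_vector_space (word_scale :: complex \<Rightarrow> (('v \<times> int) list \<Rightarrow> complex) \<Rightarrow> _)"
proof (rule complex_vector_space.intro, rule vector_space.intro)
  fix a b :: complex and x y :: "('v \<times> int) list \<Rightarrow> complex"
  show "word_scale a (x + y) = word_scale a x + word_scale a y"
    by (rule ext) (simp only: word_scale_def plus_fun_apply distrib_left)
  show "word_scale (a + b) x = word_scale a x + word_scale b x"
    by (rule ext) (simp only: word_scale_def plus_fun_apply distrib_right)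
  show "word_scale a (word_scale b x) = word_scale (a * b) x"
    by (rule ext) (simp only: word_scale_def mult.assoc)
  show "word_scale 1 x = x"
    by (rule ext) (simp only: word_scale_def mult_1)
qed

interpretation ws: complex_vector_space "word_scale :: complex \<Rightarrow> (('v \<times> int) list \<Rightarrow> complex) \<Rightarrow> _"
  by (rule word_scale_vector_space)

definition component :: "nat \<Rightarrow> (('v \<times> int) list \<Rightarrow> complex) \<Rightarrow> 'v \<Rightarrow> complex" where
  "component n x v = x [(v, int n)]"

text \<open>
  A sequence of functionals, regarded as a function on words: its value at the one-letter word
  \<open>(v, n)\<close> is that of the \<open>n\<close>-th functional at \<open>v\<close>, and it is \<open>0\<close> on all other words. This
  embeds the graded space of functionals into the space that rationality ranges over.
\<close>
definition encode :: "(nat \<Rightarrow> 'v \<Rightarrow> complex) \<Rightarrow> ('v \<times> int) list \<Rightarrow> complex" where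
  "encode f w = (if length w = 1 \<and> snd (hd w) \<ge> 0 then f (nat (snd (hd w))) (fst (hd w)) else 0)"

lemma component_encode [simp]: "component n (encode f) = f n"
  by (simp add: component_def encode_def fun_eq_iff fun_apply)

lemma component_simps [simp]:
  "component n (x + y) = (\<lambda>v. component n x v + component n y v)" "component n (word_scale c x) = (\<lambda>v. c * component n x v)"
  "component n 0 = (\<lambda>v. 0)" "component n (x - y) = (\<lambda>v. component n x v - component n y v)"
  by (simp_all add: component_def fun_eq_iff fun_apply word_scale_def)

lemma component_sum: "component n (sum f S) v = (\<Sum>i\<in>S. component n (f i) v)"
  by (induction S rule: infinite_finite_induct) simp_all

text \<open>
  The external direct sum of the spaces of functionals of level \<open>n\<close>, for \<open>n = 0, 1, \<dots>\<close>. The sum is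
  external because these spaces are nested inside the dual of \<open>V\<close>.
\<close>
definition dual_module :: "(('v \<times> int) list \<Rightarrow> complex) set" where
  "dual_module = {x. (\<forall>n. level (int n) (component n x)) \<and> finite {n. component n x \<noteq> (\<lambda>v. 0)} \<and> encode (\<lambda>n. component n x) = x}"

lemma dual_module_level: "x \<in> dual_module \<Longrightarrow> level (int n) (component n x)"
  and dual_module_finite: "x \<in> dual_module \<Longrightarrow> finite {n. component n x \<noteq> (\<lambda>v. 0)}"
  by (simp_all add: dual_module_def)

lemma dual_module_eqI:
  assumes "x \<in> dual_module" "y \<in> dual_module" "\<And>n. component n x = component n y"
  shows "x = y"
proof -
  have "encode (\<lambda>n. component n x) = encode (\<lambda>n. component n y)" by (simp only: assms(3))
  then show ?thesis using assms(1,2) by (simp add: dual_module_def)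
qed

lemma dual_module_subspace: "ws.subspace dual_module"
  unfolding ws.subspace_def
proof (intro conjI ballI allI)
  show "0 \<in> dual_module" by (simp add: dual_module_def encode_def fun_eq_iff fun_apply)
next
  fix x y assume x: "x \<in> dual_module" and y: "y \<in> dual_module"
  have "{n. component n (x + y) \<noteq> (\<lambda>v. 0)} \<subseteq> {n. component n x \<noteq> (\<lambda>v. 0)} \<union> {n. component n y \<noteq> (\<lambda>v. 0)}" by auto
  then have "finite {n. component n (x + y) \<noteq> (\<lambda>v. 0)}"
    by (rule finite_subset) (use dual_module_finite[OF x] dual_module_finite[OF y] in simp)
  moreover have "encode (\<lambda>n. component n (x + y)) = encode (\<lambda>n. component n x) + encode (\<lambda>n. component n y)"
    by (simp add: encode_def fun_eq_iff fun_apply)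
  ultimately show "x + y \<in> dual_module"
    using x y by (simp add: dual_module_def level_add)
next
  fix c x assume x: "x \<in> dual_module"
  have "{n. component n (word_scale c x) \<noteq> (\<lambda>v. 0)} \<subseteq> {n. component n x \<noteq> (\<lambda>v. 0)}" by auto
  then have "finite {n. component n (word_scale c x) \<noteq> (\<lambda>v. 0)}"
    by (rule finite_subset) (rule dual_module_finite[OF x])
  moreover have "encode (\<lambda>n. component n (word_scale c x)) = word_scale c (encode (\<lambda>n. component n x))"
    by (auto simp: encode_def fun_eq_iff fun_apply word_scale_def component_def)
  ultimately show "word_scale c x \<in> dual_module"
    using x by (simp add: dual_module_def level_scale)
qed

lemmas dual_module_closed = ws.subspace_0[OF dual_module_subspace] ws.subspace_add[OF dual_module_subspace]
  ws.subspace_scale[OF dual_module_subspace] ws.subspace_diff[OF dual_module_subspace] ws.subspace_sum[OF dual_module_subspace]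

text \<open>
  The index is an integer because the degree \<open>z + deg a - k - 1\<close> of \<open>a\<^bsub>(k)\<^esub>f\<close> may be negative; then
  the functional is zero (\<open>level_negative\<close>) and so is its encoding.
\<close>
definition single :: "int \<Rightarrow> ('v \<Rightarrow> complex) \<Rightarrow> ('v \<times> int) list \<Rightarrow> complex" where
  "single z f = encode (\<lambda>n. if int n = z then f else (\<lambda>v. 0))"

lemma component_single: "component n (single z f) = (if int n = z then f else (\<lambda>v. 0))"
  by (simp add: single_def)

lemma single_mem: "level z f \<Longrightarrow> single z f \<in> dual_module"
proof -
  assume f: "level z f"
  have "{n. component n (single z f) \<noteq> (\<lambda>v. 0)} \<subseteq> {nat z}" by (auto simp: component_single split: if_splits)
  then have "finite {n. component n (single z f) \<noteq> (\<lambda>v. 0)}" by (rule finite_subset) simp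
  with f show ?thesis by (auto simp: dual_module_def component_single single_def)
qed

lemma single_zero [simp]: "single z (\<lambda>v. 0) = 0"
  by (simp add: single_def encode_def fun_eq_iff fun_apply)

lemma single_negative: "z < 0 \<Longrightarrow> single z f = 0"
  by (auto simp: single_def encode_def fun_eq_iff fun_apply)

lemma dual_module_induct [consumes 1, case_names single add]:
  assumes x: "x \<in> dual_module" and s: "\<And>n f. level (int n) f \<Longrightarrow> P (single (int n) f)"
    and add: "\<And>x y. x \<in> dual_module \<Longrightarrow> y \<in> dual_module \<Longrightarrow> P x \<Longrightarrow> P y \<Longrightarrow> P (x + y)"
  shows "P x"
proof -
  have "finite S \<Longrightarrow> (\<Sum>n\<in>S. single (int n) (component n x)) \<in> dual_module \<and> P (\<Sum>n\<in>S. single (int n) (component n x))" for S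
  proof (induction S rule: finite_induct)
    case empty
    have "P (single (int 0) (\<lambda>v. 0))" by (rule s) simp
    then show ?case by (simp add: dual_module_closed)
  next
    case (insert n S)
    then show ?case
      using single_mem[OF dual_module_level[OF x, of n]] s[OF dual_module_level[OF x, of n]] add by (simp add: dual_module_closed)
  qed
  from this[OF dual_module_finite[OF x]]
  have *: "(\<Sum>n | component n x \<noteq> (\<lambda>v. 0). single (int n) (component n x)) \<in> dual_module"
    "P (\<Sum>n | component n x \<noteq> (\<lambda>v. 0). single (int n) (component n x))" by simp_all
  have "x = (\<Sum>n | component n x \<noteq> (\<lambda>v. 0). single (int n) (component n x))"
  proof (rule dual_module_eqI[OF x *(1)])
    fix n
    have "component n (\<Sum>n | component n x \<noteq> (\<lambda>v. 0). single (int n) (component n x)) v = component n x v" for v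
    proof -
      have "component n (\<Sum>n | component n x \<noteq> (\<lambda>v. 0). single (int n) (component n x)) v =
          (\<Sum>m | component m x \<noteq> (\<lambda>v. 0). if m = n then component n x v else 0)"
        unfolding component_sum by (intro sum.cong HOL.refl) (simp add: component_single)
      also have "\<dots> = component n x v" using dual_module_finite[OF x] by (auto simp: sum.delta)
      finally show ?thesis .
    qed
    then show "component n x = component n (\<Sum>n | component n x \<noteq> (\<lambda>v. 0). single (int n) (component n x))" by auto
  qed
  with *(2) show ?thesis by simp
qed

text \<open>
  The component of degree \<open>i\<close> collects the contributions from degree \<open>n\<close> of the homogeneous part of
  \<open>a\<close> of weight \<open>i - n + k + 1\<close>; that weight is negative for the \<open>n\<close> left out.
\<close>
definition act :: "'v \<Rightarrow> int \<Rightarrow> (('v \<times> int) list \<Rightarrow> complex) \<Rightarrow> ('v \<times> int) list \<Rightarrow> complex" where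
  "act a k x = encode (\<lambda>i v. \<Sum>n\<le>nat (int i + k + 1).
     dual_mode (component n x) (int i - int n + k + 1) (wcomp (int i - int n + k + 1) a) k 0 v)"

lemma act_left:
  assumes x: "x \<in> dual_module"
  shows "act (a + b) k x = act a k x + act b k x" "act (c *s a) k x = word_scale c (act a k x)"
  unfolding act_def wcomp_add wcomp_scale
    dual_mode_left_linear(1)[OF dual_module_level[OF x] wcomp_mem wcomp_mem] dual_mode_left_linear(2)[OF dual_module_level[OF x] wcomp_mem wcomp_mem]
  by (simp_all add: encode_def fun_eq_iff fun_apply word_scale_def sum.distrib sum_distrib_left)

lemma act_add_right: "x \<in> dual_module \<Longrightarrow> y \<in> dual_module \<Longrightarrow> act a k (x + y) = act a k x + act a k y"
  unfolding act_def component_simps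
  by (simp add: dual_mode_functional_linear(1)[OF dual_module_level dual_module_level wcomp_mem] encode_def fun_eq_iff fun_apply sum.distrib)

lemma act_scale_right: "x \<in> dual_module \<Longrightarrow> act a k (word_scale c x) = word_scale c (act a k x)"
  unfolding act_def component_simps
  by (simp add: dual_mode_functional_linear(2)[OF dual_module_level dual_module_level wcomp_mem] encode_def fun_eq_iff word_scale_def sum_distrib_left)

lemma act_zero [simp]: "act a k 0 = 0"
  by (simp add: act_def encode_def fun_eq_iff fun_apply)

lemma act_zero_left: "x \<in> dual_module \<Longrightarrow> act 0 k x = 0"
  using act_left(2)[of x 0 0 k] by simp

lemma act_single:
  assumes f: "level z f" and a: "a \<in> W \<alpha>"
  shows "act a k (single z f) = single (z + \<alpha> - k - 1) (dual_mode f \<alpha> a k 0)"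
proof (cases "z < 0")
  case True
  then show ?thesis by (simp add: level_negative[OF f] single_negative)
next
  case z: False
  have zero: "dual_mode f w 0 k 0 v = 0" for w v
    using dual_mode_left_linear(2)[OF f W_closed(1) W_closed(1), of w 0 k 0 v] by simp
  have "(\<Sum>n\<le>nat (int i + k + 1). dual_mode (component n (single z f)) (int i - int n + k + 1)
        (wcomp (int i - int n + k + 1) a) k 0 v) =
      (if int i = z + \<alpha> - k - 1 then dual_mode f \<alpha> a k 0 v else 0)" for i v
  proof -
    have "(\<Sum>n\<le>nat (int i + k + 1). dual_mode (component n (single z f)) (int i - int n + k + 1)
          (wcomp (int i - int n + k + 1) a) k 0 v) =
        (\<Sum>n\<le>nat (int i + k + 1). if n = nat z then
          (if int i = z + \<alpha> - k - 1 then dual_mode f \<alpha> a k 0 v else 0) else 0)"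
      using z zero by (intro sum.cong HOL.refl) (auto simp: component_single wcomp_of_mem[OF a])
    also have "\<dots> = (if int i = z + \<alpha> - k - 1 then dual_mode f \<alpha> a k 0 v else 0)"
      using z zero W_negative[OF a] by (cases "\<alpha> < 0") auto
    finally show ?thesis .
  qed
  then show ?thesis
    unfolding act_def single_def by (intro arg_cong[of _ _ encode] ext) (simp add: single_def[symmetric])
qed

lemma act_closed: "x \<in> dual_module \<Longrightarrow> act a k x \<in> dual_module"
proof (induction x rule: dual_module_induct)
  case (single n f)
  show ?case
  proof (induction a rule: homogeneous_induct)
    case (homogeneous \<alpha> a)
    show ?case unfolding act_single[OF single homogeneous]
      by (rule single_mem[OF dual_mode_level[OF single homogeneous]]) simp
  next
    case (add a b)
    then show ?case by (simp add: act_left[OF single_mem[OF single]] dual_module_closed)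
  qed
qed (simp add: act_add_right dual_module_closed)

lemma act_truncation: "x \<in> dual_module \<Longrightarrow> \<exists>N. \<forall>k\<ge>N. act a k x = 0"
proof (induction x rule: dual_module_induct)
  case (single n f)
  show ?case
  proof (induction a rule: homogeneous_induct)
    case (homogeneous \<alpha> a)
    show ?case
      by (rule exI[of _ "\<alpha> + int n"]) (auto simp: act_single[OF single homogeneous] dual_mode_zero_functional[OF single homogeneous])
  next
    case (add a b)
    then obtain N M where "\<forall>k\<ge>N. act a k (single (int n) f) = 0" "\<forall>k\<ge>M. act b k (single (int n) f) = 0" by blast
    then show ?case by (intro exI[of _ "max N M"]) (simp add: act_left[OF single_mem[OF single]])
  qed
next
  case (add x y)
  then obtain N M where "\<forall>k\<ge>N. act a k x = 0" "\<forall>k\<ge>M. act a k y = 0" by blast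
  then show ?case by (intro exI[of _ "max N M"]) (simp add: act_add_right[OF add.hyps])
qed

lemma act_vanishes: "x \<in> dual_module \<Longrightarrow> vanishes (\<lambda>j. act a (k + int j) x)"
proof -
  assume "x \<in> dual_module"
  then obtain N where N: "\<forall>k\<ge>N. act a k x = 0" using act_truncation by blast
  show ?thesis unfolding eventually_sequentially
    by (rule exI[of _ "nat (N - k)"]) (use N in auto)
qed

lemma act_vac: "x \<in> dual_module \<Longrightarrow> act vac k x = (if k = -1 then x else 0)"
proof (induction x rule: dual_module_induct)
  case (single n f)
  have "dual_mode f 0 vac k 0 = (if k = -1 then f else (\<lambda>v. 0))"
    by (rule ext) (simp add: dual_mode_vac[OF single])
  then show ?case by (simp add: act_single[OF single vac_weight])
qed (simp add: act_add_right)

lemma single_binsum: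
  assumes "\<And>v. vanishes (\<lambda>j. g j v)" "vanishes (\<lambda>j. single z (g j))"
  shows "ws.binsum n (\<lambda>j. single z (g j)) = single z (\<lambda>v. cmul.binsum n (\<lambda>j. g j v))"
    and "ws.altsum n (\<lambda>j. single z (g j)) = single z (\<lambda>v. cmul.altsum n (\<lambda>j. g j v))"
proof -
  obtain N where N3: "\<forall>j\<ge>N. single z (g j) = 0"
    and N1: "\<forall>n. ws.binsum n (\<lambda>j. single z (g j)) = (\<Sum>j<N. word_scale (of_int n gchoose j) (single z (g j)))"
    and N2: "\<forall>n. ws.altsum n (\<lambda>j. single z (g j)) = (\<Sum>j<N. word_scale ((-1) ^ j * (of_int n gchoose j)) (single z (g j)))"
    using ws.binsum_sums[OF assms(2)] by (elim exE conjE)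
  have ev: "(\<Sum>j<N. word_scale (c j) (single z (g j))) w = (\<Sum>j<N. c j * single z (g j) w)" for c w
    by (induction N) (simp_all add: word_scale_def fun_apply)
  have z: "g j v = 0" if "z \<ge> 0" "j \<ge> N" for j v
  proof -
    have "component (nat z) (single z (g j)) = (\<lambda>v. 0)" using N3 that(2) by simp
    then show ?thesis using that(1) by (simp add: component_single fun_eq_iff fun_apply)
  qed
  show "ws.binsum n (\<lambda>j. single z (g j)) = single z (\<lambda>v. cmul.binsum n (\<lambda>j. g j v))"
  proof
    fix w
    show "ws.binsum n (\<lambda>j. single z (g j)) w = single z (\<lambda>v. cmul.binsum n (\<lambda>j. g j v)) w"
      unfolding N1[rule_format] ev using cmul.binsum_eq[of N "\<lambda>j. g j (fst (hd w))" n] z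
      by (auto simp: single_def encode_def)
  qed
  show "ws.altsum n (\<lambda>j. single z (g j)) = single z (\<lambda>v. cmul.altsum n (\<lambda>j. g j v))"
  proof
    fix w
    show "ws.altsum n (\<lambda>j. single z (g j)) w = single z (\<lambda>v. cmul.altsum n (\<lambda>j. g j v)) w"
      unfolding N2[rule_format] ev using cmul.altsum_eq[of N "\<lambda>j. g j (fst (hd w))" n] z
      by (auto simp: single_def encode_def)
  qed
qed

lemma single_diff_scale: "single z f - word_scale c (single z g) = single z (\<lambda>v. f v - c * g v)"
  by (simp add: single_def encode_def fun_eq_iff fun_apply word_scale_def)

definition borcherds_left :: "int \<Rightarrow> int \<Rightarrow> int \<Rightarrow> 'v \<Rightarrow> 'v \<Rightarrow> (('v \<times> int) list \<Rightarrow> complex) \<Rightarrow> nat \<Rightarrow> ('v \<times> int) list \<Rightarrow> complex" where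
  "borcherds_left m n k a b x j = act (Y a (n + int j) b) (m + k - int j) x"

definition borcherds_right :: "int \<Rightarrow> int \<Rightarrow> int \<Rightarrow> 'v \<Rightarrow> 'v \<Rightarrow> (('v \<times> int) list \<Rightarrow> complex) \<Rightarrow> nat \<Rightarrow> ('v \<times> int) list \<Rightarrow> complex" where
  "borcherds_right m n k a b x j = act a (m + n - int j) (act b (k + int j) x)
     - word_scale ((-1) powi n) (act b (n + k - int j) (act a (m + int j) x))"

text \<open>
  For a vector in one degree, all terms on both sides lie in one common degree \<open>z\<close>, and there the identity is
  the one for modes acting on functionals at \<open>p1 = p2 = 0\<close>.
\<close>
lemma act_borcherds_homogeneous:
  assumes f: "level (int l) f" and a: "a \<in> W \<alpha>" and b: "b \<in> W \<beta>"
  shows "ws.binsum m (borcherds_left m n k a b (single (int l) f)) = ws.altsum n (borcherds_right m n k a b (single (int l) f))"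
proof -
  let ?x = "single (int l) f"
  define z where "z = int l + \<alpha> + \<beta> - n - m - k - 2"
  obtain J where J: "\<And>j. j \<ge> J \<Longrightarrow> Y a (n + int j) b = 0"
    using Y_vanishes[of a n b] by (auto simp: eventually_sequentially)
  have x: "?x \<in> dual_module" by (rule single_mem[OF f])
  have d: "Y a (n + int j) b \<in> W (\<alpha> + \<beta> - n - int j - 1)" for j by (rule Y_weight[OF a b]) simp
  define g where "g j = dual_mode f (\<alpha> + \<beta> - n - int j - 1) (Y a (n + int j) b) (m + k - int j) 0" for j
  have zero: "dual_mode f w 0 k' 0 v = 0" for w k' v
    using dual_mode_left_linear(2)[OF f W_closed(1) W_closed(1), of w 0 k' 0 v] by simp
  have lhs: "act (Y a (n + int j) b) (m + k - int j) ?x = single z (g j)" for j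
    unfolding act_single[OF f d] g_def z_def by (simp add: algebra_simps)
  define h where "h j v = dual_mode (dual_mode f \<beta> b (k + int j) 0) \<alpha> a (m + n - int j) 0 v
      - (-1) powi n * dual_mode (dual_mode f \<alpha> a (m + int j) 0) \<beta> b (n + k - int j) 0 v" for j v
  have rhs: "act a (m + n - int j) (act b (k + int j) ?x)
       - word_scale ((-1) powi n) (act b (n + k - int j) (act a (m + int j) ?x)) = single z (h j)" for j
  proof -
    have "act a (m + n - int j) (act b (k + int j) ?x) = single z (dual_mode (dual_mode f \<beta> b (k + int j) 0) \<alpha> a (m + n - int j) 0)"
      unfolding act_single[OF f b] act_single[OF dual_mode_level[OF f b HOL.refl] a]
      by (rule arg_cong[of _ _ "\<lambda>z. single z _"]) (simp add: z_def)
    moreover have "act b (n + k - int j) (act a (m + int j) ?x) = single z (dual_mode (dual_mode f \<alpha> a (m + int j) 0) \<beta> b (n + k - int j) 0)"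
      unfolding act_single[OF f a] act_single[OF dual_mode_level[OF f a HOL.refl] b]
      by (rule arg_cong[of _ _ "\<lambda>z. single z _"]) (simp add: z_def)
    ultimately show ?thesis unfolding h_def by (simp only: single_diff_scale)
  qed
  have vg: "vanishes (\<lambda>j. g j v)" for v
    unfolding eventually_sequentially by (rule exI[of _ J]) (auto simp: g_def J zero)
  have vg': "vanishes (\<lambda>j. single z (g j))"
    unfolding lhs[symmetric] eventually_sequentially by (rule exI[of _ J]) (auto simp: J act_zero_left[OF x])
  have vh: "vanishes (\<lambda>j. h j v)" for v
    unfolding eventually_sequentially
    by (rule exI[of _ "nat (\<bar>\<beta> + int l - k\<bar> + \<bar>\<alpha> + int l - m\<bar>)"])
       (auto simp: h_def dual_mode_zero_functional[OF f a] dual_mode_zero_functional[OF f b])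
  have vh': "vanishes (\<lambda>j. single z (h j))"
    unfolding rhs[symmetric] using eventually_conj[OF act_vanishes[OF x, of b k] act_vanishes[OF x, of a m]]
    by (rule eventually_mono) simp
  have "cmul.binsum m (\<lambda>j. g j v) = cmul.altsum n (\<lambda>j. h j v)" for v
  proof -
    have "cmul.altsum n (\<lambda>j. h j v) = (\<Sum>j<J. (of_int m gchoose j) * dual_mode f (\<alpha> + \<beta> - n - int j - 1) (Y a (n + int j) b) (m - int j + k) 0 v)"
      using dual_mode_borcherds[OF f a b J, of J k 0 m 0 v] by (simp add: h_def add.commute)
    also have "\<dots> = cmul.binsum m (\<lambda>j. g j v)"
      by (subst cmul.binsum_eq[of J]) (auto simp: g_def J zero algebra_simps)
    finally show ?thesis by simp
  qed
  then show ?thesis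
    unfolding borcherds_left_def borcherds_right_def lhs rhs single_binsum(1)[OF vg vg'] single_binsum(2)[OF vh vh'] by simp
qed

lemma borcherds_sides_vanish:
  assumes x: "x \<in> dual_module"
  shows "vanishes (borcherds_left m n k a b x)" "vanishes (borcherds_right m n k a b x)"
proof -
  show "vanishes (borcherds_left m n k a b x)"
    using Y_vanishes[of a n b] unfolding borcherds_left_def
    by (rule eventually_mono) (simp add: act_zero_left[OF x])
  show "vanishes (borcherds_right m n k a b x)"
    using eventually_conj[OF act_vanishes[OF x, of b k] act_vanishes[OF x, of a m]]
    unfolding borcherds_right_def by (rule eventually_mono) simp
qed

lemma borcherds_sides_add:
  assumes x: "x \<in> dual_module" and y: "y \<in> dual_module"
  shows "borcherds_left m n k (a + a') b x = (\<lambda>j. borcherds_left m n k a b x j + borcherds_left m n k a' b x j)"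
    "borcherds_left m n k a (b + b') x = (\<lambda>j. borcherds_left m n k a b x j + borcherds_left m n k a b' x j)"
    "borcherds_left m n k a b (x + y) = (\<lambda>j. borcherds_left m n k a b x j + borcherds_left m n k a b y j)"
    "borcherds_right m n k (a + a') b x = (\<lambda>j. borcherds_right m n k a b x j + borcherds_right m n k a' b x j)"
    "borcherds_right m n k a (b + b') x = (\<lambda>j. borcherds_right m n k a b x j + borcherds_right m n k a b' x j)"
    "borcherds_right m n k a b (x + y) = (\<lambda>j. borcherds_right m n k a b x j + borcherds_right m n k a b y j)"
  unfolding borcherds_left_def borcherds_right_def
  by (simp_all add: act_left act_add_right act_closed x y ws.scale_right_distrib add_diff_add)

lemma act_borcherds:
  assumes "x \<in> dual_module"
  shows "ws.binsum m (borcherds_left m n k a b x) = ws.altsum n (borcherds_right m n k a b x)"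
  using assms
proof (induction x rule: dual_module_induct)
  case (single l f)
  note x = single_mem[OF single]
  note additive = borcherds_sides_add[OF x x] ws.binsum_add[OF borcherds_sides_vanish(1)[OF x] borcherds_sides_vanish(1)[OF x]]
    ws.altsum_add[OF borcherds_sides_vanish(2)[OF x] borcherds_sides_vanish(2)[OF x]]
  show ?case
  proof (induction a rule: homogeneous_induct)
    case a: (homogeneous \<alpha> a)
    show ?case
    proof (induction b rule: homogeneous_induct)
      case (homogeneous \<beta> b)
      show ?case by (rule act_borcherds_homogeneous[OF single a homogeneous])
    next
      case (add b b')
      then show ?case by (simp only: additive)
    qed
  next
    case (add a a')
    then show ?case by (simp only: additive)
  qed
next
  case (add x y)
  note xy = add.hyps
  show ?case
    using add.IH
    by (simp only: borcherds_sides_add(3,6)[OF xy] ws.binsum_add[OF borcherds_sides_vanish(1)[OF xy(1)] borcherds_sides_vanish(1)[OF xy(2)]]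
        ws.altsum_add[OF borcherds_sides_vanish(2)[OF xy(1)] borcherds_sides_vanish(2)[OF xy(2)]])
qed

lemma dual_module_weak_module: "weak_module word_scale dual_module act"
proof -
  have "borcherds_identity Y word_scale dual_module act"
    unfolding borcherds_identity_def
  proof (intro allI ballI)
    fix a b m n k and x :: "('v \<times> int) list \<Rightarrow> complex" assume "x \<in> dual_module"
    from act_borcherds[OF this, of m n k a b]
    show "(\<Sum>j. word_scale (of_int m gchoose j) (act (Y a (n + int j) b) (m + k - int j) x)) =
      (\<Sum>j. word_scale ((-1) ^ j * (of_int n gchoose j))
        (act a (m + n - int j) (act b (k + int j) x)
         - word_scale ((-1) powi n) (act b (n + k - int j) (act a (m + int j) x))))"
      unfolding borcherds_left_def borcherds_right_def ws.altsum_def ws.binsum_def by (simp add: mult.commute)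
  qed
  then show ?thesis
    unfolding weak_module_def
    by (intro conjI ws.vector_space_axioms dual_module_subspace)
       (simp_all add: act_closed act_left act_add_right act_scale_right act_truncation act_vac)
qed

definition dual_grade :: "nat \<Rightarrow> (('v \<times> int) list \<Rightarrow> complex) set" where
  "dual_grade n = {single (int n) f | f. level (int n) f}"

lemma dual_gradeI: "level (int n) f \<Longrightarrow> single (int n) f \<in> dual_grade n"
  by (auto simp: dual_grade_def)

lemma dual_grade_iff: "x \<in> dual_grade n \<longleftrightarrow> x \<in> dual_module \<and> (\<forall>m. m \<noteq> n \<longrightarrow> component m x = (\<lambda>v. 0))"
proof
  assume "x \<in> dual_grade n"
  then show "x \<in> dual_module \<and> (\<forall>m. m \<noteq> n \<longrightarrow> component m x = (\<lambda>v. 0))"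
    by (auto simp: dual_grade_def single_mem component_single)
next
  assume x: "x \<in> dual_module \<and> (\<forall>m. m \<noteq> n \<longrightarrow> component m x = (\<lambda>v. 0))"
  then have "x = single (int n) (component n x)"
    by (intro dual_module_eqI single_mem) (auto simp: component_single dual_module_level)
  then show "x \<in> dual_grade n" using x dual_module_level by (metis dual_gradeI)
qed

lemma dual_grade_subspace: "ws.subspace (dual_grade n)"
  unfolding ws.subspace_def by (simp add: dual_grade_iff dual_module_closed)

lemma dual_module_direct_sum: "internal_direct_sum dual_module dual_grade UNIV"
  unfolding internal_direct_sum_def
proof (intro conjI ballI)
  fix i :: nat show "dual_grade i \<subseteq> dual_module" by (auto simp: dual_grade_iff)
next
  fix x assume x: "x \<in> dual_module"
  let ?P = "\<lambda>f. (\<forall>i\<in>UNIV. f i \<in> dual_grade i) \<and> (\<forall>i. i \<notin> UNIV \<longrightarrow> f i = 0) \<and> finite {i. f i \<noteq> 0} \<and> x = (\<Sum>i | f i \<noteq> 0. f i)"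
  have sum_comp: "component n (\<Sum>i | f i \<noteq> 0. f i) = component n (f n)" if f: "\<And>i. f i \<in> dual_grade i" "finite {i. f i \<noteq> 0}" for f n
  proof
    fix v
    have "component n (\<Sum>i | f i \<noteq> 0. f i) v = (\<Sum>i | f i \<noteq> 0. if i = n then component n (f n) v else 0)"
      unfolding component_sum using f(1) by (intro sum.cong HOL.refl) (auto simp: dual_grade_iff)
    also have "\<dots> = component n (f n) v" using f(2) by (auto simp: sum.delta)
    finally show "component n (\<Sum>i | f i \<noteq> 0. f i) v = component n (f n) v" .
  qed
  show "\<exists>!f. ?P f"
  proof (rule ex1I[of _ "\<lambda>n. single (int n) (component n x)"])
    have g: "single (int n) (component n x) \<in> dual_grade n" for n by (rule dual_gradeI[OF dual_module_level[OF x]])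
    have "{n. single (int n) (component n x) \<noteq> 0} \<subseteq> {n. component n x \<noteq> (\<lambda>v. 0)}" by auto
    then have fin: "finite {n. single (int n) (component n x) \<noteq> 0}" by (rule finite_subset) (rule dual_module_finite[OF x])
    have "x = (\<Sum>i | single (int i) (component i x) \<noteq> 0. single (int i) (component i x))"
    proof (rule dual_module_eqI[OF x])
      show "(\<Sum>i | single (int i) (component i x) \<noteq> 0. single (int i) (component i x)) \<in> dual_module"
        using g by (intro dual_module_closed) (auto simp: dual_grade_iff)
      show "component n x = component n (\<Sum>i | single (int i) (component i x) \<noteq> 0. single (int i) (component i x))" for n
        using sum_comp[OF g fin, of n] by (simp add: component_single)
    qed
    with g fin show "?P (\<lambda>n. single (int n) (component n x))" by simp
  next
    fix f assume f: "?P f"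
    show "f = (\<lambda>n. single (int n) (component n x))"
    proof
      fix n
      have c: "component n x = component n (f n)" using sum_comp[of f n] f by auto
      show "f n = single (int n) (component n x)"
      proof (rule dual_module_eqI)
        show "f n \<in> dual_module" using f by (auto simp: dual_grade_iff)
        show "single (int n) (component n x) \<in> dual_module" by (rule single_mem[OF dual_module_level[OF x]])
        show "component m (f n) = component m (single (int n) (component n x))" for m
          using f c by (auto simp: component_single dual_grade_iff)
      qed
    qed
  qed
qed

theorem dual_module_admissible: "admissible_module word_scale dual_module act dual_grade"
  unfolding admissible_module_def
proof (intro conjI allI ballI dual_module_weak_module dual_module_direct_sum dual_grade_subspace)
  fix d k n a x assume a: "a \<in> weight_space d" and x: "x \<in> dual_grade n"
  from x obtain f where f: "level (int n) f" "x = single (int n) f" by (auto simp: dual_grade_def)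
  show "act a k x \<in> {0} \<union> (\<Union>m\<in>{m. of_nat m = of_nat n + d - of_int k - 1}. dual_grade m)"
  proof (cases "a = 0")
    case True
    then show ?thesis using act_zero_left single_mem[OF f(1)] f(2) by simp
  next
    case False
    then have "d \<in> \<nat>" using a N_graded by (auto simp: N_graded_def weight_space_def)
    then obtain \<alpha> where \<alpha>: "d = of_nat \<alpha>" by (auto simp: Nats_def)
    then have a': "a \<in> W (int \<alpha>)" using a by (simp add: W_def)
    let ?z = "int n + int \<alpha> - k - 1"
    have act: "act a k x = single ?z (dual_mode f (int \<alpha>) a k 0)" unfolding f(2) by (rule act_single[OF f(1) a'])
    show ?thesis
    proof (cases "?z < 0")
      case True
      then show ?thesis unfolding act by (simp add: single_negative)
    next
      case False
      define m where "m = nat ?z"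
      have m: "int m = ?z" using False by (simp add: m_def)
      have "(of_nat m :: complex) = of_int (int m)" by simp
      also have "\<dots> = of_nat n + d - of_int k - 1" unfolding m \<alpha> by simp
      finally have "of_nat m = of_nat n + d - of_int k - 1" .
      moreover have "act a k x \<in> dual_grade m"
        unfolding act m[symmetric] by (rule dual_gradeI, rule dual_mode_level[OF f(1) a']) (simp add: m)
      ultimately show ?thesis by blast
    qed
  qed
qed

end

section \<open>Contradiction with holomorphy\<close>

lemma internal_direct_sum_obtain:
  assumes "internal_direct_sum M N I" "x \<in> M"
  shows "\<exists>f. (\<forall>i\<in>I. f i \<in> N i) \<and> (\<forall>i. i \<notin> I \<longrightarrow> f i = 0) \<and> finite {i. f i \<noteq> 0} \<and> x = (\<Sum>i | f i \<noteq> 0. f i)"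
proof (rule ex1_implies_ex)
  show "\<exists>!f. (\<forall>i\<in>I. f i \<in> N i) \<and> (\<forall>i. i \<notin> I \<longrightarrow> f i = 0) \<and> finite {i. f i \<noteq> 0} \<and> x = (\<Sum>i | f i \<noteq> 0. f i)"
    using assms unfolding internal_direct_sum_def by (elim conjE) (rule bspec)
qed

context vertex_algebra begin

text \<open>
  Choose \<open>K\<close> with \<open>a\<^bsub>(k)\<^esub>w = 0\<close> for \<open>k \<ge> K\<close>. The Borcherds identity with \<open>m = K\<close> then expresses
  \<open>a\<^bsub>(k)\<^esub>b\<^bsub>(m)\<^esub>w\<close> through single modes applied to \<open>w\<close> and products with a larger index on
  \<open>b\<close>. The latter are covered by induction, as \<open>b\<^bsub>(m)\<^esub>w = 0\<close> for large \<open>m\<close>.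
\<close>
lemma mode_span_submodule:
  "Y a k u \<in> span {Y c s w | c s. True}" if "u \<in> span {Y c s w | c s. True}"
proof -
  let ?N = "span {Y c s w | c s. True}"
  have base: "Y a k (Y b m w) \<in> ?N" for a k b m
  proof -
    obtain M where M: "\<forall>m\<ge>M. Y b m w = 0" using Y_truncation by blast
    obtain K where K: "\<forall>k\<ge>K. Y a k w = 0" using Y_truncation by blast
    show ?thesis
    proof (induction "nat (M - m)" arbitrary: m k rule: less_induct)
      case less
      show ?case
      proof (cases "m \<ge> M")
        case True
        then show ?thesis using M by (simp add: span_zero)
      next
        case False
        define n where "n = k - K"
        define G where "G j = Y a (K + n - int j) (Y b (m + int j) w)
            - (-1) powi n *s Y b (n + m - int j) (Y a (K + int j) w)" for j
        have G: "G j = Y a (k - int j) (Y b (m + int j) w)" for j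
          using K by (simp add: G_def n_def)
        have "vanishes (\<lambda>j. Y (Y a (n + int j) b) (K + m - int j) w)"
          using Y_vanishes[of a n b] by (rule eventually_mono) simp
        then have "altsum n G \<in> ?N"
          unfolding G_def borcherds[symmetric]
          by (intro binsum_subspace subspace_span span_base) auto
        moreover have "altsum n G - G 0 \<in> ?N"
        proof (rule altsum_subspace_head[OF subspace_span])
          show "G (Suc j) \<in> ?N" for j
            unfolding G using False by (intro less) auto
          show "vanishes G"
            unfolding G using Y_vanishes[of b m w] by (rule eventually_mono) simp
        qed
        ultimately have "altsum n G - (altsum n G - G 0) \<in> ?N" by (rule span_diff)
        then show ?thesis by (simp add: G)
      qed
    qed
  qed
  from that show ?thesis
  proof (induction rule: span_induct_alt)
    case base
    then show ?case by (simp add: span_zero)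
  next
    case (step c x y)
    then show ?case using base by (auto intro!: span_add span_scale)
  qed
qed

end

context N_graded_vertex_algebra begin

text \<open>
  The homogeneous components of \<open>v\<close> are again killed. The submodule generated by one of positive weight
  would have no part of weight \<open>0\<close>, so it would not contain the vacuum, against simplicity.
\<close>
lemma lowest_weight_vector_vacuum:
  assumes simple: "simple_admissible_module scale UNIV Y (\<lambda>n. weight_space (of_nat n))"
    and cft: "weight_space 0 = span {vac}"
    and v: "\<And>\<beta> b k. b \<in> W \<beta> \<Longrightarrow> k \<ge> \<beta> \<Longrightarrow> Y b k v = 0"
  shows "v \<in> span {vac}"
proof -
  have Wn: "W (int n) = weight_space (of_nat n)" for n by (simp add: W_def)
  have adm: "admissible_module scale UNIV Y (\<lambda>n. weight_space (of_nat n))"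
    using simple by (simp add: simple_admissible_module_def)
  have zero: "wcomp (int n) v = 0" if n: "n > 0" for n
  proof (rule ccontr)
    define w where "w = wcomp (int n) v"
    assume "wcomp (int n) v \<noteq> 0"
    then have w: "w \<noteq> 0" "w \<in> W (int n)" by (simp_all add: w_def)
    have low: "Y b k w = 0" if b: "b \<in> W \<beta>" "k \<ge> \<beta>" for b \<beta> k
    proof -
      have "wcomp (\<beta> + int n - k - 1) (Y b k v) = Y b k w"
        unfolding wcomp_Y[OF b(1)] by (simp add: w_def)
      then show ?thesis using v[OF b] by simp
    qed
    let ?N = "span {Y c s w | c s. True}"
    have hom: "Y c s w = (\<Sum>i<M. Y (wcomp (int i) c) s w)" if "c = (\<Sum>i<M. wcomp (int i) c)" for c s M
      by (subst that) simp
    have comp_mem: "wcomp z (Y c s w) \<in> ?N" for c s z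
    proof -
      obtain M where M: "c = (\<Sum>i<M. wcomp (int i) c)" using wcomp_sum[of c] by blast
      have "wcomp z (Y (wcomp (int i) c) s w) \<in> ?N" for i
      proof -
        have "Y (wcomp (int i) c) s w \<in> W (int i + int n - s - 1)" by (rule Y_weight[OF wcomp_mem w(2)]) simp
        moreover have "Y (wcomp (int i) c) s w \<in> ?N" by (rule span_base) blast
        ultimately show ?thesis by (simp add: wcomp_of_mem span_zero)
      qed
      then show ?thesis unfolding hom[OF M] wcomp_sum' by (intro span_sum)
    qed
    have comp_zero: "wcomp 0 (Y c s w) = 0" for c s
    proof -
      obtain M where M: "c = (\<Sum>i<M. wcomp (int i) c)" using wcomp_sum[of c] by blast
      have "wcomp 0 (Y (wcomp (int i) c) s w) = 0" for i
      proof (cases "s \<ge> int i")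
        case True
        then show ?thesis using low[OF wcomp_mem] by simp
      next
        case False
        have "Y (wcomp (int i) c) s w \<in> W (int i + int n - s - 1)" by (rule Y_weight[OF wcomp_mem w(2)]) simp
        then show ?thesis using False n by (simp add: wcomp_of_mem)
      qed
      then show ?thesis unfolding hom[OF M] wcomp_sum' by simp
    qed
    have N_comp: "wcomp z u \<in> ?N" if "u \<in> ?N" for u z
      using that
    proof (induction rule: span_induct_alt)
      case base
      show ?case by (simp add: span_zero)
    next
      case (step c x y)
      then obtain c' s where "x = Y c' s w" by blast
      then have "wcomp z x \<in> ?N" by (simp only: comp_mem)
      then show ?case
        unfolding wcomp_add wcomp_scale using step.IH by (intro span_add span_scale)
    qed
    have N_zero: "wcomp 0 u = 0" if "u \<in> ?N" for u
      using that by (induction rule: span_induct_alt) (auto simp: comp_zero)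
    have wN: "w \<in> ?N"
    proof -
      have "Y vac (-1) w \<in> ?N" by (rule span_base) blast
      then show ?thesis by (simp add: Y_vac_left)
    qed
    have weak: "weak_module scale UNIV Y" using adm by (simp add: admissible_module_def)
    have "weak_module scale ?N Y"
      using weak mode_span_submodule[of _ w] subspace_span
      unfolding weak_module_def borcherds_identity_def by auto
    moreover have "internal_direct_sum ?N (\<lambda>n. ?N \<inter> weight_space (of_nat n)) UNIV"
      unfolding internal_direct_sum_def
    proof (intro conjI ballI)
      fix i :: nat show "?N \<inter> weight_space (of_nat i) \<subseteq> ?N" by blast
    next
      fix u assume u: "u \<in> ?N"
      have iff: "((\<forall>i\<in>UNIV. f i \<in> ?N \<inter> weight_space (of_nat i)) \<and> (\<forall>i. i \<notin> UNIV \<longrightarrow> f i = 0)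
          \<and> finite {i. f i \<noteq> 0} \<and> u = (\<Sum>i | f i \<noteq> 0. f i)) \<longleftrightarrow> decomposes u f" for f
      proof
        assume d: "decomposes u f"
        then have "f i \<in> ?N" for i using N_comp[OF u, of "int i"] wcomp_eqI[OF d, of i] by simp
        with d show "(\<forall>i\<in>UNIV. f i \<in> ?N \<inter> weight_space (of_nat i)) \<and> (\<forall>i. i \<notin> UNIV \<longrightarrow> f i = 0)
          \<and> finite {i. f i \<noteq> 0} \<and> u = (\<Sum>i | f i \<noteq> 0. f i)"
          by (simp add: decomposes_def Wn)
      qed (auto simp: decomposes_def Wn)
      show "\<exists>!f. (\<forall>i\<in>UNIV. f i \<in> ?N \<inter> weight_space (of_nat i)) \<and> (\<forall>i. i \<notin> UNIV \<longrightarrow> f i = 0)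
          \<and> finite {i. f i \<noteq> 0} \<and> u = (\<Sum>i | f i \<noteq> 0. f i)"
        unfolding iff by (rule decomposes_unique)
    qed
    moreover have "\<forall>n. subspace (?N \<inter> weight_space (of_nat n))"
      using subspace_inter[OF subspace_span W_subspace] unfolding Wn[symmetric] by blast
    moreover have "\<forall>d k n. \<forall>a\<in>weight_space d. \<forall>x\<in>?N \<inter> weight_space (of_nat n).
       Y a k x \<in> {0} \<union> (\<Union>m\<in>{m. of_nat m = of_nat n + d - of_int k - 1}. ?N \<inter> weight_space (of_nat m))"
    proof (intro allI ballI)
      fix d k n a x assume a: "a \<in> weight_space d" and x: "x \<in> ?N \<inter> weight_space (of_nat n)"
      have "Y a k x \<in> {0} \<union> (\<Union>m\<in>{m. of_nat m = of_nat n + d - of_int k - 1}. weight_space (of_nat m))"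
        using adm a x unfolding admissible_module_def by blast
      moreover have "Y a k x \<in> ?N" using x by (intro mode_span_submodule) blast
      ultimately show "Y a k x \<in> {0} \<union> (\<Union>m\<in>{m. of_nat m = of_nat n + d - of_int k - 1}. ?N \<inter> weight_space (of_nat m))"
        by blast
    qed
    ultimately have "admissible_submodule scale UNIV Y (\<lambda>n. weight_space (of_nat n)) ?N"
      by (simp add: admissible_submodule_def admissible_module_def)
    then have "?N = {0} \<or> ?N = UNIV"
      using simple unfolding simple_admissible_module_def by blast
    then have "?N = UNIV" using w(1) wN by auto
    then have "wcomp 0 vac = 0" using N_zero by blast
    then have "vac = 0" using wcomp_of_mem[OF vac_weight, of 0] by simp
    then have "w = 0" using Y_creation[of w] by simp
    then show False using w(1) by simp
  qed
  obtain M where M: "v = (\<Sum>i<M. wcomp (int i) v)" using wcomp_sum[of v] by blast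
  have "wcomp (int i) v \<in> span {vac}" for i
  proof (cases "i = 0")
    case True
    then show ?thesis using wcomp_mem[of 0 v] cft by (simp add: W_def)
  qed (simp add: zero span_zero)
  then have "(\<Sum>i<M. wcomp (int i) v) \<in> span {vac}" by (intro span_sum)
  then show ?thesis using M by simp
qed

lemma module_iso_zero:
  fixes h :: "'v \<Rightarrow> 'm::ab_group_add"
  assumes "module_iso scale UNIV Y s M action h" shows "h 0 = 0"
proof -
  have "h (0 + 0) = h 0 + h 0" using assms unfolding module_iso_def by blast
  then show ?thesis by simp
qed

interpretation ws: complex_vector_space "word_scale :: complex \<Rightarrow> (('v \<times> int) list \<Rightarrow> complex) \<Rightarrow> _"
  by (rule word_scale_vector_space)

text \<open>
  In a copy of \<open>V\<close> inside the module of functionals, a vector of degree \<open>0\<close> comes from a vector killed by all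
  modes that lower the degree, that is, from a multiple of the vacuum.
\<close>
lemma act_lowest_vector:
  assumes simple: "simple_admissible_module scale UNIV Y (\<lambda>n. weight_space (of_nat n))"
    and cft: "weight_space 0 = span {vac}"
    and iso: "module_iso scale UNIV Y word_scale S act h"
    and y: "y \<in> S" "y \<in> dual_grade 0" and a: "a \<in> W d" and d: "d > 0"
  shows "act a (d - 1) y = 0"
proof -
  have h: "bij_betw h UNIV S" "\<And>a n x. h (Y a n x) = act a n (h x)"
    using iso by (auto simp: module_iso_def)
  note h0 = module_iso_zero[OF iso]
  obtain v where v: "y = h v" using h(1) y(1) by (auto simp: bij_betw_def)
  obtain f where f: "level 0 f" "y = single 0 f" using y(2) by (auto simp: dual_grade_def)
  have "Y b k v = 0" if "b \<in> W \<beta>" "k \<ge> \<beta>" for b \<beta> k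
  proof -
    have "h (Y b k v) = act b k y" by (simp add: h(2) v)
    also have "\<dots> = 0" using that by (simp add: f(2) act_single[OF f(1) that(1)] single_negative)
    finally have "h (Y b k v) = h 0" by (simp add: h0)
    then show ?thesis using h(1) by (auto simp: bij_betw_def dest: injD)
  qed
  then have "v \<in> span {vac}" by (rule lowest_weight_vector_vacuum[OF simple cft])
  then obtain c where c: "v = c *s vac" by (auto simp: span_singleton)
  have "act a (d - 1) y = h (Y a (d - 1) v)" by (simp add: h(2) v)
  also have "Y a (d - 1) v = 0" using d by (simp add: c Y_vac_right)
  finally show ?thesis by (simp add: h0)
qed

text \<open>
  The function \<open>\<psi>(Y(a,z)vac)\<close> is regular at \<open>x = 1\<close> with value \<open>\<psi>(a)\<close>. By the residue
  theorem its residue at \<open>x = 0\<close> against \<open>x\<^bsup>d-1\<^esup> z\<^bsup>-1\<^esup>\<close> is \<open>-\<psi>(a)\<close>. The one against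
  \<open>x\<^sup>d z\<^bsup>-1\<^esup> = x\<^bsup>d-1\<^esup> z\<^bsup>-1\<^esup> + x\<^bsup>d-1\<^esup>\<close> is zero, because \<open>x\<^sup>d\<close> cancels the pole.
\<close>
lemma dual_mode_vacuum_value:
  assumes \<psi>: "level 0 \<psi>" and a: "a \<in> W d"
  shows "dual_mode \<psi> d a (d - 1) 0 vac = \<psi> a"
proof -
  have "emode a (d - 1) (-1) vac = (\<Sum>j<Suc 0. (of_int (d - 1) gchoose j) *s Y a (-1 + int j) vac)"
    unfolding emode_def by (rule binsum_eq) (simp add: Y_vac_right)
  then have e: "emode a (d - 1) (-1) vac = a" by (simp add: Y_creation)
  have "dual_mode \<psi> d a (d - 1 + 1) (-1) vac = dual_mode \<psi> d a (d - 1) (-1) vac + dual_mode \<psi> d a (d - 1) (-1 + 1) vac"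
    by (rule pascalD[OF pascal_dual_mode[OF \<psi> a]])
  moreover have "dual_mode \<psi> d a (d - 1 + 1) (-1) vac = 0" by (rule dual_mode_zero[OF \<psi> a]) simp
  moreover have "dual_mode \<psi> d a (d - 1) (-1) vac = - \<psi> a" using dual_mode_eq[OF \<psi> a, of "d - 1" "-1" vac] e by simp
  ultimately show ?thesis by simp
qed

text \<open>
  The functional \<open>\<psi>\<close>, as a vector of degree \<open>0\<close>, is a sum of vectors of degree \<open>0\<close> in copies of \<open>V\<close>, hence
  is killed by \<open>a\<^bsub>(d-1)\<^esub>\<close>. The value of \<open>a\<^bsub>(d-1)\<^esub>\<psi>\<close> at the vacuum is \<open>\<psi>(a) \<noteq> 0\<close>.
\<close>
theorem holomorphic_not_classically_free:
  assumes cft: cft_type and hol: holomorphic and nt: nontrivial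
  shows "\<not> classically_free"
proof
  assume free: classically_free
  have W0: "weight_space 0 = span {vac}" using cft by (simp add: cft_type_def)
  have simple: "simple_admissible_module scale UNIV Y (\<lambda>n. weight_space (of_nat n))"
    and rational: rational
    and unique: "\<And>M action G. simple_admissible_module word_scale M action G \<Longrightarrow>
       \<exists>h. module_iso scale UNIV Y word_scale M action h"
    using hol unfolding holomorphic_def by blast+
  obtain \<psi> d a where \<psi>: "functional \<psi>" "\<forall>\<alpha> a b. a \<in> W \<alpha> \<longrightarrow> \<psi> (emode a \<alpha> (-2) b) = 0"
    and d: "d > 0" "a \<in> W d" "\<psi> a \<noteq> 0"
    using zhu_functional_exists[OF free W0 nt] by blast
  have l: "level 0 \<psi>" using \<psi> by (intro level_zeroI) auto
  define x where "x = single 0 \<psi>"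
  have x: "x \<in> dual_grade 0" using dual_gradeI[of 0 \<psi>] l by (simp add: x_def)
  then have xm: "x \<in> dual_module" by (simp add: dual_grade_iff)
  have "completely_reducible word_scale dual_module act dual_grade"
    using rational dual_module_admissible unfolding rational_def by blast
  then obtain \<S> where \<S>: "\<And>S. S \<in> \<S> \<Longrightarrow> admissible_submodule word_scale dual_module act dual_grade S"
      "\<And>S. S \<in> \<S> \<Longrightarrow> simple_admissible_module word_scale S act (\<lambda>n. S \<inter> dual_grade n)"
      "internal_direct_sum dual_module (\<lambda>S. S) \<S>"
    unfolding completely_reducible_def by blast
  obtain f where f: "\<forall>S\<in>\<S>. f S \<in> S" "\<forall>S. S \<notin> \<S> \<longrightarrow> f S = 0" "finite {S. f S \<noteq> 0}"
    "x = (\<Sum>S | f S \<noteq> 0. f S)"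
    using internal_direct_sum_obtain[OF \<S>(3) xm] by (elim exE conjE)
  have "\<exists>y. y \<in> S \<and> y \<in> dual_grade 0 \<and> component 0 (f S) = component 0 y" if S: "S \<in> \<S>" for S
  proof -
    have ds: "internal_direct_sum S (\<lambda>n. S \<inter> dual_grade n) UNIV"
      using \<S>(1)[OF S] by (simp add: admissible_submodule_def admissible_module_def)
    have fS: "f S \<in> S" using f(1) S by blast
    obtain g where g: "\<forall>n\<in>UNIV. g n \<in> S \<inter> dual_grade n" "finite {n. g n \<noteq> 0}" "f S = (\<Sum>n | g n \<noteq> 0. g n)"
      using internal_direct_sum_obtain[OF ds fS] by (elim exE conjE)
    have "component 0 (f S) v = component 0 (g 0) v" for v
    proof -
      have "component 0 (f S) v = (\<Sum>n | g n \<noteq> 0. component 0 (g n) v)" unfolding g(3) by (rule component_sum)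
      also have "\<dots> = (\<Sum>n | g n \<noteq> 0. if n = 0 then component 0 (g 0) v else 0)"
        using g(1) by (intro sum.cong HOL.refl) (auto simp: dual_grade_iff)
      also have "\<dots> = component 0 (g 0) v" using g(2) by (auto simp: sum.delta)
      finally show ?thesis .
    qed
    then show ?thesis using g(1) by blast
  qed
  then obtain y where y: "\<And>S. S \<in> \<S> \<Longrightarrow> y S \<in> S" "\<And>S. S \<in> \<S> \<Longrightarrow> y S \<in> dual_grade 0"
    "\<And>S. S \<in> \<S> \<Longrightarrow> component 0 (f S) = component 0 (y S)" by metis
  define T where "T = {S. f S \<noteq> 0}"
  have T: "finite T" "T \<subseteq> \<S>" using f by (auto simp: T_def)
  have ym: "y S \<in> dual_module" if "S \<in> T" for S using y(2) T(2) that by (auto simp: dual_grade_iff)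
  have "x = (\<Sum>S\<in>T. y S)"
  proof (rule dual_module_eqI[OF xm])
    show "(\<Sum>S\<in>T. y S) \<in> dual_module" using ym by (intro dual_module_closed)
    fix n
    show "component n x = component n (\<Sum>S\<in>T. y S)"
    proof
      fix v
      show "component n x v = component n (\<Sum>S\<in>T. y S) v"
      proof (cases "n = 0")
        case True
        have "component 0 x v = (\<Sum>S\<in>T. component 0 (f S) v)" unfolding f(4) T_def by (rule component_sum)
        also have "\<dots> = (\<Sum>S\<in>T. component 0 (y S) v)" using y(3) T(2) by (intro sum.cong HOL.refl) auto
        finally show ?thesis by (simp add: True component_sum)
      next
        case False
        have "component n (y S) v = 0" if "S \<in> T" for S using y(2) T(2) that False by (auto simp: dual_grade_iff)
        then show ?thesis using x False by (simp add: component_sum dual_grade_iff)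
      qed
    qed
  qed
  moreover have "act a (d - 1) (\<Sum>S\<in>T. y S) = 0"
  proof -
    have "(\<Sum>S\<in>U. y S) \<in> dual_module \<and> act a (d - 1) (\<Sum>S\<in>U. y S) = 0" if "finite U" "U \<subseteq> T" for U
      using that
    proof (induction U rule: finite_induct)
      case empty
      then show ?case by (simp add: dual_module_closed)
    next
      case (insert S U)
      then have S: "S \<in> \<S>" "y S \<in> dual_module" using T(2) ym by auto
      obtain h where "module_iso scale UNIV Y word_scale S act h" using unique[OF \<S>(2)[OF S(1)]] by blast
      from act_lowest_vector[OF simple W0 this y(1)[OF S(1)] y(2)[OF S(1)] d(2,1)]
      have "act a (d - 1) (y S) = 0" .
      with insert S(2) show ?case by (simp add: act_add_right dual_module_closed)
    qed
    with T(1) show ?thesis by blast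
  qed
  ultimately have "act a (d - 1) x = 0" by simp
  then have "single 0 (dual_mode \<psi> d a (d - 1) 0) = 0" by (simp add: x_def act_single[OF l d(2)])
  then have "component 0 (single 0 (dual_mode \<psi> d a (d - 1) 0)) vac = 0" by simp
  then have "\<psi> a = 0" by (simp add: component_single dual_mode_vacuum_value[OF l d(2)])
  with d(3) show False by simp
qed

end

text \<open>
  The decomposition of \<open>V\<close> into its weight spaces is part of \<open>V\<close> being an admissible module over itself.
\<close>
theorem theorem1p4:
  fixes scale :: "complex \<Rightarrow> 'v::ab_group_add \<Rightarrow> 'v"
    and vac :: 'v
    and Y :: "'v \<Rightarrow> int \<Rightarrow> 'v \<Rightarrow> 'v"
    and H :: "'v \<Rightarrow> 'v"
    and \<omega> :: 'v
  assumes "vertex_operator_algebra scale vac Y H \<omega>"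
    and "graded_vertex_algebra.cft_type scale vac H"
    and "graded_vertex_algebra.holomorphic scale vac Y H"
    and "vertex_algebra.nontrivial scale vac"
  shows "\<not> vertex_algebra.classically_free scale vac Y"
proof -
  interpret vertex_operator_algebra scale vac Y H \<omega> by (rule assms(1))
  have "N_graded_vertex_algebra scale vac Y H"
  proof
    show N_graded using assms(2) by (simp add: cft_type_def)
    show "internal_direct_sum UNIV (\<lambda>n. weight_space (of_nat n)) UNIV"
      using assms(3) by (simp add: holomorphic_def simple_admissible_module_def admissible_module_def)
  qed
  from N_graded_vertex_algebra.holomorphic_not_classically_free[OF this assms(2,3,4)]
  show ?thesis .
qed

end
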